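(* Let $g\ge1$ be a fixed integer. Suppose that for each real $0\le r<1$ and each integer $k\ge1$ there exists a number $C(r,k)$ such that for all tuples $\mathcal{X}=(X_1,\dots,X_g)$ of $k\times k$ complex matrices satisfying $\|\mathcal{X}\|_{row}\le r$, $$\sup_{d\ge1}\int_{U(d)^g}|\det(L_{\mathcal{X}}(\mathcal{U}))|^2\,d\mathcal{U}\le C(r,k).$$ Then for all integers $k,k'\ge1$ and all $g$-tuples $\mathcal{X}$ of $k\times k$ complex matrices and $\mathcal{Y}$ of $k'\times k'$ complex matrices with $\mathbf{rad}(\mathcal{X})<1$ and $\mathbf{rad}(\mathcal{Y})<1$, $$\lim_{d\to\infty}\int_{U(d)^g}\det(L_{\mathcal{X}}(\mathcal{U}))\,\overline{\det(L_{\mathcal{Y}}(\mathcal{U}))}\,d\mathcal{U}=\det\Big(I_k\otimes I_{k'}-\sum_{j=1}^gX_j\otimes\overline{Y_j}\Big)^{-1}.$$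
   Context: $U(d)$ is the $d\times d$ unitary group with normalized Haar probability measure, and $d\mathcal{U}=dU_1\times\cdots\times dU_g$ on $U(d)^g$, $\mathcal{U}=(U_1,\dots,U_g)$. $\otimes$ is the Kronecker product and $\overline{Y}$ is the entrywise complex conjugate. For a $g$-tuple $\mathcal{X}$ of $k\times k$ matrices: $L_{\mathcal{X}}(\mathcal{U})=I_k\otimes I_d+\sum_{j=1}^gX_j\otimes U_j$; $\|\mathcal{X}\|_{row}=\|X_1X_1^*+\cdots+X_gX_g^*\|^{1/2}$ (operator norm); $\mathbf{rad}(\mathcal{X})=\mathrm{rad}\big(\sum_{j=1}^gX_j\otimes\overline{X_j}\big)^{1/2}$, where $\mathrm{rad}$ is the ordinary spectral radius. *)

theory Defs
  imports
    "HOL-Probability.Probability"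
    "Jordan_Normal_Form.Spectral_Radius"
    "Jordan_Normal_Form.Schur_Decomposition"
begin

text \<open>
  The size of the unitary matrices varies within the statement, so matrices are those of the
  carrier-based type of Jordan Normal Form. A \<open>g\<close>-tuple of matrices is a function
  on \<open>nat\<close> of which only the values at \<open>0, ..., g - 1\<close> matter.
\<close>

definition mat_tuple :: "nat \<Rightarrow> nat \<Rightarrow> (nat \<Rightarrow> complex mat) \<Rightarrow> bool" where
  "mat_tuple g k X \<longleftrightarrow> (\<forall>j<g. X j \<in> carrier_mat k k)"

text \<open>The sum of the \<open>n \<times> n\<close> matrices \<open>F 0, ..., F (g - 1)\<close>; the type \<open>mat\<close> is not an
  instance of \<open>comm_monoid_add\<close>, as its zero depends on the dimensions.\<close>

definition mat_sum :: "nat \<Rightarrow> nat \<Rightarrow> (nat \<Rightarrow> complex mat) \<Rightarrow> complex mat" where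
  "mat_sum n g F = Matrix.mat n n (\<lambda>ij. \<Sum>j<g. F j $$ ij)"

definition kron :: "complex mat \<Rightarrow> complex mat \<Rightarrow> complex mat" (infixl \<open>\<otimes>\<^sub>K\<close> 70) where
  "A \<otimes>\<^sub>K B = Matrix.mat (dim_row A * dim_row B) (dim_col A * dim_col B)
     (\<lambda>(i, j). A $$ (i div dim_row B, j div dim_col B) * B $$ (i mod dim_row B, j mod dim_col B))"

definition conj_mat :: "complex mat \<Rightarrow> complex mat" where
  "conj_mat A = map_mat cnj A"

definition l2_norm_vec :: "complex Matrix.vec \<Rightarrow> real" where
  "l2_norm_vec v = L2_set (\<lambda>i. norm (vec_index v i)) {..<dim_vec v}"

definition op_norm_mat :: "complex mat \<Rightarrow> real" where
  "op_norm_mat A =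
     (SUP v \<in> {v \<in> carrier_vec (dim_col A). l2_norm_vec v \<le> 1}. l2_norm_vec (A *\<^sub>v v))"

definition row_norm :: "nat \<Rightarrow> nat \<Rightarrow> (nat \<Rightarrow> complex mat) \<Rightarrow> real" where
  "row_norm g k X = sqrt (op_norm_mat (mat_sum k g (\<lambda>j. X j * mat_adjoint (X j))))"

definition tuple_rad :: "nat \<Rightarrow> nat \<Rightarrow> (nat \<Rightarrow> complex mat) \<Rightarrow> real" where
  "tuple_rad g k X = sqrt (spectral_radius (mat_sum (k * k) g (\<lambda>j. X j \<otimes>\<^sub>K conj_mat (X j))))"

text \<open>The pencil \<open>L\<^sub>X(U)\<close> for \<open>k \<times> k\<close> matrices \<open>X j\<close> and \<open>d \<times> d\<close> matrices \<open>U j\<close>.\<close>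

definition lin_pencil ::
    "nat \<Rightarrow> nat \<Rightarrow> nat \<Rightarrow> (nat \<Rightarrow> complex mat) \<Rightarrow> (nat \<Rightarrow> complex mat) \<Rightarrow> complex mat" where
  "lin_pencil g k d X U = 1\<^sub>m k \<otimes>\<^sub>K 1\<^sub>m d + mat_sum (k * d) g (\<lambda>j. X j \<otimes>\<^sub>K U j)"

definition unitary_group :: "nat \<Rightarrow> complex mat set" where
  "unitary_group d =
     {U \<in> carrier_mat d d. U * mat_adjoint U = 1\<^sub>m d \<and> mat_adjoint U * U = 1\<^sub>m d}"

text \<open>The Borel \<open>\<sigma>\<close>-algebra of \<open>U(d)\<close> as a subspace of the \<open>d * d\<close>-fold power of the
  complex plane: the trace on \<open>U(d)\<close> of the product \<open>\<sigma>\<close>-algebra, which is the Borel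
  \<open>\<sigma>\<close>-algebra of the product.\<close>

definition unitary_borel :: "nat \<Rightarrow> complex mat measure" where
  "unitary_borel d = vimage_algebra (unitary_group d)
     (\<lambda>U. \<lambda>ij \<in> {..<d} \<times> {..<d}. U $$ ij) (PiM ({..<d} \<times> {..<d}) (\<lambda>_. borel))"

text \<open>The normalized Haar measure of the compact group \<open>U(d)\<close>: the unique left-invariant Borel
  probability measure.\<close>

definition is_haar_unitary :: "nat \<Rightarrow> complex mat measure \<Rightarrow> bool" where
  "is_haar_unitary d M \<longleftrightarrow> prob_space M \<and> space M = unitary_group d \<and>
     sets M = sets (unitary_borel d) \<and> (\<forall>V \<in> unitary_group d. distr M M (\<lambda>U. V * U) = M)"

definition haar_power :: "nat \<Rightarrow> complex mat measure \<Rightarrow> (nat \<Rightarrow> complex mat) measure" where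
  "haar_power g M = PiM {..<g} (\<lambda>_. M)"

end

theory Submission
  imports Defs "HOL-Real_Asymp.Real_Asymp"
begin

text \<open>
  The joint spectral radius condition makes \<open>X\<close> jointly similar to a strict row contraction: with
  \<open>\<Phi>(P) = \<Sum> X\<^sub>j P X\<^sub>j\<^sup>*\<close>, a long partial sum \<open>P\<close> of \<open>\<Sum> \<Phi>\<^sup>n(I)\<close> satisfies \<open>\<Phi>(P) \<le> P - I/2\<close>, and one
  conjugates by a factor of \<open>P\<close>. The homogeneous part of degree \<open>n\<close> of \<open>det (L\<^sub>X U)\<close> is the trace of
  \<open>\<Sum> X\<^sub>j \<otimes> U\<^sub>j\<close> on the \<open>n\<close>-th exterior power, hence invariant under similarity, and parts of
  different degrees are orthogonal because Haar measure is invariant under \<open>U \<mapsto> z U\<close>. The hypothesis,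
  applied to a slight dilation of the contraction, therefore bounds the homogeneous parts by a
  geometric sequence uniformly in \<open>d\<close>, and the limit may be taken degree by degree.

  In each degree one needs the limits of moments of traces of words in the \<open>U\<^sub>j\<close>. Differentiating the
  moments along unitary paths gives tensors that are invariant under the Lie algebra; for large \<open>d\<close>
  such a tensor is a combination of permutations, as is seen by moving indices to fresh ones, and
  the Gram matrix of the permutations tends to the identity. The degree \<open>n\<close> limit is the trace of
  \<open>\<Sum> X\<^sub>j \<otimes> cnj Y\<^sub>j\<close> on the \<open>n\<close>-th symmetric power, and these sum to the inverse determinant.\<close>

subsection \<open>Power traces of permutations\<close>

text \<open>The determinant has degree \<open>k * d\<close> in the \<open>U j\<close>, which grows
  with \<open>d\<close>, so limits in each fixed degree prove nothing without a bound uniform in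
  \<open>d\<close>. The hypothesis supplies it in terms of the row norm, which similarity does not
  preserve; hence the contraction must be found inside the similarity class of \<open>X\<close>.

  Exterior and symmetric powers never occur as spaces: their traces are averages over permutations
  of products of traces, with the sign or the trivial character. In this form the tensor product
  splits into word traces of \<open>X\<close> times word traces of \<open>U\<close>, and only the
  latter are integrated. In the limit a permutation is paired with its conjugates only, which have
  the same sign. The two signs cancel, and this is how exterior traces on one side produce symmetric
  traces on the other.

  Left translation moves the row indices of the entries only, so the column indices are parameters
  of the invariant tensors. Orthonormality of the columns gives the linear equations that determine
  the coefficients of the permutations.\<close>

abbreviation tuples :: "nat \<Rightarrow> 'i set \<Rightarrow> (nat \<Rightarrow> 'i) set" where
  "tuples n S \<equiv> {..<n} \<rightarrow>\<^sub>E S"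

abbreviation perms :: "nat \<Rightarrow> (nat \<Rightarrow> nat) set" where
  "perms n \<equiv> {p. p permutes {..<n}}"

lemma finite_perms [simp]: "finite (perms n)"
  by (rule finite_permutations) simp

lemma tuples_comp_permutes:
  assumes "p permutes {..<n}" "f \<in> tuples n S"
  shows "f \<circ> p \<in> tuples n S"
proof (rule PiE_I)
  fix x assume "x \<in> {..<n}"
  then show "(f \<circ> p) x \<in> S" using assms permutes_in_image[OF assms(1)] by auto
next
  fix x assume "x \<notin> {..<n}"
  then show "(f \<circ> p) x = undefined" using assms by (auto simp: permutes_def PiE_def extensional_def)
qed

lemma sum_tuples_permute:
  assumes p: "p permutes {..<n}"
  shows "(\<Sum>f\<in>tuples n S. w (f \<circ> p)) = (\<Sum>f\<in>tuples n S. w f)"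
  by (rule sum.reindex_bij_witness[where i = "\<lambda>f. f \<circ> inv_into UNIV p" and j = "\<lambda>f. f \<circ> p"])
    (use p in \<open>auto simp: comp_assoc permutes_inv_o intro!: tuples_comp_permutes permutes_inv\<close>)

text \<open>A position-dependent version of the power trace \<open>\<Prod> tr (A\<^sup>l)\<close>, the product being over the
  cycle lengths of \<open>s\<close>: if \<open>A a\<close> does not depend on \<open>a\<close>, this is its value.\<close>

definition ptr :: "nat \<Rightarrow> (nat \<Rightarrow> nat) \<Rightarrow> 'i set \<Rightarrow> (nat \<Rightarrow> 'i \<Rightarrow> 'i \<Rightarrow> complex) \<Rightarrow> complex" where
  "ptr n s S A = (\<Sum>f\<in>tuples n S. \<Prod>a<n. A a (f a) (f (s a)))"

lemma ptr_cong:
  assumes "s permutes {..<n}" "\<And>a x y. a < n \<Longrightarrow> x \<in> S \<Longrightarrow> y \<in> S \<Longrightarrow> A a x y = B a x y"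
  shows "ptr n s S A = ptr n s S B"
  unfolding ptr_def
  by (intro sum.cong prod.cong refl assms(2)) (use permutes_in_image[OF assms(1)] in auto)

text \<open>The cyclic property of the trace, for a rectangular \<open>Q\<close>. Position
  \<open>a\<close> ends where position \<open>s a\<close> begins, so reindexing the intermediate
  tuple by \<open>s\<close> moves \<open>Q\<close> across every junction. \<open>Q\<close> is the
  same at all positions, while \<open>B\<close> may vary with the position.\<close>

lemma ptr_cyclic:
  assumes s: "s permutes {..<n}" and fin: "finite S" "finite R"
  shows "ptr n s S (\<lambda>a x y. \<Sum>z\<in>R. Q x z * B a z y) = ptr n s R (\<lambda>a x y. \<Sum>z\<in>S. B a x z * Q z y)"
proof -
  have "ptr n s R (\<lambda>a x y. \<Sum>z\<in>S. B a x z * Q z y)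
      = (\<Sum>h\<in>tuples n R. \<Sum>f\<in>tuples n S. \<Prod>a<n. B a (h a) (f a) * Q (f a) (h (s a)))"
    unfolding ptr_def using fin by (subst prod_sum_PiE) auto
  also have "\<dots> = (\<Sum>h\<in>tuples n R. \<Sum>f\<in>tuples n S. \<Prod>a<n. B a (h a) (f (s a)) * Q (f (s a)) (h (s a)))"
    by (subst sum_tuples_permute[OF s, symmetric]) (simp add: o_def)
  also have "\<dots> = (\<Sum>h\<in>tuples n R. \<Sum>f\<in>tuples n S. \<Prod>a<n. B a (h a) (f (s a)) * Q (f a) (h a))"
    using prod.permute[OF s, of "\<lambda>a. Q (f a) (h a)" for f h]
    by (simp add: prod.distrib o_def)
  also have "\<dots> = (\<Sum>f\<in>tuples n S. \<Sum>h\<in>tuples n R. \<Prod>a<n. Q (f a) (h a) * B a (h a) (f (s a)))"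
    by (subst sum.swap) (simp add: mult.commute)
  also have "\<dots> = ptr n s S (\<lambda>a x y. \<Sum>z\<in>R. Q x z * B a z y)"
    unfolding ptr_def using fin by (subst prod_sum_PiE) auto
  finally show ?thesis ..
qed

lemma ptr_times:
  assumes s: "s permutes {..<n}"
  shows "ptr n s (S \<times> R) (\<lambda>a p q. A a (fst p) (fst q) * B a (snd p) (snd q))
       = ptr n s S A * ptr n s R B"
proof -
  have sn: "s a < n" if "a < n" for a
    using permutes_in_image[OF s] that by auto
  have "ptr n s S A * ptr n s R B = (\<Sum>(f, h)\<in>tuples n S \<times> tuples n R.
      \<Prod>a<n. A a (f a) (f (s a)) * B a (h a) (h (s a)))"
    by (simp add: ptr_def sum_product sum.cartesian_product prod.distrib)
  also have "\<dots> = ptr n s (S \<times> R) (\<lambda>a p q. A a (fst p) (fst q) * B a (snd p) (snd q))"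
    unfolding ptr_def
    by (rule sum.reindex_bij_witness[where
          i = "\<lambda>u. (restrict (fst \<circ> u) {..<n}, restrict (snd \<circ> u) {..<n})" and
          j = "\<lambda>(f, h). restrict (\<lambda>a. (f a, h a)) {..<n}"])
      (auto simp: fun_eq_iff PiE_def extensional_def Pi_def restrict_def mem_Times_iff sn
        intro!: prod.cong)
  finally show ?thesis ..
qed

lemma ptr_sum:
  assumes "finite J"
  shows "ptr n s S (\<lambda>a x y. \<Sum>j\<in>J. A a j x y) = (\<Sum>c\<in>tuples n J. ptr n s S (\<lambda>a. A a (c a)))"
  unfolding ptr_def using assms by (simp add: prod_sum_PiE, subst sum.swap, simp)

text \<open>Relabelling the positions by \<open>p\<close> turns \<open>s\<close> into its conjugate
  \<open>t\<close> and carries the matrices along. This identifies the traces of words that are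
  matched in the limit.\<close>

lemma ptr_conjugate:
  assumes s: "s permutes {..<n}" and p: "p permutes {..<n}" and t: "p \<circ> t = s \<circ> p"
  shows "ptr n t S (\<lambda>a. A (p a)) = ptr n s S A"
proof -
  have "ptr n t S (\<lambda>a. A (p a)) = (\<Sum>f\<in>tuples n S. \<Prod>a<n. A (p a) (f (p a)) (f (p (t a))))"
    unfolding ptr_def by (subst sum_tuples_permute[OF p, symmetric]) simp
  also have "\<dots> = (\<Sum>f\<in>tuples n S. \<Prod>a<n. A (p a) (f (p a)) (f (s (p a))))"
    using t by (simp add: fun_eq_iff)
  also have "\<dots> = ptr n s S A"
    unfolding ptr_def using prod.permute[OF p, of "\<lambda>a. A a (f a) (f (s a))" for f]
    by (simp add: o_def)
  finally show ?thesis .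
qed

lemma ptr_reindex:
  assumes s: "s permutes {..<n}" and h: "bij_betw h R S"
  shows "ptr n s R (\<lambda>a x y. A a (h x) (h y)) = ptr n s S A"
proof -
  have sn: "s a < n" if "a < n" for a
    using permutes_in_image[OF s] that by auto
  let ?g = "the_inv_into R h"
  have g: "?g (h x) = x" if "x \<in> R" for x
    using h that by (auto simp: bij_betw_def the_inv_into_f_f)
  have hg: "h (?g y) = y" "?g y \<in> R" if "y \<in> S" for y
    using h that by (auto simp: bij_betw_def f_the_inv_into_f the_inv_into_into)
  have hS: "h x \<in> S" if "x \<in> R" for x
    using h that by (auto simp: bij_betw_def)
  show ?thesis
    unfolding ptr_def
    by (rule sum.reindex_bij_witness[where
          i = "\<lambda>u. restrict (?g \<circ> u) {..<n}" and j = "\<lambda>u. restrict (h \<circ> u) {..<n}"])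
      (auto simp: fun_eq_iff PiE_def extensional_def Pi_def restrict_def sn g hg hS
        intro!: prod.cong)
qed

lemma ptr_scale: "ptr n s S (\<lambda>a x y. z * A a x y) = z ^ n * ptr n s S A"
  by (simp add: ptr_def prod.distrib sum_distrib_left)

lemma cnj_ptr: "cnj (ptr n s S A) = ptr n s S (\<lambda>a x y. cnj (A a x y))"
  by (simp add: ptr_def)

text \<open>A nonvanishing term has \<open>f a \<le> f (s a)\<close> at every position. Since
  \<open>s\<close> permutes the positions, both sides have the same sum, so equality holds
  throughout. Only tuples constant on the cycles of \<open>s\<close> survive, and they see the
  diagonal alone.\<close>

lemma ptr_triangular:
  fixes m :: nat
  assumes s: "s permutes {..<n}" and tri: "\<And>x y. x < m \<Longrightarrow> y < x \<Longrightarrow> A x y = 0"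
  shows "ptr n s {..<m} (\<lambda>_. A) = (\<Sum>f\<in>tuples n {..<m}. if f \<circ> s = f then \<Prod>a<n. A (f a) (f a) else 0)"
  unfolding ptr_def
proof (rule sum.cong[OF refl])
  fix f :: "nat \<Rightarrow> nat" assume f: "f \<in> tuples n {..<m}"
  have fm: "f a < m" if "a < n" for a
    using f that by auto
  show "(\<Prod>a<n. A (f a) (f (s a))) = (if f \<circ> s = f then \<Prod>a<n. A (f a) (f a) else 0)"
  proof (cases "f \<circ> s = f")
    case True
    then have "f (s a) = f a" for a
      by (metis comp_apply)
    then show ?thesis
      using True by simp
  next
    case False
    then obtain b where b: "f (s b) \<noteq> f b"
      by (auto simp: fun_eq_iff)
    then have bn: "b < n"
      using s by (metis permutes_def lessThan_iff)
    have "\<exists>a<n. f (s a) < f a"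
    proof (rule ccontr)
      assume "\<not> ?thesis"
      then have le: "\<forall>a<n. f a \<le> f (s a)"
        by (meson not_le)
      have "(\<Sum>a<n. f a) < (\<Sum>a<n. f (s a))"
        by (rule sum_strict_mono_ex1) (use le b bn in \<open>auto intro!: bexI[of _ b] simp: le_neq_implies_less\<close>)
      then show False
        using sum.permute[OF s, of f] by (simp add: o_def)
    qed
    then show ?thesis
      using False tri fm by (subst prod_zero) auto
  qed
qed

subsection \<open>Symmetric and exterior power traces\<close>

definition msets :: "nat \<Rightarrow> 'i set \<Rightarrow> 'i multiset set" where
  "msets n S = {M. set_mset M \<subseteq> S \<and> size M = n}"

text \<open>For the trivial character this is the order of the stabilizer, the product of the
  factorials of the multiplicities in \<open>f\<close>. For the sign it is 1 if \<open>f\<close> is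
  injective on the \<open>n\<close> positions and 0 otherwise.\<close>

definition stab_weight :: "((nat \<Rightarrow> nat) \<Rightarrow> complex) \<Rightarrow> nat \<Rightarrow> (nat \<Rightarrow> 'i) \<Rightarrow> complex" where
  "stab_weight chi n f = (\<Sum>p\<in>perms n. if f \<circ> p = f then chi p else 0)"

definition tuple_mset :: "nat \<Rightarrow> (nat \<Rightarrow> 'i) \<Rightarrow> 'i multiset" where
  "tuple_mset n f = image_mset f (mset_set {..<n})"

text \<open>What the recursion over \<open>n\<close> uses of the trivial character
  (\<open>e = 1\<close>) and of the sign (\<open>e = -1\<close>), so that one induction serves
  symmetric and exterior powers. The transpositions are those that adjoin the new point
  \<open>n\<close> to a permutation of the smaller points.\<close>

definition chi_sym :: "complex \<Rightarrow> ((nat \<Rightarrow> nat) \<Rightarrow> complex) \<Rightarrow> bool" where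
  "chi_sym e chi \<longleftrightarrow> chi id = 1 \<and>
    (\<forall>n b q. b < n \<longrightarrow> q permutes {..<n} \<longrightarrow> chi (Transposition.transpose n b \<circ> q) = e * chi q)"

lemma chi_sym_one: "chi_sym 1 (\<lambda>_. 1)"
  by (simp add: chi_sym_def)

lemma chi_sym_sign: "chi_sym (-1) (\<lambda>p. of_int (sign p))"
  unfolding chi_sym_def
proof (intro conjI allI impI)
  fix n b :: nat and q assume "b < n" and q: "q permutes {..<n}"
  have "permutation q"
    using q permutation_permutes by blast
  then have "sign (Transposition.transpose n b \<circ> q) = - sign q"
    using \<open>b < n\<close> by (simp add: sign_compose permutation_swap_id sign_swap_id)
  then show "of_int (sign (Transposition.transpose n b \<circ> q)) = - 1 * of_int (sign q)"
    by simp
qed simp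

lemma finite_msets: "finite S \<Longrightarrow> finite (msets n S)"
proof (induction n)
  case (Suc n)
  have "msets (Suc n) S \<subseteq> (\<lambda>(i, M). add_mset i M) ` (S \<times> msets n S)"
  proof
    fix N assume N: "N \<in> msets (Suc n) S"
    then obtain i M where "N = add_mset i M"
      by (auto simp: msets_def size_Suc_Diff1 dest!: size_eq_Suc_imp_eq_union)
    then show "N \<in> (\<lambda>(i, M). add_mset i M) ` (S \<times> msets n S)"
      using N by (auto simp: msets_def intro!: image_eqI[of _ _ "(i, M)"])
  qed
  with Suc show ?case
    by (meson finite_SigmaI finite_imageI finite_subset)
qed (simp add: msets_def)

text \<open>Each permutation of \<open>n + 1\<close> points is uniquely a permutation
  \<open>q\<close> of the first \<open>n\<close> points followed by the transposition of
  \<open>n\<close> with some \<open>b \<le> n\<close>. It fixes the extended tuple iff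
  \<open>q\<close> fixes \<open>f\<close> and entry \<open>b\<close> is \<open>i\<close>. The case
  \<open>b = n\<close> gives the 1, and each \<open>b < n\<close> with \<open>f b = i\<close> gives
  an \<open>e\<close>.\<close>

lemma stab_weight_Suc:
  assumes chi: "chi_sym e chi"
  shows "stab_weight chi (Suc n) (f(n := i)) = (1 + e * of_nat (count (tuple_mset n f) i)) * stab_weight chi n f"
proof -
  let ?f = "f(n := i)"
  have ins: "{..<Suc n} = insert n {..<n}"
    by auto
  have fix_iff: "?f \<circ> q = ?f \<longleftrightarrow> f \<circ> q = f" if q: "q permutes {..<n}" for q
  proof -
    have "q n = n" "\<And>x. q x = n \<longleftrightarrow> x = n"
      using q by (auto simp: permutes_def)
    then show ?thesis
      by (simp add: fun_eq_iff) metis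
  qed
  have iff: "?f \<circ> (Transposition.transpose n b \<circ> q) = ?f \<longleftrightarrow> ?f b = i \<and> f \<circ> q = f"
    if q: "q permutes {..<n}" for b q
  proof -
    have qn: "q n = n"
      using q by (auto simp: permutes_def)
    show ?thesis
    proof
      assume L: "?f \<circ> (Transposition.transpose n b \<circ> q) = ?f"
      have b: "?f b = i"
        using fun_cong[OF L, of n] qn by simp
      then have "?f \<circ> Transposition.transpose n b = ?f"
        by (auto simp: fun_eq_iff Transposition.transpose_def)
      then have "?f \<circ> q = ?f"
        using L by (metis comp_assoc)
      with b q show "?f b = i \<and> f \<circ> q = f"
        using fix_iff by blast
    next
      assume R: "?f b = i \<and> f \<circ> q = f"
      then have "?f \<circ> Transposition.transpose n b = ?f"
        by (auto simp: fun_eq_iff Transposition.transpose_def)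
      then show "?f \<circ> (Transposition.transpose n b \<circ> q) = ?f"
        using R q fix_iff by (metis comp_assoc)
    qed
  qed
  have "stab_weight chi (Suc n) ?f = (\<Sum>b\<in>insert n {..<n}. \<Sum>q\<in>perms n.
      if ?f b = i \<and> f \<circ> q = f then chi (Transposition.transpose n b \<circ> q) else 0)"
    unfolding stab_weight_def ins
    by (subst sum_over_permutations_insert) (auto simp: iff intro!: sum.cong)
  also have "\<dots> = stab_weight chi n f + (\<Sum>b<n. if f b = i then e * stab_weight chi n f else 0)"
  proof -
    have "(\<Sum>q\<in>perms n. if ?f b = i \<and> f \<circ> q = f then chi (Transposition.transpose n b \<circ> q) else 0)
        = (if f b = i then e * stab_weight chi n f else 0)" if "b < n" for b
      using chi that by (auto simp: stab_weight_def chi_sym_def sum_distrib_left intro!: sum.cong)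
    then show ?thesis
      by (simp add: stab_weight_def cong: if_cong)
  qed
  also have "(\<Sum>b<n. if f b = i then e * stab_weight chi n f else 0)
      = count (tuple_mset n f) i * (e * stab_weight chi n f)"
    by (simp add: tuple_mset_def count_image_mset sum.If_cases Int_def vimage_def conj_commute)
  finally show ?thesis
    by (simp only: distrib_right mult_1_left mult.assoc) (simp only: mult_ac)
qed

lemma sum_tuples_Suc:
  assumes "finite S"
  shows "(\<Sum>f\<in>tuples (Suc n) S. w f) = (\<Sum>f\<in>tuples n S. \<Sum>i\<in>S. w (f(n := i)))"
proof -
  have "(\<Sum>f\<in>tuples n S. \<Sum>i\<in>S. w (f(n := i))) = (\<Sum>(f, i)\<in>tuples n S \<times> S. w (f(n := i)))"
    by (simp add: sum.cartesian_product)
  also have "\<dots> = (\<Sum>f\<in>tuples (Suc n) S. w f)"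
    by (rule sum.reindex_bij_witness[where i = "\<lambda>f. (f(n := undefined), f n)" and j = "\<lambda>(f, i). f(n := i)"])
      (auto simp: fun_eq_iff PiE_def extensional_def Pi_def)
  finally show ?thesis ..
qed

text \<open>The passage from tuples to multisets. Removing the last entry \<open>i\<close> from a
  tuple with multiset \<open>M\<close> leaves \<open>count M i - 1\<close> copies of
  \<open>i\<close>, whence the factor in the recursion required of \<open>c\<close>. The solutions
  used are the constant 1 for \<open>e = 1\<close> and \<open>simple_ind\<close> for
  \<open>e = -1\<close>.\<close>

lemma sum_stab_weight:
  fixes c :: "'i multiset \<Rightarrow> complex" and e :: complex
  assumes chi: "chi_sym e chi" and fin: "finite S"
    and c0: "c {#} = 1"
    and c: "\<And>M. (\<Sum>i\<in>set_mset M. c (M - {#i#}) * (1 + e * (of_nat (count M i) - 1))) = of_nat (size M) * c M"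
  shows "(\<Sum>f\<in>tuples n S. stab_weight chi n f * w (tuple_mset n f)) = fact n * (\<Sum>M\<in>msets n S. c M * w M)"
proof (induction n arbitrary: w)
  case 0
  have "msets 0 S = {{#}}"
    by (auto simp: msets_def)
  then show ?case
    using chi c0 by (simp add: stab_weight_def tuple_mset_def chi_sym_def)
next
  case (Suc n)
  have cnt: "tuple_mset (Suc n) (f(n := i)) = add_mset i (tuple_mset n f)" for f :: "nat \<Rightarrow> 'i" and i
  proof -
    have "image_mset (f(n := i)) (mset_set {..<n}) = image_mset f (mset_set {..<n})"
      by (rule image_mset_cong) auto
    then show ?thesis
      by (simp add: tuple_mset_def lessThan_Suc)
  qed
  have "(\<Sum>f\<in>tuples (Suc n) S. stab_weight chi (Suc n) f * w (tuple_mset (Suc n) f))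
      = (\<Sum>f\<in>tuples n S. stab_weight chi n f *
          (\<Sum>i\<in>S. (1 + e * of_nat (count (tuple_mset n f) i)) * w (add_mset i (tuple_mset n f))))"
    by (simp add: sum_tuples_Suc[OF fin] stab_weight_Suc[OF chi] cnt sum_distrib_left mult_ac)
  also have "\<dots> = fact n * (\<Sum>M\<in>msets n S. c M * (\<Sum>i\<in>S. (1 + e * of_nat (count M i)) * w (add_mset i M)))"
    by (rule Suc.IH)
  also have "(\<Sum>M\<in>msets n S. c M * (\<Sum>i\<in>S. (1 + e * of_nat (count M i)) * w (add_mset i M)))
      = (\<Sum>(M, i)\<in>msets n S \<times> S. c M * (1 + e * of_nat (count M i)) * w (add_mset i M))"
    by (simp add: sum.cartesian_product sum_distrib_left mult_ac)
  also have "\<dots> = (\<Sum>(N, i)\<in>(SIGMA N:msets (Suc n) S. set_mset N). c (N - {#i#}) * (1 + e * (of_nat (count N i) - 1)) * w N)"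
    by (rule sum.reindex_bij_witness[where i = "\<lambda>(N, i). (N - {#i#}, i)" and j = "\<lambda>(M, i). (add_mset i M, i)"])
      (auto simp: msets_def size_Diff_singleton dest: in_diffD)
  also have "\<dots> = (\<Sum>N\<in>msets (Suc n) S. (\<Sum>i\<in>set_mset N. c (N - {#i#}) * (1 + e * (of_nat (count N i) - 1))) * w N)"
    by (subst sum.Sigma[symmetric]) (auto simp: finite_msets fin sum_distrib_right)
  also have "\<dots> = (\<Sum>N\<in>msets (Suc n) S. of_nat (Suc n) * c N * w N)"
    by (subst c) (auto simp: msets_def intro!: sum.cong)
  finally show ?case
    by (simp add: sum_distrib_left mult_ac)
qed

text \<open>The trace of \<open>A\<close> on the symmetric and the exterior power, up to the choice of \<open>chi\<close>.\<close>

definition power_trace :: "((nat \<Rightarrow> nat) \<Rightarrow> complex) \<Rightarrow> nat \<Rightarrow> 'i set \<Rightarrow> ('i \<Rightarrow> 'i \<Rightarrow> complex) \<Rightarrow> complex" where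
  "power_trace chi n S A = (\<Sum>p\<in>perms n. chi p * ptr n p S (\<lambda>_. A)) / fact n"

abbreviation "sym_trace \<equiv> power_trace (\<lambda>_. 1)"
abbreviation "ext_trace \<equiv> power_trace (\<lambda>p. of_int (sign p))"

text \<open>With \<open>c = 1\<close> this is the complete homogeneous symmetric polynomial of
  degree \<open>n\<close> in the values of \<open>mu\<close>, with \<open>c = simple_ind\<close> the
  elementary one.\<close>

definition mset_gen :: "('i multiset \<Rightarrow> complex) \<Rightarrow> ('i \<Rightarrow> complex) \<Rightarrow> nat \<Rightarrow> 'i set \<Rightarrow> complex" where
  "mset_gen c mu n S = (\<Sum>M\<in>msets n S. c M * (\<Prod>x\<in>#M. mu x))"

lemma power_trace_triangular:
  fixes c :: "nat multiset \<Rightarrow> complex" and e :: complex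
  assumes chi: "chi_sym e chi" and c0: "c {#} = 1"
    and c: "\<And>M. (\<Sum>i\<in>set_mset M. c (M - {#i#}) * (1 + e * (of_nat (count M i) - 1))) = of_nat (size M) * c M"
    and tri: "\<And>x y. x < m \<Longrightarrow> y < x \<Longrightarrow> A x y = 0"
  shows "power_trace chi n {..<m} A = mset_gen c (\<lambda>x. A x x) n {..<m}"
proof -
  have pm: "(\<Prod>a<n. A (f a) (f a)) = (\<Prod>x\<in>#tuple_mset n f. A x x)" for f
    by (simp add: tuple_mset_def prod_unfold_prod_mset multiset.map_comp o_def)
  have pt: "ptr n p {..<m} (\<lambda>_. A) = (\<Sum>f\<in>tuples n {..<m}. if f \<circ> p = f then \<Prod>a<n. A (f a) (f a) else 0)"
    if "p permutes {..<n}" for p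
    by (rule ptr_triangular[OF that tri])
  have "(\<Sum>p\<in>perms n. chi p * ptr n p {..<m} (\<lambda>_. A))
      = (\<Sum>p\<in>perms n. \<Sum>f\<in>tuples n {..<m}. (if f \<circ> p = f then chi p else 0) * (\<Prod>x\<in>#tuple_mset n f. A x x))"
    by (intro sum.cong refl) (simp add: pt sum_distrib_left, intro sum.cong refl, simp add: pm)
  also have "\<dots> = (\<Sum>f\<in>tuples n {..<m}. stab_weight chi n f * (\<Prod>x\<in>#tuple_mset n f. A x x))"
    by (subst sum.swap) (simp add: stab_weight_def sum_distrib_right)
  also have "\<dots> = fact n * mset_gen c (\<lambda>x. A x x) n {..<m}"
    unfolding mset_gen_def
    by (rule sum_stab_weight[OF chi finite_lessThan c0 c, where w = "\<lambda>M. \<Prod>x\<in>#M. A x x"])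
  finally show ?thesis
    by (simp add: power_trace_def)
qed

section \<open>Elementary and complete homogeneous symmetric polynomials\<close>

definition simple_ind :: "'i multiset \<Rightarrow> complex" where
  "simple_ind M = (if \<forall>x. count M x \<le> 1 then 1 else 0)"

lemma sum_count_eq_size: "(\<Sum>i\<in>set_mset M. count M i) = size M"
  by (simp add: size_multiset_overloaded_eq)

lemma one_recursion:
  "(\<Sum>i\<in>set_mset M. 1 * (1 + 1 * (of_nat (count M i) - 1))) = of_nat (size M) * (1::complex)"
  by (simp add: sum_count_eq_size[symmetric])

text \<open>If \<open>M\<close> has a repeated entry, a term could survive only if removing
  \<open>i\<close> makes the multiset simple. Then \<open>i\<close> has multiplicity exactly 2, and
  the factor \<open>1 - (2 - 1)\<close> vanishes.\<close>

lemma simple_ind_recursion: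
  "(\<Sum>i\<in>set_mset M. simple_ind (M - {#i#}) * (1 + (-1) * (of_nat (count M i) - 1))) = of_nat (size M) * simple_ind M"
proof (cases "\<forall>x. count M x \<le> 1")
  case True
  then have "simple_ind (M - {#i#}) * (1 + (-1) * (of_nat (count M i) - 1)) = of_nat (count M i)"
    if "i \<in># M" for i
  proof -
    have "count M i = 1"
      using True that by (meson count_greater_eq_one_iff le_antisym)
    then show ?thesis
      using True by (auto simp: simple_ind_def le_diff_conv intro: le_SucI)
  qed
  then show ?thesis
    using True by (simp add: simple_ind_def sum_count_eq_size[symmetric])
next
  case False
  have "simple_ind (M - {#i#}) * (1 + (-1) * (of_nat (count M i) - 1)) = 0" if "i \<in># M" for i
  proof (cases "\<forall>x. count (M - {#i#}) x \<le> 1")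
    case True
    obtain y where y: "count M y > 1"
      using False by (auto simp: not_le)
    then have "y = i"
      using True[rule_format, of y] by (cases "y = i") auto
    then have "count M i = 2"
      using True[rule_format, of i] y by simp
    then show ?thesis
      by simp
  next
    case not_simple: False
    then have "simple_ind (M - {#i#}) = 0"
      by (simp only: simple_ind_def if_False)
    then show ?thesis
      by simp
  qed
  then have "(\<Sum>i\<in>set_mset M. simple_ind (M - {#i#}) * (1 + (-1) * (of_nat (count M i) - 1))) = 0"
    by (rule sum.neutral[rule_format])
  moreover have "simple_ind M = 0"
    using False by (simp only: simple_ind_def if_False)
  ultimately show ?thesis
    by simp
qed

lemma msets_empty: "msets n {} = (if n = 0 then {{#}} else {})"
  by (auto simp: msets_def)

lemma msets_insert:
  "msets (Suc n) (insert s S) = msets (Suc n) S \<union> add_mset s ` msets n (insert s S)"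
proof (intro equalityI subsetI)
  fix M assume M: "M \<in> msets (Suc n) (insert s S)"
  show "M \<in> msets (Suc n) S \<union> add_mset s ` msets n (insert s S)"
  proof (cases "s \<in># M")
    case True
    then have "M = add_mset s (M - {#s#})" "M - {#s#} \<in> msets n (insert s S)"
      using M by (auto simp: msets_def size_Diff_singleton dest: in_diffD)
    then show ?thesis by blast
  next
    case False
    then show ?thesis using M by (auto simp: msets_def)
  qed
qed (auto simp: msets_def)

lemma mset_gen_insert:
  assumes "finite S" "s \<notin> S"
  shows "mset_gen c mu (Suc n) (insert s S) = mset_gen c mu (Suc n) S
    + mu s * mset_gen (\<lambda>M. c (add_mset s M)) mu n (insert s S)"
proof -
  have "msets (Suc n) S \<inter> add_mset s ` msets n (insert s S) = {}"
    using assms by (auto simp: msets_def)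
  then have "mset_gen c mu (Suc n) (insert s S) = mset_gen c mu (Suc n) S
      + (\<Sum>M\<in>add_mset s ` msets n (insert s S). c M * (\<Prod>x\<in>#M. mu x))"
    unfolding mset_gen_def msets_insert
    by (rule sum.union_disjoint[rotated 2]) (auto intro!: finite_msets finite_imageI simp: assms)
  also have "(\<Sum>M\<in>add_mset s ` msets n (insert s S). c M * (\<Prod>x\<in>#M. mu x))
      = mu s * mset_gen (\<lambda>M. c (add_mset s M)) mu n (insert s S)"
    by (subst sum.reindex) (auto simp: mset_gen_def sum_distrib_left mult_ac intro!: inj_onI)
  finally show ?thesis .
qed

lemma mset_gen_one_insert:
  assumes "finite S" "s \<notin> S"
  shows "mset_gen (\<lambda>_. 1) mu (Suc n) (insert s S) = mset_gen (\<lambda>_. 1) mu (Suc n) S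
    + mu s * mset_gen (\<lambda>_. 1) mu n (insert s S)"
  by (rule mset_gen_insert[OF assms])

text \<open>In contrast to the complete homogeneous case the new variable can be used only once: a
  multiset that already contains \<open>s\<close> gets weight 0 when \<open>s\<close> is added, so
  the last factor lives on \<open>S\<close>.\<close>

lemma mset_gen_simple_insert:
  assumes "finite S" "s \<notin> S"
  shows "mset_gen simple_ind mu (Suc n) (insert s S) = mset_gen simple_ind mu (Suc n) S
    + mu s * mset_gen simple_ind mu n S"
proof -
  have "mset_gen (\<lambda>M. simple_ind (add_mset s M)) mu n (insert s S) = mset_gen simple_ind mu n S"
    unfolding mset_gen_def
  proof (rule sum.mono_neutral_cong_right)
    show "\<forall>M\<in>msets n (insert s S) - msets n S. simple_ind (add_mset s M) * (\<Prod>x\<in>#M. mu x) = 0"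
    proof
      fix M assume "M \<in> msets n (insert s S) - msets n S"
      then have "s \<in># M"
        by (auto simp: msets_def)
      then have "\<not> count (add_mset s M) s \<le> 1"
        by simp
      then have "\<not> (\<forall>x. count (add_mset s M) x \<le> 1)"
        by blast
      then show "simple_ind (add_mset s M) * (\<Prod>x\<in>#M. mu x) = 0"
        by (simp only: simple_ind_def if_False mult_zero_left)
    qed
    show "finite (msets n (insert s S))"
      using assms by (simp add: finite_msets)
    show "msets n S \<subseteq> msets n (insert s S)"
      by (auto simp: msets_def)
    fix M assume "M \<in> msets n S"
    then have "count M s = 0"
      using assms by (auto simp: msets_def count_eq_zero_iff)
    then have "count (add_mset s M) x \<le> 1 \<longleftrightarrow> count M x \<le> 1" for x
      by (cases "x = s") simp_all
    then have "simple_ind (add_mset s M) = simple_ind M"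
      by (simp only: simple_ind_def)
    then show "simple_ind (add_mset s M) * (\<Prod>x\<in>#M. mu x) = simple_ind M * (\<Prod>x\<in>#M. mu x)"
      by simp
  qed
  then show ?thesis
    by (simp only: mset_gen_insert[OF assms, of simple_ind mu n])
qed

lemma mset_gen_empty: "mset_gen c mu n {} = (if n = 0 then c {#} else 0)"
  by (simp add: mset_gen_def msets_empty)

lemma mset_gen_0: "mset_gen c mu 0 S = c {#}"
proof -
  have "msets 0 S = {{#}}"
    by (auto simp: msets_def)
  then show ?thesis
    by (simp add: mset_gen_def)
qed

lemma mset_gen_simple_eq_0: "m < n \<Longrightarrow> mset_gen simple_ind mu n {..<m::nat} = 0"
proof (induction m arbitrary: n)
  case (Suc m)
  then obtain n' where "n = Suc n'"
    by (metis not0_implies_Suc not_less0)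
  with Suc show ?case
    by (simp add: lessThan_Suc mset_gen_simple_insert)
qed (simp add: mset_gen_empty)

lemma sum_mset_gen_simple: "(\<Sum>n\<le>m. mset_gen simple_ind mu n {..<m::nat}) = (\<Prod>i<m. 1 + mu i)"
proof (induction m)
  case (Suc m)
  have "(\<Sum>n\<le>Suc m. mset_gen simple_ind mu n {..<Suc m})
      = simple_ind ({#} :: nat multiset) + (\<Sum>n\<le>m. mset_gen simple_ind mu (Suc n) {..<m})
        + mu m * (\<Sum>n\<le>m. mset_gen simple_ind mu n {..<m})"
    by (simp only: sum.atMost_Suc_shift)
      (simp add: lessThan_Suc mset_gen_simple_insert mset_gen_0 sum.distrib sum_distrib_left)
  also have "simple_ind ({#} :: nat multiset) + (\<Sum>n\<le>m. mset_gen simple_ind mu (Suc n) {..<m})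
      = (\<Sum>n\<le>Suc m. mset_gen simple_ind mu n {..<m})"
    by (simp only: sum.atMost_Suc_shift mset_gen_0)
  also have "\<dots> = (\<Sum>n\<le>m. mset_gen simple_ind mu n {..<m})"
    by (simp add: mset_gen_simple_eq_0)
  finally show ?case
    by (simp add: Suc algebra_simps)
qed (simp add: mset_gen_empty simple_ind_def)

text \<open>The classical identity H(t) E(-t) = 1. A new variable \<open>mu m\<close> multiplies the
  second series by \<open>1 - mu m * X\<close> and divides the first by the same factor.\<close>

lemma mset_gen_fps:
  "Abs_fps (\<lambda>n. mset_gen (\<lambda>_. 1) mu n {..<m::nat}) * Abs_fps (\<lambda>n. (-1) ^ n * mset_gen simple_ind mu n {..<m}) = 1"
proof (induction m)
  case 0
  have "Abs_fps (\<lambda>n. mset_gen (\<lambda>_. 1) mu n {}) = 1" "Abs_fps (\<lambda>n. (-1) ^ n * mset_gen simple_ind mu n {}) = 1"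
    by (auto simp: fps_eq_iff mset_gen_empty simple_ind_def)
  then show ?case by simp
next
  case (Suc m)
  let ?H = "\<lambda>m. Abs_fps (\<lambda>n. mset_gen (\<lambda>_. 1) mu n {..<m::nat})"
  let ?E = "\<lambda>m. Abs_fps (\<lambda>n. (-1) ^ n * mset_gen simple_ind mu n {..<m::nat})"
  let ?L = "1 - fps_const (mu m) * fps_X"
  have "mset_gen (\<lambda>_. 1) mu n {..<Suc m}
      = mset_gen (\<lambda>_. 1) mu n {..<m} + mu m * (if n = 0 then 0 else mset_gen (\<lambda>_. 1) mu (n - 1) {..<Suc m})" for n
    using mset_gen_one_insert[of "{..<m}" m mu "n - 1"]
    by (cases n) (auto simp: lessThan_Suc mset_gen_0)
  then have H1: "?H (Suc m) = ?H m + fps_const (mu m) * (fps_X * ?H (Suc m))"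
    by (auto simp: fps_eq_iff)
  have geom: "h * (1 - c * x) = k" if "h = k + c * (x * h)" for h k c x :: "complex fps"
  proof -
    have "h * (1 - c * x) = h - c * (x * h)"
      by (simp add: algebra_simps)
    also have "\<dots> = k"
      using that by (metis add_diff_cancel_right')
    finally show ?thesis .
  qed
  have H: "?H (Suc m) * ?L = ?H m"
    by (rule geom[OF H1])
  have "mset_gen simple_ind mu n {..<Suc m}
      = mset_gen simple_ind mu n {..<m} + mu m * (if n = 0 then 0 else mset_gen simple_ind mu (n - 1) {..<m})" for n
    using mset_gen_simple_insert[of "{..<m}" m mu "n - 1"]
    by (cases n) (auto simp: lessThan_Suc mset_gen_0)
  moreover have "(-1) ^ n * (x + y * (if n = 0 then 0 else z))
      = (-1) ^ n * x - y * (if n = 0 then 0 else (-1) ^ (n - 1) * z)" for n and x y z :: complex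
    by (cases n) (auto simp: algebra_simps)
  ultimately have E: "?E (Suc m) = ?E m - fps_const (mu m) * (fps_X * ?E m)"
    by (simp add: fps_eq_iff)
  have E: "?E (Suc m) = ?L * ?E m"
    by (subst E) (simp only: left_diff_distrib mult_1_left mult.assoc)
  have "?H (Suc m) * ?E (Suc m) = (?H (Suc m) * ?L) * ?E m"
    by (simp only: E mult.assoc)
  then show ?case
    using Suc H by simp
qed

section \<open>Similarity invariance and Schur triangularization\<close>

lemma ptr_similar:
  assumes s: "s permutes {..<n}" and fin: "finite S"
    and QP: "\<And>x y. x \<in> S \<Longrightarrow> y \<in> S \<Longrightarrow> (\<Sum>z\<in>S. Q x z * P z y) = (if x = y then 1 else 0)"
  shows "ptr n s S (\<lambda>a x y. \<Sum>z\<in>S. P x z * (\<Sum>w\<in>S. B a z w * Q w y)) = ptr n s S B"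
proof -
  have "ptr n s S (\<lambda>a x y. \<Sum>z\<in>S. P x z * (\<Sum>w\<in>S. B a z w * Q w y))
      = ptr n s S (\<lambda>a x y. \<Sum>z\<in>S. (\<Sum>w\<in>S. B a x w * Q w z) * P z y)"
    by (rule ptr_cyclic[OF s fin fin])
  also have "\<dots> = ptr n s S B"
  proof (rule ptr_cong[OF s])
    fix a x y assume "x \<in> S" and y: "y \<in> S"
    have "(\<Sum>z\<in>S. (\<Sum>w\<in>S. B a x w * Q w z) * P z y) = (\<Sum>w\<in>S. B a x w * (\<Sum>z\<in>S. Q w z * P z y))"
      unfolding sum_distrib_left sum_distrib_right mult.assoc by (rule sum.swap)
    also have "\<dots> = (\<Sum>w\<in>S. if w = y then B a x w else 0)"
      by (intro sum.cong refl) (simp add: QP y)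
    also have "\<dots> = B a x y"
      using fin y by simp
    finally show "(\<Sum>z\<in>S. (\<Sum>w\<in>S. B a x w * Q w z) * P z y) = B a x y" .
  qed
  finally show ?thesis .
qed

lemma index_mult_mat_sum:
  fixes A B :: "complex mat"
  assumes "A \<in> carrier_mat n m" "B \<in> carrier_mat m p" "i < n" "j < p"
  shows "(A * B) $$ (i, j) = (\<Sum>l<m. A $$ (i, l) * B $$ (l, j))"
  using assms by (auto simp: scalar_prod_def atLeast0LessThan intro!: sum.cong)

lemma power_trace_similar:
  assumes A: "A \<in> carrier_mat m m" and sim: "similar_mat_wit A B P Q"
  shows "power_trace chi n {..<m} (\<lambda>x y. A $$ (x, y)) = power_trace chi n {..<m} (\<lambda>x y. B $$ (x, y))"
proof -
  note w = similar_mat_witD2[OF A sim]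
  have QP: "(\<Sum>z<m. Q $$ (x, z) * P $$ (z, y)) = (if x = y then 1 else 0)" if "x \<in> {..<m}" "y \<in> {..<m}" for x y
  proof -
    have "(\<Sum>z<m. Q $$ (x, z) * P $$ (z, y)) = (Q * P) $$ (x, y)"
      by (rule index_mult_mat_sum[OF w(7,6), symmetric]) (use that in auto)
    then show ?thesis
      using that by (simp only: w(2) lessThan_iff index_one_mat)
  qed
  have Axy: "A $$ (x, y) = (\<Sum>z<m. P $$ (x, z) * (\<Sum>w<m. B $$ (z, w) * Q $$ (w, y)))"
    if "x < m" "y < m" for x y
  proof -
    have "A = P * (B * Q)"
      using w(3) assoc_mult_mat[OF w(6,5,7)] by simp
    then have "A $$ (x, y) = (P * (B * Q)) $$ (x, y)"
      by (rule arg_cong)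
    also have "\<dots> = (\<Sum>z<m. P $$ (x, z) * (B * Q) $$ (z, y))"
      by (rule index_mult_mat_sum[of _ m m _ m]) (use w(5-7) that in auto)
    also have "\<dots> = (\<Sum>z<m. P $$ (x, z) * (\<Sum>w<m. B $$ (z, w) * Q $$ (w, y)))"
      using that by (intro sum.cong refl arg_cong2[of _ _ _ _ "(*)"] index_mult_mat_sum[OF w(5,7)]) auto
    finally show ?thesis .
  qed
  have "ptr n s {..<m} (\<lambda>_ x y. A $$ (x, y)) = ptr n s {..<m} (\<lambda>_ x y. B $$ (x, y))"
    if "s permutes {..<n}" for s
  proof -
    have "ptr n s {..<m} (\<lambda>_ x y. A $$ (x, y))
        = ptr n s {..<m} (\<lambda>a x y. \<Sum>z<m. P $$ (x, z) * (\<Sum>w<m. B $$ (z, w) * Q $$ (w, y)))"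
      by (rule ptr_cong[OF that]) (auto intro: Axy)
    also have "\<dots> = ptr n s {..<m} (\<lambda>_ x y. B $$ (x, y))"
      by (rule ptr_similar[OF that _ QP]) auto
    finally show ?thesis .
  qed
  then show ?thesis
    by (simp add: power_trace_def)
qed

lemma schur_triangularization:
  fixes A :: "complex mat"
  assumes A: "A \<in> carrier_mat m m"
  obtains B P Q where "similar_mat_wit A B P Q" "upper_triangular B" "B \<in> carrier_mat m m"
proof -
  obtain es where es: "char_poly A = (\<Prod>a\<leftarrow>es. [:- a, 1:])"
    using char_poly_factorized[OF A] by blast
  obtain B P Q where BPQ: "schur_decomposition A es = (B, P, Q)"
    by (cases "schur_decomposition A es")
  from schur_decomposition[OF A es BPQ] similar_mat_witD2[OF A, of B P Q] that show ?thesis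
    by blast
qed

text \<open>Power traces and determinants are invariant under similarity, so \<open>A\<close> may be
  replaced by an upper triangular Schur form. There all three claims are identities between
  symmetric polynomials in the diagonal entries.\<close>

lemma det_one_plus:
  assumes A: "A \<in> carrier_mat m m"
  shows "Determinant.det (1\<^sub>m m + A) = (\<Sum>n\<le>m. ext_trace n {..<m} (\<lambda>x y. A $$ (x, y)))"
    and "m < n \<Longrightarrow> ext_trace n {..<m} (\<lambda>x y. A $$ (x, y)) = 0"
    and "Abs_fps (\<lambda>n. sym_trace n {..<m} (\<lambda>x y. A $$ (x, y)))
      * Abs_fps (\<lambda>n. (-1) ^ n * ext_trace n {..<m} (\<lambda>x y. A $$ (x, y))) = 1"
proof -
  obtain B P Q where sim: "similar_mat_wit A B P Q" and ut: "upper_triangular B" and B: "B \<in> carrier_mat m m"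
    by (rule schur_triangularization[OF A])
  note w = similar_mat_witD2[OF A sim]
  have tri: "B $$ (x, y) = 0" if "x < m" "y < x" for x y
    using ut B that by (auto simp: upper_triangular_def)
  let ?mu = "\<lambda>x. B $$ (x, x)"
  have ext: "ext_trace n {..<m} (\<lambda>x y. A $$ (x, y)) = mset_gen simple_ind ?mu n {..<m}" for n
    unfolding power_trace_similar[OF A sim]
    by (rule power_trace_triangular[OF chi_sym_sign _ simple_ind_recursion tri]) (auto simp: simple_ind_def)
  have sym: "sym_trace n {..<m} (\<lambda>x y. A $$ (x, y)) = mset_gen (\<lambda>_. 1) ?mu n {..<m}" for n
    unfolding power_trace_similar[OF A sim]
    by (rule power_trace_triangular[OF chi_sym_one _ one_recursion tri]) auto
  have "1\<^sub>m m + A = P * (1\<^sub>m m + B) * Q"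
    using w(1,3) add_mult_distrib_mat[of "P * 1\<^sub>m m" m m "P * B" Q m]
      mult_add_distrib_mat[of P m m "1\<^sub>m m" m B] right_mult_one_mat[OF w(6)] w(5-7) by auto
  then have "Determinant.det (1\<^sub>m m + A) = Determinant.det (1\<^sub>m m + B) * Determinant.det (P * Q)"
    using w(5-7) by (simp add: det_mult[of _ m])
  also have "\<dots> = Determinant.det (1\<^sub>m m + B)"
    by (simp add: w(1))
  also have "\<dots> = (\<Prod>i<m. 1 + ?mu i)"
    using B ut by (subst det_upper_triangular[of _ m])
      (auto simp: upper_triangular_def prod_list_diag_prod atLeast0LessThan intro!: prod.cong)
  finally show "Determinant.det (1\<^sub>m m + A) = (\<Sum>n\<le>m. ext_trace n {..<m} (\<lambda>x y. A $$ (x, y)))"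
    by (simp add: ext sum_mset_gen_simple)
  show "m < n \<Longrightarrow> ext_trace n {..<m} (\<lambda>x y. A $$ (x, y)) = 0"
    by (simp add: ext mset_gen_simple_eq_0)
  show "Abs_fps (\<lambda>n. sym_trace n {..<m} (\<lambda>x y. A $$ (x, y)))
      * Abs_fps (\<lambda>n. (-1) ^ n * ext_trace n {..<m} (\<lambda>x y. A $$ (x, y))) = 1"
    by (simp add: ext sym mset_gen_fps)
qed

subsection \<open>Tensors invariant under products of unitary groups\<close>

text \<open>Invariance under the matrix units of the complexified Lie algebra of
  \<open>U(d)^g\<close>; an index \<open>(j, p)\<close> is row \<open>p\<close> of factor
  \<open>j\<close>. The generator replaces \<open>p\<close> by \<open>q\<close> in the first
  argument and \<open>q\<close> by \<open>p\<close> in the second, because the second argument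
  belongs to conjugated entries. With matrix units the condition is combinatorial: one index is
  replaced at a time.\<close>

definition infinitesimally_invariant ::
    "nat \<Rightarrow> nat \<Rightarrow> nat \<Rightarrow> ((nat \<Rightarrow> nat \<times> nat) \<Rightarrow> (nat \<Rightarrow> nat \<times> nat) \<Rightarrow> complex) \<Rightarrow> bool" where
  "infinitesimally_invariant n g d T \<longleftrightarrow>
    (\<forall>j<g. \<forall>p<d. \<forall>q<d. \<forall>I\<in>tuples n ({..<g} \<times> {..<d}). \<forall>I'\<in>tuples n ({..<g} \<times> {..<d}).
      (\<Sum>a<n. if I a = (j, p) then T (I(a := (j, q))) I' else 0)
      = (\<Sum>b<n. if I' b = (j, q) then T I (I'(b := (j, p))) else 0))"

lemma infinitesimally_invariantD:
  assumes "infinitesimally_invariant n g d T" "j < g" "p < d" "q < d"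
    "I \<in> tuples n ({..<g} \<times> {..<d})" "I' \<in> tuples n ({..<g} \<times> {..<d})"
  shows "(\<Sum>a<n. if I a = (j, p) then T (I(a := (j, q))) I' else 0)
      = (\<Sum>b<n. if I' b = (j, q) then T I (I'(b := (j, p))) else 0)"
  using assms unfolding infinitesimally_invariant_def by blast

lemma tuples_upd: "I \<in> tuples n S \<Longrightarrow> a < n \<Longrightarrow> x \<in> S \<Longrightarrow> I(a := x) \<in> tuples n S"
  by (auto simp: PiE_def extensional_def)

text \<open>Changing \<open>I\<close> at position \<open>al b\<close> changes
  \<open>I \<circ> al\<close> at position \<open>b\<close>, so the terms of the two sums correspond
  to each other under \<open>al\<close>.\<close>

lemma infinitesimally_invariant_perm:
  assumes al: "al permutes {..<n}"
  shows "infinitesimally_invariant n g d (\<lambda>I I'. if I' = I \<circ> al then t else 0)"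
  unfolding infinitesimally_invariant_def
proof (intro allI impI ballI)
  fix j p q I I'
  let ?x = "(j, p) :: nat \<times> nat" and ?y = "(j, q) :: nat \<times> nat"
  have iff: "I (al b) = ?x \<and> I' = I(al b := ?y) \<circ> al \<longleftrightarrow> I' b = ?y \<and> I'(b := ?x) = I \<circ> al" for b
  proof -
    have "al z = al b \<longleftrightarrow> z = b" for z
      using permutes_inj[OF al] by (auto dest: injD)
    then have "I(al b := ?y) \<circ> al = (I \<circ> al)(b := ?y)"
      by (auto simp: fun_eq_iff)
    then show ?thesis
      by (auto simp: fun_eq_iff)
  qed
  have "(\<Sum>a<n. if I a = ?x then if I' = I(a := ?y) \<circ> al then t else 0 else 0)
      = (\<Sum>a<n. if I a = ?x \<and> I' = I(a := ?y) \<circ> al then t else 0)"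
    by (intro sum.cong) auto
  also have "\<dots> = (\<Sum>b<n. if I (al b) = ?x \<and> I' = I(al b := ?y) \<circ> al then t else 0)"
    by (subst sum.permute[OF al]) (simp add: o_def)
  also have "\<dots> = (\<Sum>b<n. if I' b = ?y then if I'(b := ?x) = I \<circ> al then t else 0 else 0)"
    unfolding iff by (intro sum.cong) auto
  finally show "(\<Sum>a<n. if I a = ?x then if I' = I(a := ?y) \<circ> al then t else 0 else 0)
      = (\<Sum>b<n. if I' b = ?y then if I'(b := ?x) = I \<circ> al then t else 0 else 0)" .
qed

lemma infinitesimally_invariant_diff:
  assumes "infinitesimally_invariant n g d T" "infinitesimally_invariant n g d T'"
  shows "infinitesimally_invariant n g d (\<lambda>I I'. T I I' - T' I I')"
proof -
  have "(if b then x - y else 0) = (if b then x else 0) - (if b then y else 0)" for b and x y :: complex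
    by auto
  then show ?thesis
    using assms unfolding infinitesimally_invariant_def by (simp add: sum_subtractf)
qed

lemma infinitesimally_invariant_sum:
  assumes "\<And>s. s \<in> S \<Longrightarrow> infinitesimally_invariant n g d (T s)"
  shows "infinitesimally_invariant n g d (\<lambda>I I'. \<Sum>s\<in>S. T s I I')"
  unfolding infinitesimally_invariant_def
proof (intro allI impI ballI)
  fix j p q I I'
  assume *: "j < g" "p < d" "q < d" "I \<in> tuples n ({..<g} \<times> {..<d})" "I' \<in> tuples n ({..<g} \<times> {..<d})"
  have if_sum: "(if b then \<Sum>s\<in>S. x s else 0) = (\<Sum>s\<in>S. if b then x s else 0)" for b and x :: "'a \<Rightarrow> complex"
    by auto
  have "(\<Sum>a<n. if I a = (j, p) then \<Sum>s\<in>S. T s (I(a := (j, q))) I' else 0)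
      = (\<Sum>s\<in>S. \<Sum>a<n. if I a = (j, p) then T s (I(a := (j, q))) I' else 0)"
    unfolding if_sum by (rule sum.swap)
  also have "\<dots> = (\<Sum>s\<in>S. \<Sum>b<n. if I' b = (j, q) then T s I (I'(b := (j, p))) else 0)"
    using assms * by (intro sum.cong refl infinitesimally_invariantD)
  also have "\<dots> = (\<Sum>b<n. if I' b = (j, q) then \<Sum>s\<in>S. T s I (I'(b := (j, p))) else 0)"
    unfolding if_sum by (rule sum.swap)
  finally show "(\<Sum>a<n. if I a = (j, p) then \<Sum>s\<in>S. T s (I(a := (j, q))) I' else 0)
      = (\<Sum>b<n. if I' b = (j, q) then \<Sum>s\<in>S. T s I (I'(b := (j, p))) else 0)" .
qed

text \<open>Replacing one index of \<open>I\<close> by a fresh one expresses \<open>T I\<close> through the values of \<open>T\<close> at the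
  new tuple, so vanishing propagates from one injective tuple to all tuples disjoint from it.\<close>

lemma infinitesimally_invariant_vanish:
  assumes inv: "infinitesimally_invariant n g d T"
    and K: "K \<in> tuples n ({..<g} \<times> {..<d})" "inj_on K {..<n}"
    and I: "I \<in> tuples n ({..<g} \<times> {..<d})"
    and col: "\<And>a. a < n \<Longrightarrow> fst (I a) = fst (K a)"
    and disj: "K ` {..<n} \<inter> I ` {..<n} = {}"
    and zero: "\<And>I'. I' \<in> tuples n ({..<g} \<times> {..<d}) \<Longrightarrow> T K I' = 0"
    and I': "I' \<in> tuples n ({..<g} \<times> {..<d})"
  shows "T I I' = 0"
proof -
  \<comment> \<open>A hybrid of the two tuples: \<open>K\<close> in the first \<open>m\<close>
    positions and \<open>I\<close> in the others. The induction descends from \<open>J n = K\<close>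
    to \<open>J 0 = I\<close>.\<close>
  define J where "J m a = (if a < m then K a else I a)" for m a :: nat
  have "T (J (n - m)) I' = 0" if "m \<le> n" "I' \<in> tuples n ({..<g} \<times> {..<d})" for m I'
    using that
  proof (induction m arbitrary: I')
    case 0
    have "J n = K"
      using K(1) I by (auto simp: J_def fun_eq_iff PiE_def extensional_def)
    then show ?case
      using zero 0 by simp
  next
    case (Suc m)
    define b where "b = n - Suc m"
    have b: "b < n" "n - m = Suc b"
      using Suc.prems by (auto simp: b_def)
    obtain j p where Kb: "K b = (j, p)" "j < g" "p < d"
      using K(1) b(1) by (cases "K b") (auto simp: PiE_def Pi_def mem_Times_iff)
    obtain q where Ib: "I b = (j, q)" "q < d"
      using I b(1) col[OF b(1)] Kb by (cases "I b") (auto simp: PiE_def Pi_def mem_Times_iff)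
    have JT: "J m \<in> tuples n ({..<g} \<times> {..<d})" for m
      using K(1) I by (auto simp: J_def PiE_def extensional_def Pi_def)
    \<comment> \<open>Since \<open>K\<close> is injective and disjoint from \<open>I\<close>,
      position \<open>b\<close> is the only one holding \<open>K b\<close>. The left side of the
      invariance identity is therefore the single term \<open>T (J b) I'\<close>, and every term on
      the right vanishes by induction.\<close>
    have only: "J (Suc b) a = (j, p) \<longleftrightarrow> a = b" if "a < n" for a
    proof (cases "a < Suc b")
      case True
      then show ?thesis
        using K(2) Kb b(1) that by (auto simp: J_def inj_on_def)
    next
      case False
      then have "I a \<noteq> K b"
        using disj b(1) that by blast
      then show ?thesis
        using False Kb by (auto simp: J_def)
    qed
    have upd: "(J (Suc b))(b := (j, q)) = J b"
      using Ib by (auto simp: J_def fun_eq_iff)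
    have "(\<Sum>a<n. if J (Suc b) a = (j, p) then T ((J (Suc b))(a := (j, q))) I' else 0)
        = (\<Sum>a<n. if I' a = (j, q) then T (J (Suc b)) (I'(a := (j, p))) else 0)"
      by (rule infinitesimally_invariantD[OF inv Kb(2,3) Ib(2) JT Suc.prems(2)])
    also have "\<dots> = 0"
    proof (intro sum.neutral ballI)
      fix x assume x: "x \<in> {..<n}"
      have "T (J (n - m)) (I'(x := (j, p))) = 0"
        using Suc.prems Kb x by (intro Suc.IH tuples_upd) auto
      then show "(if I' x = (j, q) then T (J (Suc b)) (I'(x := (j, p))) else 0) = 0"
        by (simp add: b)
    qed
    also have "(\<Sum>a<n. if J (Suc b) a = (j, p) then T ((J (Suc b))(a := (j, q))) I' else 0)
        = (\<Sum>a<n. if a = b then T (J b) I' else 0)"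
      using only upd by (intro sum.cong) auto
    finally show ?case
      using b by (simp add: b_def)
  qed
  from this[of n I'] I' have "T (J 0) I' = 0"
    by simp
  moreover have "J 0 = I"
    by (auto simp: J_def)
  ultimately show ?thesis
    by simp
qed

definition ctup :: "nat \<Rightarrow> (nat \<Rightarrow> nat) \<Rightarrow> (nat \<Rightarrow> nat) \<Rightarrow> nat \<Rightarrow> nat \<times> nat" where
  "ctup n c i = restrict (\<lambda>a. (c a, i a)) {..<n}"

lemma ctup_in:
  "(\<And>a. a < n \<Longrightarrow> c a < g) \<Longrightarrow> (\<And>a. a < n \<Longrightarrow> i a < d) \<Longrightarrow> ctup n c i \<in> tuples n ({..<g} \<times> {..<d})"
  by (auto simp: ctup_def)

lemma ctup_comp:
  assumes "al permutes {..<n}"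
  shows "ctup n c i \<circ> al = ctup n (c \<circ> al) (i \<circ> al)"
proof
  fix a
  have "al a < n \<longleftrightarrow> a < n"
    using permutes_in_image[OF assms] by (metis lessThan_iff)
  then show "(ctup n c i \<circ> al) a = ctup n (c \<circ> al) (i \<circ> al) a"
    by (simp add: ctup_def)
qed

lemma ctup_eq_iff:
  assumes "c \<in> tuples n S" "c' \<in> tuples n S" "i \<in> tuples n R" "i' \<in> tuples n R"
  shows "ctup n c i = ctup n c' i' \<longleftrightarrow> c = c' \<and> i = i'"
proof
  assume L: "ctup n c i = ctup n c' i'"
  have "c a = c' a \<and> i a = i' a" if "a < n" for a
    using fun_cong[OF L, of a] that by (simp add: ctup_def)
  then show "c = c' \<and> i = i'"
    using PiE_ext[OF assms(1,2)] PiE_ext[OF assms(3,4)] by simp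
qed simp

text \<open>The diagonal generators, with \<open>p = q\<close>, count the occurrences of an index.
  Where \<open>T F I'\<close> is nonzero the two counts agree for each index, and for an injective
  \<open>F\<close> this makes \<open>I'\<close> a rearrangement of \<open>F\<close>.\<close>

lemma infinitesimally_invariant_weight:
  assumes inv: "infinitesimally_invariant n g d T"
    and F: "F \<in> tuples n ({..<g} \<times> {..<d})" "inj_on F {..<n}"
    and I': "I' \<in> tuples n ({..<g} \<times> {..<d})" and nz: "T F I' \<noteq> 0"
  obtains al where "al permutes {..<n}" "I' = F \<circ> al"
proof -
  have card_eq: "card {a. a < n \<and> F a = x} = card {b. b < n \<and> I' b = x}" if xin: "x \<in> {..<g} \<times> {..<d}" for x
  proof -
    obtain j p where x: "x = (j, p)" "j < g" "p < d"
      using xin by (cases x) auto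
    have "(\<Sum>a<n. if F a = x then T F I' else 0) = (\<Sum>a<n. if F a = (j, p) then T (F(a := (j, p))) I' else 0)"
      using x by (intro sum.cong) (auto simp: fun_upd_idem)
    also have "\<dots> = (\<Sum>b<n. if I' b = (j, p) then T F (I'(b := (j, p))) else 0)"
      by (rule infinitesimally_invariantD[OF inv x(2,3,3) F(1) I'])
    also have "\<dots> = (\<Sum>b<n. if I' b = x then T F I' else 0)"
      using x by (intro sum.cong) (auto simp: fun_upd_idem)
    finally have "of_nat (card {a. a < n \<and> F a = x}) * T F I' = of_nat (card {b. b < n \<and> I' b = x}) * T F I'"
      by (simp add: sum.If_cases Int_def)
    then show ?thesis
      using nz by simp
  qed
  have ex: "\<exists>a<n. F a = I' b" if "b < n" for b
  proof -
    have "I' b \<in> {..<g} \<times> {..<d}"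
      using I' that by auto
    moreover have "card {b'. b' < n \<and> I' b' = I' b} \<noteq> 0"
      using that by (subst card_0_eq) auto
    ultimately have "card {a. a < n \<and> F a = I' b} \<noteq> 0"
      using card_eq[of "I' b"] by metis
    then have "{a. a < n \<and> F a = I' b} \<noteq> {}"
      by (intro notI) simp
    then show ?thesis
      by blast
  qed
  then obtain al0 where al0: "\<And>b. b < n \<Longrightarrow> al0 b < n \<and> F (al0 b) = I' b"
    by metis
  define al where "al b = (if b < n then al0 b else b)" for b
  have "inj_on al {..<n}"
  proof (rule inj_onI)
    fix b b' assume bb: "b \<in> {..<n}" "b' \<in> {..<n}" "al b = al b'"
    define x where "x = I' b"
    have alF: "al b < n \<and> F (al b) = I' b" if "b < n" for b
      using al0[OF that] that by (simp add: al_def)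
    have x: "I' b' = x" "F (al b) = x" "al b < n"
      using bb(1,2) alF[of b] alF[of b'] unfolding x_def bb(3) by (simp_all add: bb(3))
    have "{a. a < n \<and> F a = x} = {al b}"
      using inj_onD[OF F(2)] x(2,3) by fastforce
    then have "card {b. b < n \<and> I' b = x} = 1"
      using card_eq[of x] PiE_mem[OF I' bb(1)] x_def by simp
    then obtain z where "{b. b < n \<and> I' b = x} = {z}"
      by (rule card_1_singletonE)
    moreover have "b \<in> {b. b < n \<and> I' b = x}" "b' \<in> {b. b < n \<and> I' b = x}"
      using bb(1,2) x(1) x_def by simp_all
    ultimately show "b = b'"
      by auto
  qed
  moreover have "al ` {..<n} \<subseteq> {..<n}"
    using al0 by (auto simp: al_def)
  ultimately have "bij_betw al {..<n} {..<n}"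
    using endo_inj_surj[OF finite_lessThan] by (simp add: bij_betw_def)
  then have "al permutes {..<n}"
    by (rule bij_imp_permutes) (simp add: al_def)
  moreover have "I' = F \<circ> al"
  proof
    fix b show "I' b = (F \<circ> al) b"
      using al0[of b] PiE_arb[OF I', of b] PiE_arb[OF F(1), of b] by (cases "b < n") (auto simp: al_def)
  qed
  ultimately show ?thesis
    using that by blast
qed

text \<open>The coefficients are read off at one injective tuple \<open>F\<close> with the given
  colours. Subtracting the resulting combination of permutations leaves an invariant tensor that
  vanishes at \<open>F\<close> by the weight argument, hence at all tuples coloured by
  \<open>c\<close>. The bound \<open>3 * n\<close> leaves \<open>n\<close> indices that occur
  neither in \<open>F\<close> nor in \<open>i\<close>.\<close>

lemma infinitesimally_invariant_decomposition:
  assumes inv: "infinitesimally_invariant n g d T" and d: "3 * n \<le> d"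
    and c: "c \<in> tuples n {..<g}" and i: "i \<in> tuples n {..<d}"
    and I': "I' \<in> tuples n ({..<g} \<times> {..<d})"
  defines "F \<equiv> ctup n c (\<lambda>a. a)"
  shows "T (ctup n c i) I' = (\<Sum>al\<in>perms n. if I' = ctup n c i \<circ> al then T F (F \<circ> al) else 0)"
proof -
  define D where "D I I' = T I I' - (\<Sum>al\<in>perms n. if I' = I \<circ> al then T F (F \<circ> al) else 0)" for I I'
  have invD: "infinitesimally_invariant n g d D"
    unfolding D_def
    by (intro infinitesimally_invariant_diff inv infinitesimally_invariant_sum)
      (auto intro!: infinitesimally_invariant_perm)
  have cg: "c a < g" if "a < n" for a
    using c that by auto
  have id: "i a < d" if "a < n" for a
    using i that by auto
  have F: "F \<in> tuples n ({..<g} \<times> {..<d})"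
    unfolding F_def using d cg by (intro ctup_in) auto
  have injF: "inj_on F {..<n}"
    by (auto simp: F_def ctup_def inj_on_def)
  have D0: "D F I' = 0" if I': "I' \<in> tuples n ({..<g} \<times> {..<d})" for I'
  proof (cases "\<exists>al. al permutes {..<n} \<and> I' = F \<circ> al")
    case True
    then obtain al where al: "al permutes {..<n}" "I' = F \<circ> al"
      by blast
    have "be = al" if be: "be permutes {..<n}" "I' = F \<circ> be" for be
    proof
      fix x show "be x = al x"
      proof (cases "x < n")
        case True
        then have "al x < n" "be x < n"
          using permutes_in_image[OF al(1)] permutes_in_image[OF be(1)] by auto
        moreover have "F (be x) = F (al x)"
          using al(2) be(2) by (metis comp_apply)
        ultimately show ?thesis
          using injF by (auto simp: inj_on_def)
      next
        case False
        then show ?thesis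
          using al(1) be(1) by (simp add: permutes_def)
      qed
    qed
    then have "(\<Sum>be\<in>perms n. if I' = F \<circ> be then T F (F \<circ> be) else 0)
        = (\<Sum>be\<in>perms n. if be = al then T F (F \<circ> al) else 0)"
      using al by (intro sum.cong) auto
    also have "\<dots> = T F I'"
      using al by simp
    finally show ?thesis
      by (simp add: D_def)
  next
    case False
    then have "T F I' = 0"
      using infinitesimally_invariant_weight[OF inv F injF I'] by metis
    moreover have "(\<Sum>al\<in>perms n. if I' = F \<circ> al then T F (F \<circ> al) else 0) = 0"
      using False by (intro sum.neutral) auto
    ultimately show ?thesis
      by (simp add: D_def)
  qed
  text \<open>\<open>F\<close> and \<open>ctup n c i\<close> may overlap, so both are compared with a tuple \<open>H\<close> disjoint from them.\<close>
  have "card ({..<n} \<union> i ` {..<n}) \<le> n + n"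
    by (intro order_trans[OF card_Un_le] add_mono) (auto intro: order_trans[OF card_image_le])
  then have "n \<le> card ({..<d} - ({..<n} \<union> i ` {..<n}))"
    using d by (intro order_trans[OF _ diff_card_le_card_Diff]) auto
  then obtain S where S: "S \<subseteq> {..<d} - ({..<n} \<union> i ` {..<n})" "card S = n" "finite S"
    by (metis obtain_subset_with_card_n)
  obtain h where h: "bij_betw h {..<n} S"
    using S finite_same_card_bij[of "{..<n}" S] by auto
  define H where "H = ctup n c h"
  have hS: "h a \<in> S" if "a < n" for a
    using h that by (auto simp: bij_betw_def)
  have H: "H \<in> tuples n ({..<g} \<times> {..<d})"
    unfolding H_def using cg hS S(1) by (intro ctup_in) auto
  have injH: "inj_on H {..<n}"
    using h by (auto simp: H_def ctup_def inj_on_def bij_betw_def)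
  have DH: "D H I' = 0" if "I' \<in> tuples n ({..<g} \<times> {..<d})" for I'
    by (rule infinitesimally_invariant_vanish[OF invD F injF H _ _ D0 that])
      (use hS S(1) in \<open>auto simp: F_def H_def ctup_def\<close>)
  have "D (ctup n c i) I' = 0"
    by (rule infinitesimally_invariant_vanish[OF invD H injH ctup_in[OF cg id] _ _ DH I'])
      (use hS S(1) in \<open>auto simp: H_def ctup_def\<close>)
  then show ?thesis
    by (simp add: D_def)
qed

section \<open>The linear system for the coefficients and its limit\<close>

lemma linear_system_limit:
  fixes G :: "nat \<Rightarrow> 'a \<Rightarrow> 'a \<Rightarrow> complex"
  assumes fin: "finite A"
    and sys: "eventually (\<lambda>d. \<forall>b\<in>A. (\<Sum>a\<in>A. x d a * G d b a) = y d b) sequentially"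
    and G: "\<And>a b. a \<in> A \<Longrightarrow> b \<in> A \<Longrightarrow> (\<lambda>d. G d b a) \<longlonglongrightarrow> (if a = b then 1 else 0)"
    and y: "\<And>b. b \<in> A \<Longrightarrow> (\<lambda>d. y d b) \<longlonglongrightarrow> z b" and b: "b \<in> A"
  shows "(\<lambda>d. x d b) \<longlonglongrightarrow> z b"
proof -
  define E where "E d b a = G d b a - (if a = b then 1 else 0)" for d a b
  define N where "N d = (\<Sum>a\<in>A. norm (x d a))" for d
  define R where "R d = (\<Sum>b\<in>A. \<Sum>a\<in>A. norm (E d b a))" for d
  have E0: "(\<lambda>d. E d b a) \<longlonglongrightarrow> 0" if "a \<in> A" "b \<in> A" for a b
    using LIM_zero[OF G[OF that]] by (simp add: E_def)
  have R0: "R \<longlonglongrightarrow> 0"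
    unfolding R_def using E0 by (intro tendsto_null_sum tendsto_norm_zero) auto
  have xeq: "x d b = y d b - (\<Sum>a\<in>A. x d a * E d b a)"
    if "\<forall>b\<in>A. (\<Sum>a\<in>A. x d a * G d b a) = y d b" "b \<in> A" for d b
  proof -
    have "y d b = (\<Sum>a\<in>A. x d a * G d b a)"
      using that by simp
    also have "\<dots> = (\<Sum>a\<in>A. x d a * E d b a + (if a = b then x d a else 0))"
      by (intro sum.cong refl) (auto simp: E_def algebra_simps)
    finally have "y d b = (\<Sum>a\<in>A. x d a * E d b a) + x d b"
      using fin that(2) by (simp add: sum.distrib)
    then show ?thesis
      by (simp only: add_diff_cancel_left')
  qed
  have bnd: "norm (\<Sum>a\<in>A. x d a * E d b a) \<le> N d * (\<Sum>a\<in>A. norm (E d b a))" if "b \<in> A" for d b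
  proof -
    have "norm (\<Sum>a\<in>A. x d a * E d b a) \<le> (\<Sum>a\<in>A. norm (x d a) * norm (E d b a))"
      by (rule order_trans[OF norm_sum]) (simp add: norm_mult)
    also have "\<dots> \<le> (\<Sum>a\<in>A. N d * norm (E d b a))"
      unfolding N_def using fin by (intro sum_mono mult_right_mono member_le_sum) auto
    finally show ?thesis
      by (simp add: sum_distrib_left)
  qed
  define Y where "Y d = (\<Sum>b\<in>A. norm (y d b))" for d
  have "Y \<longlonglongrightarrow> (\<Sum>b\<in>A. norm (z b))"
    unfolding Y_def using y by (intro tendsto_sum tendsto_norm) auto
  then have "Bseq Y"
    by (intro convergent_imp_Bseq convergentI)
  then obtain K where "\<forall>d. norm (Y d) \<le> K"
    by (rule BseqE)
  then have K: "norm (Y d) \<le> K" for d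
    by blast
  have "eventually (\<lambda>d. R d < 1 / 2) sequentially"
    using R0 by (rule order_tendstoD) simp
  \<comment> \<open>Nothing bounds the solutions \<open>x d\<close> in advance. The system gives
    \<open>N d \<le> Y d + N d * R d\<close>, and once \<open>R d\<close> is below
    \<open>1 / 2\<close> the last term can be absorbed into the left side.\<close>
  with sys have evN: "eventually (\<lambda>d. N d \<le> 2 * K) sequentially"
  proof eventually_elim
    case (elim d)
    have "N d \<le> (\<Sum>b\<in>A. norm (y d b) + N d * (\<Sum>a\<in>A. norm (E d b a)))"
    proof -
      have "norm (x d b) \<le> norm (y d b) + N d * (\<Sum>a\<in>A. norm (E d b a))" if "b \<in> A" for b
      proof -
        have "norm (x d b) = norm (y d b - (\<Sum>a\<in>A. x d a * E d b a))"
          by (rule arg_cong[OF xeq[OF elim(1) that]])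
        then show ?thesis
          using norm_triangle_ineq4[of "y d b" "\<Sum>a\<in>A. x d a * E d b a"] bnd[OF that, of d] by linarith
      qed
      then have "(\<Sum>b\<in>A. norm (x d b)) \<le> (\<Sum>b\<in>A. norm (y d b) + N d * (\<Sum>a\<in>A. norm (E d b a)))"
        by (rule sum_mono)
      then show ?thesis
        by (simp only: N_def[of d, symmetric])
    qed
    also have "\<dots> = Y d + N d * R d"
      by (simp add: Y_def R_def sum.distrib sum_distrib_left)
    also have "\<dots> \<le> K + N d * (1 / 2)"
      using K[of d] elim(2) by (intro add_mono mult_left_mono) (auto simp: N_def sum_nonneg)
    finally show ?case
      by simp
  qed
  have "(\<lambda>d. \<Sum>a\<in>A. x d a * E d b a) \<longlonglongrightarrow> 0"
  proof (rule Lim_null_comparison)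
    show "eventually (\<lambda>d. norm (\<Sum>a\<in>A. x d a * E d b a) \<le> 2 * K * (\<Sum>a\<in>A. norm (E d b a))) sequentially"
      using evN
    proof eventually_elim
      case (elim d)
      then show ?case
        by (intro order_trans[OF bnd[OF b]] mult_right_mono) (auto intro: sum_nonneg)
    qed
    show "(\<lambda>d. 2 * K * (\<Sum>a\<in>A. norm (E d b a))) \<longlonglongrightarrow> 0"
      using E0 b by (intro tendsto_mult_right_zero tendsto_null_sum tendsto_norm_zero) auto
  qed
  from tendsto_diff[OF y[OF b] this] have "(\<lambda>d. y d b - (\<Sum>a\<in>A. x d a * E d b a)) \<longlonglongrightarrow> z b"
    by simp
  then show ?thesis
  proof (rule Lim_transform_eventually)
    show "eventually (\<lambda>d. y d b - (\<Sum>a\<in>A. x d a * E d b a) = x d b) sequentially"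
      using sys by eventually_elim (rule xeq[OF _ b, symmetric])
  qed
qed

text \<open>If \<open>p\<close> and \<open>q\<close> differ at \<open>a\<close>, the entry of the
  tuple at \<open>p a\<close> is determined by the one at \<open>q a\<close>. One of the
  \<open>n\<close> free coordinates is lost, and with it a factor \<open>d\<close>.\<close>

lemma card_agreeing_tuples:
  assumes p: "p permutes {..<n}" and q: "q permutes {..<n}"
  shows "(\<lambda>d. complex_of_nat (card {i\<in>tuples n {..<d}. i \<circ> p = i \<circ> q}) / of_nat d ^ n)
    \<longlonglongrightarrow> (if p = q then 1 else 0)"
proof (cases "p = q")
  case True
  have "eventually (\<lambda>d. complex_of_nat (card {i\<in>tuples n {..<d}. i \<circ> p = i \<circ> q}) / of_nat d ^ n = 1) sequentially"
    using eventually_gt_at_top[of 0] by eventually_elim (simp add: True card_PiE)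
  then show ?thesis
    unfolding if_P[OF True] by (rule tendsto_eventually)
next
  case False
  then obtain a where a: "p a \<noteq> q a"
    by auto
  then have "a < n"
    using permutes_not_in[OF p, of a] permutes_not_in[OF q, of a] by (cases "a < n") auto
  then have pa: "p a < n" "q a < n"
    using permutes_in_image[OF p] permutes_in_image[OF q] by auto
  have card_le: "card {i\<in>tuples n {..<d}. i \<circ> p = i \<circ> q} \<le> d ^ (n - 1)" for d
  proof -
    let ?A = "{i\<in>tuples n {..<d}. i \<circ> p = i \<circ> q}" and ?B = "({..<n} - {p a}) \<rightarrow>\<^sub>E {..<d}"
    have "inj_on (\<lambda>i. i(p a := undefined)) ?A"
    proof (rule inj_onI)
      fix i i' assume i: "i \<in> ?A" "i' \<in> ?A" "i(p a := undefined) = i'(p a := undefined)"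
      have off: "i x = i' x" if "x \<noteq> p a" for x
        using fun_cong[OF i(3), of x] that by simp
      from i have e: "i \<circ> p = i \<circ> q" "i' \<circ> p = i' \<circ> q"
        by blast+
      have "i (p a) = i (q a)"
        using fun_cong[OF e(1), of a] by (simp only: comp_apply)
      also have "\<dots> = i' (q a)"
        using off a by metis
      also have "\<dots> = i' (p a)"
        using fun_cong[OF e(2), of a] by (simp only: comp_apply)
      finally have "i x = i' x" for x
        using off by (cases "x = p a") (simp_all only:)
      then show "i = i'"
        by (rule ext)
    qed
    moreover have "(\<lambda>i. i(p a := undefined)) ` ?A \<subseteq> ?B"
    proof (rule image_subsetI)
      fix i assume "i \<in> ?A"
      then have "i \<in> tuples n {..<d}"
        by blast
      then show "i(p a := undefined) \<in> ?B"
        by (auto simp: PiE_def extensional_def Pi_def)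
    qed
    moreover have "finite ?B"
      by (intro finite_PiE) auto
    ultimately have "card ?A \<le> card ?B"
      by (rule card_inj_on_le)
    also have "\<dots> = d ^ (n - 1)"
      using pa by (simp add: card_PiE)
    finally show ?thesis .
  qed
  have "(\<lambda>d. complex_of_nat (card {i\<in>tuples n {..<d}. i \<circ> p = i \<circ> q}) / of_nat d ^ n) \<longlonglongrightarrow> 0"
  proof (rule Lim_null_comparison)
    show "eventually (\<lambda>d. norm (complex_of_nat (card {i\<in>tuples n {..<d}. i \<circ> p = i \<circ> q}) / of_nat d ^ n) \<le> inverse (real d)) sequentially"
      using eventually_gt_at_top[of 0]
    proof eventually_elim
      case (elim d)
      have "real (card {i\<in>tuples n {..<d}. i \<circ> p = i \<circ> q}) \<le> real d ^ (n - 1)"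
        using of_nat_mono[OF card_le[of d], where 'a = real] by simp
      moreover have "real d ^ n = real d * real d ^ (n - 1)"
        using pa by (cases n) auto
      ultimately have "real (card {i\<in>tuples n {..<d}. i \<circ> p = i \<circ> q}) / real d ^ n \<le> real d ^ (n - 1) / (real d * real d ^ (n - 1))"
        by (simp only: divide_right_mono mult_nonneg_nonneg of_nat_0_le_iff zero_le_power)
      also have "\<dots> = inverse (real d)"
        using elim by (simp add: field_simps)
      finally show ?case
        by (simp only: norm_divide norm_power norm_of_nat)
    qed
    show "(\<lambda>d. inverse (real d)) \<longlonglongrightarrow> 0"
      by (rule lim_inverse_n)
  qed
  then show ?thesis
    by (simp only: False if_False)
qed

lemma sum_ind_card: "finite A \<Longrightarrow> (\<Sum>x\<in>A. if P x then 1 else 0) = complex_of_nat (card {x\<in>A. P x})"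
  by (subst sum.inter_filter[symmetric]) simp_all

text \<open>For each \<open>ga\<close> compatible with the colours, the coefficients of
  \<open>T\<close> are summed over the columns \<open>i \<circ> s\<close> and
  \<open>i \<circ> ga \<circ> t\<close>. The sums \<open>x ga d\<close> solve a linear system whose
  matrix counts the tuples on which two permutations agree. Division of both sides by
  \<open>d ^ n\<close> makes this matrix tend to the identity, so the solution has the same limit as
  the right side.\<close>

theorem invariant_moment_limit:
  fixes T :: "nat \<Rightarrow> (nat \<Rightarrow> nat) \<Rightarrow> (nat \<Rightarrow> nat) \<Rightarrow> (nat \<Rightarrow> nat \<times> nat) \<Rightarrow> (nat \<Rightarrow> nat \<times> nat) \<Rightarrow> complex"
  assumes inv: "\<And>d J J'. d \<ge> 1 \<Longrightarrow> J \<in> tuples n {..<d} \<Longrightarrow> J' \<in> tuples n {..<d} \<Longrightarrow>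
      infinitesimally_invariant n g d (T d J J')"
    and gram: "\<And>d J J' c be. d \<ge> 1 \<Longrightarrow> J \<in> tuples n {..<d} \<Longrightarrow> J' \<in> tuples n {..<d} \<Longrightarrow>
      c \<in> tuples n {..<g} \<Longrightarrow> be permutes {..<n} \<Longrightarrow>
      (\<Sum>i\<in>tuples n {..<d}. T d J J' (ctup n c i) (ctup n c i \<circ> be)) = (if J \<circ> be = J' then 1 else 0)"
    and s: "s permutes {..<n}" and t: "t permutes {..<n}"
    and c: "c \<in> tuples n {..<g}" and c': "c' \<in> tuples n {..<g}"
  shows "(\<lambda>d. \<Sum>i\<in>tuples n {..<d}. \<Sum>i'\<in>tuples n {..<d}. T d (i \<circ> s) (i' \<circ> t) (ctup n c i) (ctup n c' i'))
    \<longlonglongrightarrow> (\<Sum>al\<in>perms n. if c \<circ> al = c' \<and> s \<circ> al = al \<circ> t then 1 else 0)"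
proof -
  define A where "A = {al\<in>perms n. c \<circ> al = c'}"
  have finA: "finite A"
    by (simp add: A_def)
  define F where "F = ctup n c (\<lambda>a. a)"
  define x where "x ga d al = (\<Sum>i\<in>tuples n {..<d}. T d (i \<circ> s) (i \<circ> ga \<circ> t) F (F \<circ> al))" for ga d al
  have tp: "i \<circ> p \<in> tuples n {..<d}" if "p permutes {..<n}" "i \<in> tuples n {..<d}" for p and i :: "nat \<Rightarrow> nat" and d :: nat
    using that by (rule tuples_comp_permutes)
  have cp: "c \<circ> p \<in> tuples n {..<g}" if "p permutes {..<n}" for p
    using that c by (rule tuples_comp_permutes)
  have cin: "ctup n c i \<in> tuples n ({..<g} \<times> {..<d})" if "c \<in> tuples n {..<g}" "i \<in> tuples n {..<d}" for c i d
    using that by (intro ctup_in) auto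
  have dec: "T d J J' (ctup n c i) (ctup n c2 i') = (\<Sum>al\<in>perms n. if c \<circ> al = c2 \<and> i \<circ> al = i' then T d J J' F (F \<circ> al) else 0)"
    if d: "d \<ge> 1" "3 * n \<le> d" and J: "J \<in> tuples n {..<d}" "J' \<in> tuples n {..<d}"
      and i: "i \<in> tuples n {..<d}" "i' \<in> tuples n {..<d}" and c2: "c2 \<in> tuples n {..<g}" for d J J' i i' c2
  proof -
    have "T d J J' (ctup n c i) (ctup n c2 i')
        = (\<Sum>al\<in>perms n. if ctup n c2 i' = ctup n c i \<circ> al then T d J J' F (F \<circ> al) else 0)"
      unfolding F_def
      by (rule infinitesimally_invariant_decomposition[OF inv[OF d(1) J] d(2) c i(1) cin[OF c2 i(2)]])
    also have "\<dots> = (\<Sum>al\<in>perms n. if c \<circ> al = c2 \<and> i \<circ> al = i' then T d J J' F (F \<circ> al) else 0)"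
    proof (rule sum.cong[OF refl])
      fix al assume "al \<in> perms n"
      then have al: "al permutes {..<n}"
        by blast
      have "ctup n c2 i' = ctup n c i \<circ> al \<longleftrightarrow> c \<circ> al = c2 \<and> i \<circ> al = i'"
        unfolding ctup_comp[OF al] using ctup_eq_iff[OF c2 cp[OF al] i(2) tp[OF al i(1)]] by blast
      then show "(if ctup n c2 i' = ctup n c i \<circ> al then T d J J' F (F \<circ> al) else 0)
          = (if c \<circ> al = c2 \<and> i \<circ> al = i' then T d J J' F (F \<circ> al) else 0)"
        by (simp only:)
    qed
    finally show ?thesis .
  qed
  have sumA: "(\<Sum>al\<in>perms n. if c \<circ> al = c' then h al else 0) = (\<Sum>al\<in>A. h al)" for h :: "_ \<Rightarrow> complex"
    unfolding A_def by (rule sum.inter_filter[OF finite_perms, symmetric])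
  have finT: "finite (tuples n {..<d::nat})" for d
    by (intro finite_PiE) auto
  \<comment> \<open>The decomposition forces \<open>i' = i \<circ> al\<close>. The double sum over
    rows collapses, and only the diagonal values \<open>x ga d ga\<close> remain.\<close>
  have main: "(\<Sum>i\<in>tuples n {..<d}. \<Sum>i'\<in>tuples n {..<d}. T d (i \<circ> s) (i' \<circ> t) (ctup n c i) (ctup n c' i'))
      = (\<Sum>ga\<in>A. x ga d ga)" if d: "d \<ge> 1" "3 * n \<le> d" for d
  proof -
    have "(\<Sum>i'\<in>tuples n {..<d}. T d (i \<circ> s) (i' \<circ> t) (ctup n c i) (ctup n c' i'))
        = (\<Sum>ga\<in>A. T d (i \<circ> s) (i \<circ> ga \<circ> t) F (F \<circ> ga))" if i: "i \<in> tuples n {..<d}" for i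
    proof -
      have "(\<Sum>i'\<in>tuples n {..<d}. T d (i \<circ> s) (i' \<circ> t) (ctup n c i) (ctup n c' i'))
          = (\<Sum>i'\<in>tuples n {..<d}. \<Sum>al\<in>perms n. if c \<circ> al = c' \<and> i \<circ> al = i' then T d (i \<circ> s) (i' \<circ> t) F (F \<circ> al) else 0)"
        by (rule sum.cong[OF refl], rule dec[OF d tp[OF s i] tp[OF t] i _ c']) assumption+
      also have "\<dots> = (\<Sum>al\<in>perms n. \<Sum>i'\<in>tuples n {..<d}. if i' = i \<circ> al then
          if c \<circ> al = c' then T d (i \<circ> s) (i \<circ> al \<circ> t) F (F \<circ> al) else 0 else 0)"
      proof (subst sum.swap, rule sum.cong[OF refl], rule sum.cong[OF refl])
        fix al i'
        show "(if c \<circ> al = c' \<and> i \<circ> al = i' then T d (i \<circ> s) (i' \<circ> t) F (F \<circ> al) else 0)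
            = (if i' = i \<circ> al then if c \<circ> al = c' then T d (i \<circ> s) (i \<circ> al \<circ> t) F (F \<circ> al) else 0 else 0)"
          by (cases "i' = i \<circ> al"; cases "c \<circ> al = c'") simp_all
      qed
      also have "\<dots> = (\<Sum>al\<in>perms n. if c \<circ> al = c' then T d (i \<circ> s) (i \<circ> al \<circ> t) F (F \<circ> al) else 0)"
      proof (rule sum.cong[OF refl])
        fix al assume "al \<in> perms n"
        then have "i \<circ> al \<in> tuples n {..<d}"
          using tp i by blast
        then show "(\<Sum>i'\<in>tuples n {..<d}. if i' = i \<circ> al then
            if c \<circ> al = c' then T d (i \<circ> s) (i \<circ> al \<circ> t) F (F \<circ> al) else 0 else 0)
          = (if c \<circ> al = c' then T d (i \<circ> s) (i \<circ> al \<circ> t) F (F \<circ> al) else 0)"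
          by (simp only: sum.delta[OF finT] if_True)
      qed
      also have "\<dots> = (\<Sum>ga\<in>A. T d (i \<circ> s) (i \<circ> ga \<circ> t) F (F \<circ> ga))"
        by (rule sumA)
      finally show ?thesis .
    qed
    then have "(\<Sum>i\<in>tuples n {..<d}. \<Sum>i'\<in>tuples n {..<d}. T d (i \<circ> s) (i' \<circ> t) (ctup n c i) (ctup n c' i'))
        = (\<Sum>i\<in>tuples n {..<d}. \<Sum>ga\<in>A. T d (i \<circ> s) (i \<circ> ga \<circ> t) F (F \<circ> ga))"
      by (rule sum.cong[OF refl])
    also have "\<dots> = (\<Sum>ga\<in>A. x ga d ga)"
      unfolding x_def by (rule sum.swap)
    finally show ?thesis .
  qed
  have lim: "(\<lambda>d. x ga d ga) \<longlonglongrightarrow> (if s \<circ> ga = ga \<circ> t then 1 else 0)" if ga: "ga \<in> A" for ga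
  proof (rule linear_system_limit[OF finA _ _ _ ga, where x = "x ga"
        and G = "\<lambda>d be al. complex_of_nat (card {i\<in>tuples n {..<d}. i \<circ> al = i \<circ> be}) / of_nat d ^ n"
        and y = "\<lambda>d be. complex_of_nat (card {i\<in>tuples n {..<d}. i \<circ> (s \<circ> be) = i \<circ> (ga \<circ> t)}) / of_nat d ^ n"
        and z = "\<lambda>be. if s \<circ> be = ga \<circ> t then 1 else 0"])
    have gap: "ga permutes {..<n}"
      using ga by (simp add: A_def)
    show "(\<lambda>d. complex_of_nat (card {i\<in>tuples n {..<d}. i \<circ> (s \<circ> be) = i \<circ> (ga \<circ> t)}) / of_nat d ^ n)
        \<longlonglongrightarrow> (if s \<circ> be = ga \<circ> t then 1 else 0)" if "be \<in> A" for be
      by (intro card_agreeing_tuples permutes_compose s t gap) (use that in \<open>simp add: A_def\<close>)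
    have ev: "eventually (\<lambda>d. d \<ge> 1 \<and> 3 * n \<le> d) sequentially"
      using eventually_ge_at_top[of 1] eventually_ge_at_top[of "3 * n"] by eventually_elim simp
    show "(\<lambda>d. complex_of_nat (card {i\<in>tuples n {..<d}. i \<circ> al = i \<circ> be}) / of_nat d ^ n)
        \<longlonglongrightarrow> (if al = be then 1 else 0)" if "al \<in> A" "be \<in> A" for al be
      by (rule card_agreeing_tuples) (use that in \<open>simp_all add: A_def\<close>)
    show "eventually (\<lambda>d. \<forall>be\<in>A. (\<Sum>al\<in>A. x ga d al *
          (complex_of_nat (card {i\<in>tuples n {..<d}. i \<circ> al = i \<circ> be}) / of_nat d ^ n))
        = complex_of_nat (card {i\<in>tuples n {..<d}. i \<circ> (s \<circ> be) = i \<circ> (ga \<circ> t)}) / of_nat d ^ n) sequentially"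
      using ev
    proof (eventually_elim, intro ballI)
      fix d be assume d: "1 \<le> d \<and> 3 * n \<le> d" and be: "be \<in> A"
      have bep: "be permutes {..<n}" "c \<circ> be = c'"
        using be by (auto simp: A_def)
      \<comment> \<open>The relation \<open>gram\<close> after decomposition into permutations. The
        coefficients do not depend on \<open>i\<close>, so the sum over \<open>i\<close> merely
        counts agreements and an equation between coefficients results.\<close>
      have key: "(\<Sum>al\<in>A. T d J J' F (F \<circ> al) * of_nat (card {i\<in>tuples n {..<d}. i \<circ> al = i \<circ> be}))
          = (if J \<circ> be = J' then 1 else 0)" if J: "J \<in> tuples n {..<d}" "J' \<in> tuples n {..<d}" for J J'
      proof -
        have "(if J \<circ> be = J' then 1 else 0) = (\<Sum>i\<in>tuples n {..<d}. T d J J' (ctup n c i) (ctup n c' (i \<circ> be)))"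
          using gram[OF conjunct1[OF d] J c bep(1)] by (simp only: ctup_comp[OF bep(1)] bep(2))
        also have "\<dots> = (\<Sum>i\<in>tuples n {..<d}. \<Sum>al\<in>perms n. if c \<circ> al = c' \<and> i \<circ> al = i \<circ> be then T d J J' F (F \<circ> al) else 0)"
          by (rule sum.cong[OF refl], rule dec[OF conjunct1[OF d] conjunct2[OF d] J _ tp[OF bep(1)] c']) assumption+
        also have "\<dots> = (\<Sum>al\<in>perms n. if c \<circ> al = c' then \<Sum>i\<in>tuples n {..<d}. if i \<circ> al = i \<circ> be then T d J J' F (F \<circ> al) else 0 else 0)"
        proof (subst sum.swap, rule sum.cong[OF refl])
          fix al
          show "(\<Sum>i\<in>tuples n {..<d}. if c \<circ> al = c' \<and> i \<circ> al = i \<circ> be then T d J J' F (F \<circ> al) else 0)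
            = (if c \<circ> al = c' then \<Sum>i\<in>tuples n {..<d}. if i \<circ> al = i \<circ> be then T d J J' F (F \<circ> al) else 0 else 0)"
            by (cases "c \<circ> al = c'") (simp_all only: simp_thms if_False if_True sum.neutral_const)
        qed
        also have "\<dots> = (\<Sum>al\<in>A. \<Sum>i\<in>tuples n {..<d}. if i \<circ> al = i \<circ> be then T d J J' F (F \<circ> al) else 0)"
          by (rule sumA)
        also have "\<dots> = (\<Sum>al\<in>A. T d J J' F (F \<circ> al) * of_nat (card {i\<in>tuples n {..<d}. i \<circ> al = i \<circ> be}))"
        proof (rule sum.cong[OF refl])
          fix al
          have "(\<Sum>i\<in>tuples n {..<d}. if i \<circ> al = i \<circ> be then T d J J' F (F \<circ> al) else 0)
              = (\<Sum>i\<in>{i\<in>tuples n {..<d}. i \<circ> al = i \<circ> be}. T d J J' F (F \<circ> al))"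
            by (rule sum.inter_filter[OF finT, symmetric])
          then show "(\<Sum>i\<in>tuples n {..<d}. if i \<circ> al = i \<circ> be then T d J J' F (F \<circ> al) else 0)
              = T d J J' F (F \<circ> al) * of_nat (card {i\<in>tuples n {..<d}. i \<circ> al = i \<circ> be})"
            by (simp only: sum_constant mult.commute)
        qed
        finally show ?thesis ..
      qed
      have "(\<Sum>al\<in>A. x ga d al * of_nat (card {i\<in>tuples n {..<d}. i \<circ> al = i \<circ> be}))
          = (\<Sum>i0\<in>tuples n {..<d}. \<Sum>al\<in>A. T d (i0 \<circ> s) (i0 \<circ> ga \<circ> t) F (F \<circ> al) * of_nat (card {i\<in>tuples n {..<d}. i \<circ> al = i \<circ> be}))"
        unfolding x_def sum_distrib_right by (rule sum.swap)
      also have "\<dots> = (\<Sum>i0\<in>tuples n {..<d}. if i0 \<circ> (s \<circ> be) = i0 \<circ> (ga \<circ> t) then 1 else 0)"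
      proof (rule sum.cong[OF refl])
        fix i0 assume i0: "i0 \<in> tuples n {..<d}"
        from key[OF tp[OF s i0] tp[OF t tp[OF gap i0]]] show "(\<Sum>al\<in>A. T d (i0 \<circ> s) (i0 \<circ> ga \<circ> t) F (F \<circ> al) * of_nat (card {i\<in>tuples n {..<d}. i \<circ> al = i \<circ> be}))
            = (if i0 \<circ> (s \<circ> be) = i0 \<circ> (ga \<circ> t) then 1 else 0)"
          by (simp only: comp_assoc)
      qed
      also have "\<dots> = of_nat (card {i\<in>tuples n {..<d}. i \<circ> (s \<circ> be) = i \<circ> (ga \<circ> t)})"
        by (rule sum_ind_card[OF finT])
      finally have eq: "(\<Sum>al\<in>A. x ga d al * of_nat (card {i\<in>tuples n {..<d}. i \<circ> al = i \<circ> be}))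
          = of_nat (card {i\<in>tuples n {..<d}. i \<circ> (s \<circ> be) = i \<circ> (ga \<circ> t)})" .
      show "(\<Sum>al\<in>A. x ga d al *
          (complex_of_nat (card {i\<in>tuples n {..<d}. i \<circ> al = i \<circ> be}) / of_nat d ^ n))
        = complex_of_nat (card {i\<in>tuples n {..<d}. i \<circ> (s \<circ> be) = i \<circ> (ga \<circ> t)}) / of_nat d ^ n"
        unfolding eq[symmetric] sum_divide_distrib by (simp only: times_divide_eq_right)
    qed
  qed
  have L: "(\<lambda>d. \<Sum>ga\<in>A. x ga d ga) \<longlonglongrightarrow> (\<Sum>ga\<in>A. if s \<circ> ga = ga \<circ> t then 1 else 0)"
    by (intro tendsto_sum lim)
  have eq: "(\<Sum>ga\<in>A. if s \<circ> ga = ga \<circ> t then 1 else (0::complex))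
      = (\<Sum>al\<in>perms n. if c \<circ> al = c' \<and> s \<circ> al = al \<circ> t then 1 else 0)"
    unfolding sumA[symmetric]
  proof (rule sum.cong[OF refl])
    fix al
    show "(if c \<circ> al = c' then if s \<circ> al = al \<circ> t then 1 else 0 else (0::complex))
        = (if c \<circ> al = c' \<and> s \<circ> al = al \<circ> t then 1 else 0)"
      by (cases "c \<circ> al = c'") (simp_all only: simp_thms if_False if_True)
  qed
  have ev: "eventually (\<lambda>d. (\<Sum>ga\<in>A. x ga d ga)
      = (\<Sum>i\<in>tuples n {..<d}. \<Sum>i'\<in>tuples n {..<d}. T d (i \<circ> s) (i' \<circ> t) (ctup n c i) (ctup n c' i'))) sequentially"
    using eventually_ge_at_top[of 1] eventually_ge_at_top[of "3 * n"]
    by eventually_elim (rule main[symmetric])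
  show ?thesis
    using Lim_transform_eventually[OF L ev] unfolding eq .
qed

subsection \<open>The unitary group and its Haar measure\<close>

lemma mat_adjoint_carrier: "A \<in> carrier_mat n m \<Longrightarrow> mat_adjoint A \<in> carrier_mat m n"
  by (auto simp: mat_adjoint_def)

lemma mat_adjoint_index:
  assumes "A \<in> carrier_mat n m" "i < m" "j < n"
  shows "mat_adjoint A $$ (i, j) = conjugate (A $$ (j, i))"
  using assms by (simp add: mat_adjoint_def mat_of_rows_index)

lemma unitary_groupI:
  assumes U: "U \<in> carrier_mat d d"
    and rows: "\<And>x y. x < d \<Longrightarrow> y < d \<Longrightarrow> (\<Sum>k<d. U $$ (x, k) * cnj (U $$ (y, k))) = (if x = y then 1 else 0)"
    and cols: "\<And>x y. x < d \<Longrightarrow> y < d \<Longrightarrow> (\<Sum>k<d. cnj (U $$ (k, x)) * U $$ (k, y)) = (if x = y then 1 else 0)"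
  shows "U \<in> unitary_group d"
proof -
  note A = mat_adjoint_carrier[OF U]
  have "U * mat_adjoint U = 1\<^sub>m d"
  proof (rule eq_matI)
    fix x y assume xy: "x < dim_row (1\<^sub>m d :: complex mat)" "y < dim_col (1\<^sub>m d :: complex mat)"
    then have "(U * mat_adjoint U) $$ (x, y) = (\<Sum>k<d. U $$ (x, k) * mat_adjoint U $$ (k, y))"
      using U A by (auto simp: scalar_prod_def atLeast0LessThan intro!: sum.cong)
    also have "\<dots> = (\<Sum>k<d. U $$ (x, k) * cnj (U $$ (y, k)))"
      using xy by (intro sum.cong) (auto simp: mat_adjoint_index[OF U])
    finally show "(U * mat_adjoint U) $$ (x, y) = 1\<^sub>m d $$ (x, y)"
      using xy rows by simp
  qed (use U A in auto)
  moreover have "mat_adjoint U * U = 1\<^sub>m d"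
  proof (rule eq_matI)
    fix x y assume xy: "x < dim_row (1\<^sub>m d :: complex mat)" "y < dim_col (1\<^sub>m d :: complex mat)"
    then have "(mat_adjoint U * U) $$ (x, y) = (\<Sum>k<d. mat_adjoint U $$ (x, k) * U $$ (k, y))"
      using U A by (auto simp: scalar_prod_def atLeast0LessThan intro!: sum.cong)
    also have "\<dots> = (\<Sum>k<d. cnj (U $$ (k, x)) * U $$ (k, y))"
      using xy by (intro sum.cong) (auto simp: mat_adjoint_index[OF U])
    finally show "(mat_adjoint U * U) $$ (x, y) = 1\<^sub>m d $$ (x, y)"
      using xy cols by simp
  qed (use U A in auto)
  ultimately show ?thesis
    using U by (simp add: unitary_group_def)
qed

lemma unitary_group_columns:
  assumes "U \<in> unitary_group d" "x < d" "y < d"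
  shows "(\<Sum>k<d. U $$ (k, x) * cnj (U $$ (k, y))) = (if x = y then 1 else 0)"
proof -
  have U: "U \<in> carrier_mat d d" "mat_adjoint U * U = 1\<^sub>m d"
    using assms by (auto simp: unitary_group_def)
  have "(\<Sum>k<d. U $$ (k, x) * cnj (U $$ (k, y))) = (\<Sum>k<d. mat_adjoint U $$ (y, k) * U $$ (k, x))"
    using assms by (intro sum.cong) (auto simp: mat_adjoint_index[OF U(1)])
  also have "\<dots> = (mat_adjoint U * U) $$ (y, x)"
    using assms(2,3) U(1) mat_adjoint_carrier[OF U(1)]
    by (auto simp: scalar_prod_def atLeast0LessThan intro!: sum.cong)
  also have "\<dots> = (if x = y then 1 else 0)"
    using assms(2,3) by (auto simp: U(2))
  finally show ?thesis .
qed

lemma unitary_group_entry_le: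
  assumes "U \<in> unitary_group d" "x < d" "y < d"
  shows "norm (U $$ (x, y)) \<le> 1"
proof -
  have "of_real (\<Sum>k<d. (norm (U $$ (k, y)))\<^sup>2) = (1 :: complex)"
    using unitary_group_columns[OF assms(1,3,3)] by (simp only: of_real_sum complex_norm_square if_True refl simp_thms)
  then have "(\<Sum>k<d. (norm (U $$ (k, y)))\<^sup>2) = 1"
    using of_real_eq_1_iff by blast
  moreover have "(norm (U $$ (x, y)))\<^sup>2 \<le> (\<Sum>k<d. (norm (U $$ (k, y)))\<^sup>2)"
    using assms(2) by (intro member_le_sum) auto
  ultimately show ?thesis
    by (simp add: power_le_one_iff abs_square_le_1)
qed

lemma mat_adjoint_mult:
  fixes A B :: "complex mat"
  assumes A: "A \<in> carrier_mat n m" and B: "B \<in> carrier_mat m p"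
  shows "mat_adjoint (A * B) = mat_adjoint B * mat_adjoint A"
proof (rule eq_matI)
  have AB: "A * B \<in> carrier_mat n p" and aB: "mat_adjoint B \<in> carrier_mat p m" and aA: "mat_adjoint A \<in> carrier_mat m n"
    using A B by (auto intro: mat_adjoint_carrier)
  then show "dim_row (mat_adjoint (A * B)) = dim_row (mat_adjoint B * mat_adjoint A)"
    "dim_col (mat_adjoint (A * B)) = dim_col (mat_adjoint B * mat_adjoint A)"
    using mat_adjoint_carrier[OF AB] by auto
  fix x y assume "x < dim_row (mat_adjoint B * mat_adjoint A)" "y < dim_col (mat_adjoint B * mat_adjoint A)"
  then have xy: "x < p" "y < n"
    using aA aB by auto
  have "mat_adjoint (A * B) $$ (x, y) = cnj (\<Sum>l<m. A $$ (y, l) * B $$ (l, x))"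
    using xy by (simp only: mat_adjoint_index[OF AB] index_mult_mat_sum[OF A B] conjugate_complex_def)
  also have "\<dots> = (\<Sum>l<m. mat_adjoint B $$ (x, l) * mat_adjoint A $$ (l, y))"
    unfolding cnj_sum using xy by (intro sum.cong) (auto simp: mat_adjoint_index[OF A] mat_adjoint_index[OF B])
  also have "\<dots> = (mat_adjoint B * mat_adjoint A) $$ (x, y)"
    by (rule index_mult_mat_sum[OF aB aA xy, symmetric])
  finally show "mat_adjoint (A * B) $$ (x, y) = (mat_adjoint B * mat_adjoint A) $$ (x, y)" .
qed

lemma unitary_group_mult:
  assumes "V \<in> unitary_group d" "U \<in> unitary_group d"
  shows "V * U \<in> unitary_group d"
proof -
  have C: "V \<in> carrier_mat d d" "U \<in> carrier_mat d d"
    using assms by (auto simp: unitary_group_def)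
  note aV = mat_adjoint_carrier[OF C(1)] and aU = mat_adjoint_carrier[OF C(2)]
  have E: "V * mat_adjoint V = 1\<^sub>m d" "mat_adjoint V * V = 1\<^sub>m d" "U * mat_adjoint U = 1\<^sub>m d" "mat_adjoint U * U = 1\<^sub>m d"
    using assms by (auto simp: unitary_group_def)
  have cancel: "A * B * (B' * A') = 1\<^sub>m d"
    if "A \<in> carrier_mat d d" "B \<in> carrier_mat d d" "A' \<in> carrier_mat d d" "B' \<in> carrier_mat d d"
      "B * B' = 1\<^sub>m d" "A * A' = 1\<^sub>m d" for A B A' B' :: "complex mat"
  proof -
    have "A * B * (B' * A') = A * (B * (B' * A'))"
      by (rule assoc_mult_mat) (use that in auto)
    also have "B * (B' * A') = B * B' * A'"
      by (rule assoc_mult_mat[symmetric]) (use that in auto)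
    finally show ?thesis
      using that by simp
  qed
  show ?thesis
    using C by (simp add: unitary_group_def mat_adjoint_mult[OF C] cancel[OF C aV aU E(3,1)] cancel[OF aU aV C(2,1) E(2,4)])
qed

lemma one_unitary: "1\<^sub>m d \<in> unitary_group d"
  by (rule unitary_groupI) (auto simp: if_distrib[of cnj] if_distrib[of "(*) _"] if_distrib[of "\<lambda>x. x * _"] cong: if_cong)

lemma scalar_unitary: "norm z = 1 \<Longrightarrow> z \<cdot>\<^sub>m 1\<^sub>m d \<in> unitary_group d"
proof (rule unitary_groupI)
  assume "norm z = 1"
  then have z: "z * cnj z = 1"
    by (simp add: complex_norm_square[symmetric])
  fix x y assume xy: "x < d" "y < d"
  have "(\<Sum>k<d. (z \<cdot>\<^sub>m 1\<^sub>m d) $$ (x, k) * cnj ((z \<cdot>\<^sub>m 1\<^sub>m d) $$ (y, k))) = (\<Sum>k<d. if k = x then if x = y then 1 else 0 else 0)"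
    using xy z by (intro sum.cong) auto
  then show "(\<Sum>k<d. (z \<cdot>\<^sub>m 1\<^sub>m d) $$ (x, k) * cnj ((z \<cdot>\<^sub>m 1\<^sub>m d) $$ (y, k))) = (if x = y then 1 else 0)"
    using xy by simp
  have "(\<Sum>k<d. cnj ((z \<cdot>\<^sub>m 1\<^sub>m d) $$ (k, x)) * (z \<cdot>\<^sub>m 1\<^sub>m d) $$ (k, y)) = (\<Sum>k<d. if k = x then if x = y then 1 else 0 else 0)"
    using xy z by (intro sum.cong) (auto simp: mult.commute)
  then show "(\<Sum>k<d. cnj ((z \<cdot>\<^sub>m 1\<^sub>m d) $$ (k, x)) * (z \<cdot>\<^sub>m 1\<^sub>m d) $$ (k, y)) = (if x = y then 1 else 0)"
    using xy by simp
qed simp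

text \<open>Unlike integrability this class is closed under products, and on a finite measure space
  it implies integrability.\<close>

definition bounded_measurable :: "'a measure \<Rightarrow> ('a \<Rightarrow> complex) \<Rightarrow> bool" where
  "bounded_measurable M f \<longleftrightarrow> f \<in> borel_measurable M \<and> (\<exists>B. \<forall>x\<in>space M. norm (f x) \<le> B)"

lemma bounded_measurable_const: "bounded_measurable M (\<lambda>_. c)"
  by (auto simp: bounded_measurable_def)

lemma bounded_measurable_add:
  assumes "bounded_measurable M f" "bounded_measurable M h"
  shows "bounded_measurable M (\<lambda>x. f x + h x)"
proof -
  obtain A B where "\<And>x. x \<in> space M \<Longrightarrow> norm (f x) \<le> A" "\<And>x. x \<in> space M \<Longrightarrow> norm (h x) \<le> B"
    using assms unfolding bounded_measurable_def by blast
  then have "norm (f x + h x) \<le> A + B" if "x \<in> space M" for x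
    using norm_triangle_mono that by blast
  then have "\<exists>B. \<forall>x\<in>space M. norm (f x + h x) \<le> B"
    by blast
  then show ?thesis
    using assms unfolding bounded_measurable_def by (auto intro: borel_measurable_add)
qed

lemma bounded_measurable_mult:
  assumes "bounded_measurable M f" "bounded_measurable M h"
  shows "bounded_measurable M (\<lambda>x. f x * h x)"
proof -
  obtain A B where "\<And>x. x \<in> space M \<Longrightarrow> norm (f x) \<le> A" "\<And>x. x \<in> space M \<Longrightarrow> norm (h x) \<le> B"
    using assms unfolding bounded_measurable_def by blast
  then have "norm (f x * h x) \<le> A * B" if "x \<in> space M" for x
    unfolding norm_mult using that by (meson mult_mono' norm_ge_zero)
  then have "\<exists>B. \<forall>x\<in>space M. norm (f x * h x) \<le> B"
    by blast
  then show ?thesis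
    using assms unfolding bounded_measurable_def by (auto intro: borel_measurable_times)
qed

lemma bounded_measurable_cnj:
  assumes "bounded_measurable M f"
  shows "bounded_measurable M (\<lambda>x. cnj (f x))"
  using assms unfolding bounded_measurable_def complex_mod_cnj
  by (auto intro: borel_measurable_continuous_on[OF continuous_on_cnj[OF continuous_on_id]])

lemma bounded_measurable_sum:
  "(\<And>i. i \<in> I \<Longrightarrow> bounded_measurable M (f i)) \<Longrightarrow> bounded_measurable M (\<lambda>x. \<Sum>i\<in>I. f i x)"
  by (induction I rule: infinite_finite_induct) (auto intro: bounded_measurable_const bounded_measurable_add)

lemma bounded_measurable_prod:
  "(\<And>i. i \<in> I \<Longrightarrow> bounded_measurable M (f i)) \<Longrightarrow> bounded_measurable M (\<lambda>x. \<Prod>i\<in>I. f i x)"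
  by (induction I rule: infinite_finite_induct) (auto intro: bounded_measurable_const bounded_measurable_mult)

lemmas bounded_measurable_intros =
  bounded_measurable_const bounded_measurable_add bounded_measurable_mult bounded_measurable_cnj
  bounded_measurable_sum bounded_measurable_prod

lemma (in finite_measure) bounded_measurable_integrable:
  assumes "bounded_measurable M f"
  shows "integrable M f"
proof -
  obtain B where "\<forall>x\<in>space M. norm (f x) \<le> B" and "f \<in> borel_measurable M"
    using assms unfolding bounded_measurable_def by blast
  then show ?thesis
    by (intro integrable_const_bound[of _ B]) auto
qed

section \<open>Translation invariance of the product Haar measure\<close>

locale haar_unitary =
  fixes d g :: nat and M :: "complex mat measure"
  assumes haar: "is_haar_unitary d M"
begin

abbreviation "H \<equiv> haar_power g M"

lemma prob_M: "prob_space M" and space_M: "space M = unitary_group d"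
  and sets_M: "sets M = sets (unitary_borel d)"
  and left_inv: "V \<in> unitary_group d \<Longrightarrow> distr M M (\<lambda>U. V * U) = M"
  using haar by (auto simp: is_haar_unitary_def)

lemma prob_H: "prob_space H"
  unfolding haar_power_def by (intro prob_space_PiM prob_M)

lemma space_H: "U \<in> space H \<Longrightarrow> j < g \<Longrightarrow> U j \<in> unitary_group d"
  by (auto simp: haar_power_def space_PiM space_M)

lemma entry_measurable_M:
  assumes "x < d" "y < d"
  shows "(\<lambda>U. U $$ (x, y)) \<in> borel_measurable M"
proof -
  let ?N = "PiM ({..<d} \<times> {..<d}) (\<lambda>_. borel :: complex measure)"
  let ?f = "\<lambda>U :: complex mat. \<lambda>ij \<in> {..<d} \<times> {..<d}. U $$ ij"
  have "?f \<in> measurable (unitary_borel d) ?N"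
    unfolding unitary_borel_def by (rule measurable_vimage_algebra1) (auto simp: space_PiM)
  then have f: "?f \<in> measurable M ?N"
    by (simp only: measurable_cong_sets[OF sets_M refl])
  have "(\<lambda>U. ?f U (x, y)) \<in> borel_measurable M"
    by (rule measurable_compose[OF f measurable_component_singleton]) (use assms in auto)
  then show ?thesis
    using assms by simp
qed

lemma mult_measurable:
  assumes V: "V \<in> unitary_group d"
  shows "(\<lambda>U. V * U) \<in> measurable M M"
proof -
  have "(\<lambda>U. V * U) \<in> measurable M (unitary_borel d)"
    unfolding unitary_borel_def
  proof (rule measurable_vimage_algebra2)
    show "(\<lambda>U. V * U) \<in> space M \<rightarrow> unitary_group d"
      using unitary_group_mult[OF V] by (auto simp: space_M)
    show "(\<lambda>U. \<lambda>ij\<in>{..<d} \<times> {..<d}. (V * U) $$ ij) \<in> measurable M (PiM ({..<d} \<times> {..<d}) (\<lambda>_. borel))"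
    proof (rule measurable_restrict)
      fix ij :: "nat \<times> nat" assume "ij \<in> {..<d} \<times> {..<d}"
      then obtain x y where xy: "ij = (x, y)" "x < d" "y < d"
        by auto
      have "(\<lambda>U. \<Sum>l<d. V $$ (x, l) * U $$ (l, y)) \<in> borel_measurable M"
        by (intro borel_measurable_sum borel_measurable_times borel_measurable_const entry_measurable_M) (use xy in auto)
      moreover have "(V * U) $$ ij = (\<Sum>l<d. V $$ (x, l) * U $$ (l, y))" if "U \<in> space M" for U
        using that V xy by (auto simp: space_M unitary_group_def scalar_prod_def atLeast0LessThan intro!: sum.cong)
      ultimately show "(\<lambda>U. (V * U) $$ ij) \<in> borel_measurable M"
        by (simp cong: measurable_cong)
    qed
  qed
  then show ?thesis
    by (simp only: measurable_cong_sets[OF refl sets_M])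
qed

lemma entry_bounded_measurable:
  assumes "j < g" "x < d" "y < d"
  shows "bounded_measurable H (\<lambda>U. U j $$ (x, y))"
proof -
  have "(\<lambda>U. U j) \<in> measurable H M"
    unfolding haar_power_def by (rule measurable_component_singleton) (use assms in auto)
  then have "(\<lambda>U. U j $$ (x, y)) \<in> borel_measurable H"
    by (rule measurable_compose) (rule entry_measurable_M[OF assms(2,3)])
  then show ?thesis
    using unitary_group_entry_le[OF space_H[OF _ assms(1)] assms(2,3)] unfolding bounded_measurable_def by blast
qed

definition translate :: "(nat \<Rightarrow> complex mat) \<Rightarrow> (nat \<Rightarrow> complex mat) \<Rightarrow> nat \<Rightarrow> complex mat" where
  "translate V U = restrict (\<lambda>j. V j * U j) {..<g}"

lemma translate_measurable:
  assumes V: "\<And>j. j < g \<Longrightarrow> V j \<in> unitary_group d"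
  shows "translate V \<in> measurable H H"
  unfolding haar_power_def translate_def
proof (rule measurable_restrict)
  fix j assume j: "j \<in> {..<g}"
  show "(\<lambda>U. V j * U j) \<in> measurable (PiM {..<g} (\<lambda>_. M)) M"
    by (rule measurable_compose[OF measurable_component_singleton[OF j] mult_measurable]) (use V j in auto)
qed

text \<open>The product measure is determined by its values on boxes. The preimage of a box is the
  box of the preimages, whose sides keep their measure by left invariance. Each factor may be
  translated by a unitary of its own.\<close>

lemma distr_translate:
  assumes V: "\<And>j. j < g \<Longrightarrow> V j \<in> unitary_group d"
  shows "distr H H (translate V) = H"
proof -
  interpret M: prob_space M by (rule prob_M)
  interpret P: product_sigma_finite "\<lambda>_ :: nat. M" by standard
  have "distr H H (translate V) = PiM {..<g} (\<lambda>_. M)"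
  proof (rule P.PiM_eqI)
    show "sets (distr H H (translate V)) = PiM {..<g} (\<lambda>_. M)"
      by (simp add: haar_power_def)
    fix A :: "nat \<Rightarrow> complex mat set" assume A: "\<And>j. j \<in> {..<g} \<Longrightarrow> A j \<in> sets M"
    let ?B = "\<lambda>j. (\<lambda>U. V j * U) -` A j \<inter> space M"
    have B: "?B j \<in> sets M" if "j \<in> {..<g}" for j
      using measurable_sets[OF mult_measurable[OF V] A] that by auto
    have AH: "Pi\<^sub>E {..<g} A \<in> sets H"
      unfolding haar_power_def by (intro sets_PiM_I_finite) (use A in auto)
    have eq: "translate V -` Pi\<^sub>E {..<g} A \<inter> space H = Pi\<^sub>E {..<g} ?B"
      by (auto simp: translate_def haar_power_def space_PiM PiE_def Pi_def)
    have "emeasure (distr H H (translate V)) (Pi\<^sub>E {..<g} A) = emeasure H (Pi\<^sub>E {..<g} ?B)"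
      using translate_measurable[OF V] AH by (subst emeasure_distr) (auto simp: eq)
    also have "\<dots> = (\<Prod>j\<in>{..<g}. emeasure M (?B j))"
      unfolding haar_power_def by (rule P.emeasure_PiM) (use B in auto)
    also have "\<dots> = (\<Prod>j\<in>{..<g}. emeasure M (A j))"
    proof (rule prod.cong[OF refl])
      fix j assume j: "j \<in> {..<g}"
      have "emeasure M (?B j) = emeasure (distr M M (\<lambda>U. V j * U)) (A j)"
        by (rule emeasure_distr[symmetric]) (use mult_measurable V A j in auto)
      then show "emeasure M (?B j) = emeasure M (A j)"
        using left_inv V j by simp
    qed
    finally show "emeasure (distr H H (translate V)) (Pi\<^sub>E {..<g} A) = (\<Prod>j\<in>{..<g}. emeasure M (A j))" .
  qed simp
  then show ?thesis
    by (simp add: haar_power_def)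
qed

lemma integral_translate:
  fixes F :: "_ \<Rightarrow> complex"
  assumes V: "\<And>j. j < g \<Longrightarrow> V j \<in> unitary_group d" and F: "F \<in> borel_measurable H"
  shows "(LINT U|H. F (translate V U)) = (LINT U|H. F U)"
  using integral_distr[OF translate_measurable[OF V] F] distr_translate[OF V] by simp

end

subsection \<open>Derivatives of moments along unitary paths\<close>

text \<open>Derivatives are taken as limits of \<open>m * (w m - u)\<close> along sequences. This
  suits dominated convergence and asks for no smooth curves in the group.\<close>

lemma diffquot_tendsto:
  fixes w :: "nat \<Rightarrow> complex"
  assumes "(\<lambda>m. of_nat m * (w m - u)) \<longlonglongrightarrow> v"
  shows "w \<longlonglongrightarrow> u"
proof -
  have "(\<lambda>m. inverse (of_nat m) * (of_nat m * (w m - u))) \<longlonglongrightarrow> 0 * v"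
    by (intro tendsto_mult lim_inverse_n assms)
  moreover have "eventually (\<lambda>m. inverse (of_nat m) * (of_nat m * (w m - u)) = w m - u) sequentially"
    using eventually_gt_at_top[of 0] by eventually_elim simp
  ultimately have "(\<lambda>m. w m - u) \<longlonglongrightarrow> 0 * v"
    by (rule Lim_transform_eventually)
  then show ?thesis
    by (simp add: LIM_zero_iff)
qed

lemma diffquot_mult:
  fixes w w' :: "nat \<Rightarrow> complex"
  assumes 1: "(\<lambda>m. of_nat m * (w m - u)) \<longlonglongrightarrow> v" and 2: "(\<lambda>m. of_nat m * (w' m - u')) \<longlonglongrightarrow> v'"
  shows "(\<lambda>m. of_nat m * (w m * w' m - u * u')) \<longlonglongrightarrow> v * u' + u * v'"
proof -
  have "(\<lambda>m. of_nat m * (w m - u) * w' m + u * (of_nat m * (w' m - u'))) \<longlonglongrightarrow> v * u' + u * v'"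
    by (intro tendsto_intros 1 2 diffquot_tendsto[OF 2])
  moreover have "of_nat m * (w m - u) * w' m + u * (of_nat m * (w' m - u')) = of_nat m * (w m * w' m - u * u')" for m
    by (simp add: algebra_simps)
  ultimately show ?thesis
    by (simp only:)
qed

lemma diffquot_prod:
  fixes w :: "'a \<Rightarrow> nat \<Rightarrow> complex"
  assumes "finite A" and "\<And>a. a \<in> A \<Longrightarrow> (\<lambda>m. of_nat m * (w a m - u a)) \<longlonglongrightarrow> v a"
  shows "(\<lambda>m. of_nat m * ((\<Prod>a\<in>A. w a m) - (\<Prod>a\<in>A. u a))) \<longlonglongrightarrow> (\<Sum>a\<in>A. v a * (\<Prod>b\<in>A - {a}. u b))"
  using assms
proof (induction A rule: finite_induct)
  case (insert x A)
  have "(\<lambda>m. of_nat m * (w x m * (\<Prod>a\<in>A. w a m) - u x * (\<Prod>a\<in>A. u a)))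
      \<longlonglongrightarrow> v x * (\<Prod>a\<in>A. u a) + u x * (\<Sum>a\<in>A. v a * (\<Prod>b\<in>A - {a}. u b))"
    by (rule diffquot_mult) (use insert in auto)
  moreover have "v x * (\<Prod>a\<in>A. u a) + u x * (\<Sum>a\<in>A. v a * (\<Prod>b\<in>A - {a}. u b))
      = (\<Sum>a\<in>insert x A. v a * (\<Prod>b\<in>insert x A - {a}. u b))"
  proof -
    have "v a * (\<Prod>b\<in>insert x A - {a}. u b) = u x * (v a * (\<Prod>b\<in>A - {a}. u b))" if "a \<in> A" for a
    proof -
      have "insert x A - {a} = insert x (A - {a})"
        using insert.hyps that by auto
      then show ?thesis
        using insert.hyps by simp
    qed
    then have "(\<Sum>a\<in>A. v a * (\<Prod>b\<in>insert x A - {a}. u b)) = (\<Sum>a\<in>A. u x * (v a * (\<Prod>b\<in>A - {a}. u b)))"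
      by (rule sum.cong[OF refl])
    then show ?thesis
      using insert.hyps by (simp add: sum_distrib_left)
  qed
  ultimately show ?case
    using insert.hyps by simp
qed simp

context haar_unitary
begin

definition mon :: "nat \<Rightarrow> (nat \<Rightarrow> nat) \<Rightarrow> (nat \<Rightarrow> nat \<times> nat) \<Rightarrow> (nat \<Rightarrow> complex mat) \<Rightarrow> complex" where
  "mon n J I U = (\<Prod>a<n. U (fst (I a)) $$ (snd (I a), J a))"

text \<open>The column tuples \<open>J\<close> and \<open>J'\<close> come first because they are
  parameters: left translation changes row indices only, so for fixed columns this is a tensor in
  \<open>I\<close> and \<open>I'\<close>.\<close>

definition moment :: "nat \<Rightarrow> (nat \<Rightarrow> nat) \<Rightarrow> (nat \<Rightarrow> nat) \<Rightarrow> (nat \<Rightarrow> nat \<times> nat) \<Rightarrow> (nat \<Rightarrow> nat \<times> nat) \<Rightarrow> complex" where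
  "moment n J J' I I' = (LINT U|H. mon n J I U * cnj (mon n J' I' U))"

abbreviation "rowtup n \<equiv> tuples n ({..<g} \<times> {..<d})"
abbreviation "coltup n \<equiv> tuples n {..<d}"

lemma rowsD: "I \<in> rowtup n \<Longrightarrow> a < n \<Longrightarrow> fst (I a) < g \<and> snd (I a) < d"
  by (auto simp: PiE_def Pi_def mem_Times_iff)

lemma colsD: "J \<in> coltup n \<Longrightarrow> a < n \<Longrightarrow> J a < d"
  by auto

lemma mon_bounded_measurable: "I \<in> rowtup n \<Longrightarrow> J \<in> coltup n \<Longrightarrow> bounded_measurable H (mon n J I)"
  unfolding mon_def
  by (intro bounded_measurable_prod entry_bounded_measurable) (auto dest: rowsD colsD)

lemma mon_mult_bounded_measurable:
  assumes "I \<in> rowtup n" "I' \<in> rowtup n" "J \<in> coltup n" "J' \<in> coltup n"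
  shows "bounded_measurable H (\<lambda>U. mon n J I U * cnj (mon n J' I' U))"
  by (intro bounded_measurable_mult bounded_measurable_cnj mon_bounded_measurable assms)

lemma integrable_H: "bounded_measurable H f \<Longrightarrow> integrable H f"
  using finite_measure.bounded_measurable_integrable prob_H prob_space_def by blast

lemma mon_le_1:
  assumes "U \<in> space H" "I \<in> rowtup n" "J \<in> coltup n"
  shows "norm (mon n J I U) \<le> 1"
  unfolding mon_def prod_norm[symmetric]
proof (rule prod_le_1)
  fix a assume "a \<in> {..<n}"
  then have "fst (I a) < g" "snd (I a) < d" "J a < d"
    using rowsD[OF assms(2)] colsD[OF assms(3)] by auto
  then show "0 \<le> norm (U (fst (I a)) $$ (snd (I a), J a)) \<and> norm (U (fst (I a)) $$ (snd (I a), J a)) \<le> 1"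
    using unitary_group_entry_le[OF space_H[OF assms(1)]] by simp
qed

lemma mon_upd:
  assumes "a < n"
  shows "mon n J (I(a := (j, k))) U = U j $$ (k, J a) * (\<Prod>b\<in>{..<n} - {a}. U (fst (I b)) $$ (snd (I b), J b))"
proof -
  have "mon n J (I(a := (j, k))) U = U j $$ (k, J a)
      * (\<Prod>b\<in>{..<n} - {a}. U (fst ((I(a := (j, k))) b)) $$ (snd ((I(a := (j, k))) b), J b))"
    unfolding mon_def using assms by (subst prod.remove[of _ a]) auto
  also have "(\<Prod>b\<in>{..<n} - {a}. U (fst ((I(a := (j, k))) b)) $$ (snd ((I(a := (j, k))) b), J b))
      = (\<Prod>b\<in>{..<n} - {a}. U (fst (I b)) $$ (snd (I b), J b))"
    by (rule prod.cong) auto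
  finally show ?thesis .
qed

text \<open>Translating factor \<open>j\<close> by \<open>V m\<close>, which is
  \<open>1 + K / m\<close> to first order, does not change the integral, so the difference quotients
  integrate to 0. They are bounded uniformly in \<open>U\<close>, and by dominated convergence their
  limit, given by the product rule, integrates to 0 as well.\<close>

lemma moment_derivative:
  assumes V: "\<And>m. V m \<in> unitary_group d" and j: "j < g"
    and K: "\<And>x y. x < d \<Longrightarrow> y < d \<Longrightarrow>
      (\<lambda>m. of_nat m * (V m $$ (x, y) - (if x = y then 1 else 0))) \<longlonglongrightarrow> K x y"
    and I: "I \<in> rowtup n" "I' \<in> rowtup n" and J: "J \<in> coltup n" "J' \<in> coltup n"
  shows "(\<Sum>a<n. if fst (I a) = j then \<Sum>k<d. K (snd (I a)) k * moment n J J' (I(a := (j, k))) I' else 0)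
    + (\<Sum>b<n. if fst (I' b) = j then \<Sum>k<d. cnj (K (snd (I' b)) k) * moment n J J' I (I'(b := (j, k))) else 0) = 0"
proof -
  interpret H: prob_space H by (rule prob_H)
  define W where "W m i = (if i = j then V m else 1\<^sub>m d)" for m i
  have W: "W m i \<in> unitary_group d" for m i
    using V one_unitary by (simp add: W_def)
  define tr where "tr m = translate (W m)" for m
  have tr_space: "tr m U \<in> space H" if "U \<in> space H" for m U
    using measurable_space[OF translate_measurable[OF W] that] by (simp add: tr_def)
  define f where "f U = mon n J I U * cnj (mon n J' I' U)" for U
  have f_bm: "bounded_measurable H f"
    unfolding f_def[abs_def] by (rule mon_mult_bounded_measurable[OF I J])
  have ft_bm: "bounded_measurable H (\<lambda>U. f (tr m U))" for m
  proof -
    have "(\<lambda>U. f (tr m U)) \<in> borel_measurable H"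
      using f_bm unfolding tr_def bounded_measurable_def
      by (intro measurable_compose[OF translate_measurable[OF W]]) auto
    moreover obtain B where "\<forall>U\<in>space H. norm (f U) \<le> B"
      using f_bm unfolding bounded_measurable_def by blast
    then have "\<forall>U\<in>space H. norm (f (tr m U)) \<le> B"
      using tr_space by blast
    ultimately show ?thesis
      unfolding bounded_measurable_def by blast
  qed
  define D where "D m U = of_nat m * (f (tr m U) - f U)" for m U
  have int_D: "(LINT U|H. D m U) = 0" for m
  proof -
    have "(LINT U|H. f (tr m U)) = (LINT U|H. f U)"
      unfolding tr_def by (rule integral_translate[OF W]) (use f_bm in \<open>simp add: bounded_measurable_def\<close>)
    then show ?thesis
      unfolding D_def
      by (simp add: Bochner_Integration.integral_diff[OF integrable_H[OF ft_bm] integrable_H[OF f_bm]])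
  qed
  define E where "E U x l = (if fst x = j then \<Sum>k<d. K (snd x) k * U j $$ (k, l) else 0)" for U x l
  have diff: "tr m U i $$ (p, l) - U i $$ (p, l)
      = (if i = j then \<Sum>k<d. (V m $$ (p, k) - (if p = k then 1 else 0)) * U j $$ (k, l) else 0)"
    if U: "U \<in> space H" and i: "i < g" and pl: "p < d" "l < d" for m U i p l
  proof -
    have C: "U i \<in> carrier_mat d d" "W m i \<in> carrier_mat d d"
      using space_H[OF U i] W[of m i] by (auto simp: unitary_group_def)
    have "tr m U i $$ (p, l) = (\<Sum>k<d. W m i $$ (p, k) * U i $$ (k, l))"
      using index_mult_mat_sum[OF C(2,1) pl] i by (simp add: tr_def translate_def)
    moreover have "U i $$ (p, l) = (\<Sum>k<d. (if p = k then 1 else 0) * U i $$ (k, l))"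
      using pl by (simp add: if_distrib[of "\<lambda>x. x * _"] cong: if_cong)
    ultimately have "tr m U i $$ (p, l) - U i $$ (p, l) = (\<Sum>k<d. (W m i $$ (p, k) - (if p = k then 1 else 0)) * U i $$ (k, l))"
      by (simp only: sum_subtractf[symmetric] left_diff_distrib)
    also have "\<dots> = (if i = j then \<Sum>k<d. (V m $$ (p, k) - (if p = k then 1 else 0)) * U j $$ (k, l) else 0)"
      using pl by (auto simp: W_def intro!: sum.neutral)
    finally show ?thesis .
  qed
  have entry_lim: "(\<lambda>m. of_nat m * (tr m U (fst x) $$ (snd x, l) - U (fst x) $$ (snd x, l))) \<longlonglongrightarrow> E U x l"
    if U: "U \<in> space H" and x: "fst x < g \<and> snd x < d" and l: "l < d" for U x l
  proof (cases "fst x = j")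
    case True
    have "(\<lambda>m. \<Sum>k<d. of_nat m * (V m $$ (snd x, k) - (if snd x = k then 1 else 0)) * U j $$ (k, l))
        \<longlonglongrightarrow> (\<Sum>k<d. K (snd x) k * U j $$ (k, l))"
      using x by (intro tendsto_sum tendsto_mult tendsto_const K) auto
    moreover have "of_nat m * (tr m U (fst x) $$ (snd x, l) - U (fst x) $$ (snd x, l))
        = (\<Sum>k<d. of_nat m * (V m $$ (snd x, k) - (if snd x = k then 1 else 0)) * U j $$ (k, l))" for m
      unfolding diff[OF U conjunct1[OF x] conjunct2[OF x] l] if_P[OF True] sum_distrib_left mult.assoc ..
    ultimately show ?thesis
      by (simp only: E_def if_P[OF True])
  next
    case False
    then show ?thesis
      by (simp add: diff[OF U conjunct1[OF x] conjunct2[OF x] l] E_def)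
  qed
  have "\<exists>B. \<forall>m. norm (of_nat m * (V m $$ (x, y) - (if x = y then 1 else 0))) \<le> B" if "x < d" "y < d" for x y
  proof -
    have "Bseq (\<lambda>m. of_nat m * (V m $$ (x, y) - (if x = y then 1 else 0)))"
      by (rule convergent_imp_Bseq[OF convergentI[OF K[OF that]]])
    then show ?thesis
      unfolding Bseq_def by blast
  qed
  then obtain B0 where B0: "\<And>x y m. x < d \<Longrightarrow> y < d \<Longrightarrow> norm (of_nat m * (V m $$ (x, y) - (if x = y then 1 else 0))) \<le> B0 x y"
    by metis
  \<comment> \<open>The difference quotients of the entries of \<open>V m\<close> converge and so
    are bounded. Summing the bounds yields one constant for all entries, all \<open>m\<close> and
    all \<open>U\<close>.\<close>
  define B where "B = (\<Sum>x<d. \<Sum>y<d. max 0 (B0 x y))"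
  have B_nonneg: "0 \<le> B"
    unfolding B_def by (intro sum_nonneg) auto
  have entry_bound: "of_nat m * norm (tr m U (fst x) $$ (snd x, l) - U (fst x) $$ (snd x, l)) \<le> B"
    if U: "U \<in> space H" and x: "fst x < g \<and> snd x < d" and l: "l < d" for U x l m
  proof (cases "fst x = j")
    case True
    have "of_nat m * norm (tr m U (fst x) $$ (snd x, l) - U (fst x) $$ (snd x, l))
        = norm (\<Sum>k<d. of_nat m * (V m $$ (snd x, k) - (if snd x = k then 1 else 0)) * U j $$ (k, l))"
      unfolding diff[OF U conjunct1[OF x] conjunct2[OF x] l] if_P[OF True] mult.assoc sum_distrib_left[symmetric] norm_mult
      by simp
    also have "\<dots> \<le> (\<Sum>k<d. max 0 (B0 (snd x) k))"
    proof (rule order_trans[OF norm_sum sum_mono])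
      fix k assume "k \<in> {..<d}"
      then have k: "k < d" by simp
      have "norm (of_nat m * (V m $$ (snd x, k) - (if snd x = k then 1 else 0)) * U j $$ (k, l))
          \<le> B0 (snd x) k * 1"
        unfolding norm_mult[of _ "U j $$ (k, l)"]
        by (intro mult_mono' B0 unitary_group_entry_le[OF space_H[OF U j] k l]) (use x k in auto)
      then show "norm (of_nat m * (V m $$ (snd x, k) - (if snd x = k then 1 else 0)) * U j $$ (k, l))
          \<le> max 0 (B0 (snd x) k)"
        by simp
    qed
    also have "\<dots> \<le> B"
      unfolding B_def using x
      by (intro member_le_sum[where f = "\<lambda>x. \<Sum>y<d. max 0 (B0 x y)"]) (auto intro: sum_nonneg)
    finally show ?thesis .
  next
    case False
    then show ?thesis
      using B_nonneg by (simp add: diff[OF U conjunct1[OF x] conjunct2[OF x] l])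
  qed
  have mon_bound: "of_nat m * norm (mon n J I (tr m U) - mon n J I U) \<le> n * B"
    if U: "U \<in> space H" and I: "I \<in> rowtup n" and J: "J \<in> coltup n" for U I J m
  proof -
    have "norm (mon n J I (tr m U) - mon n J I U)
        \<le> (\<Sum>a<n. norm (tr m U (fst (I a)) $$ (snd (I a), J a) - U (fst (I a)) $$ (snd (I a), J a)))"
      unfolding mon_def
      by (intro norm_prod_diff unitary_group_entry_le[where d = d] space_H[OF U] space_H[OF tr_space[OF U]])
        (use rowsD[OF I] colsD[OF J] in auto)
    then have "of_nat m * norm (mon n J I (tr m U) - mon n J I U)
        \<le> (\<Sum>a<n. of_nat m * norm (tr m U (fst (I a)) $$ (snd (I a), J a) - U (fst (I a)) $$ (snd (I a), J a)))"
      unfolding sum_distrib_left[symmetric] by (intro mult_left_mono) auto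
    also have "\<dots> \<le> (\<Sum>a<n. B)"
      using rowsD[OF I] colsD[OF J] by (intro sum_mono entry_bound[OF U]) auto
    finally show ?thesis
      by simp
  qed
  have D_bound: "norm (D m U) \<le> n * B + n * B" if U: "U \<in> space H" for m U
  proof -
    let ?p = "mon n J I" and ?q = "mon n J' I'"
    have "f (tr m U) - f U = (?p (tr m U) - ?p U) * cnj (?q (tr m U)) + ?p U * cnj (?q (tr m U) - ?q U)"
      by (simp add: f_def algebra_simps)
    then have "norm (f (tr m U) - f U) \<le> norm (?p (tr m U) - ?p U) * norm (?q (tr m U)) + norm (?p U) * norm (?q (tr m U) - ?q U)"
      by (metis norm_triangle_ineq norm_mult complex_mod_cnj)
    also have "\<dots> \<le> norm (?p (tr m U) - ?p U) * 1 + 1 * norm (?q (tr m U) - ?q U)"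
      by (intro add_mono mult_mono mon_le_1[OF tr_space[OF U] I(2) J(2)] mon_le_1[OF U I(1) J(1)]) auto
    finally have "of_nat m * norm (f (tr m U) - f U) \<le> of_nat m * (norm (?p (tr m U) - ?p U) + norm (?q (tr m U) - ?q U))"
      by (intro mult_left_mono) auto
    also have "\<dots> \<le> n * B + n * B"
      unfolding distrib_left by (intro add_mono mon_bound[OF U] I J)
    finally show ?thesis
      by (simp add: D_def norm_mult)
  qed
  define L1 where "L1 U I J = (\<Sum>a<n. E U (I a) (J a) * (\<Prod>b\<in>{..<n} - {a}. U (fst (I b)) $$ (snd (I b), J b)))" for U I and J :: "nat \<Rightarrow> nat"
  define L where "L U = L1 U I J * cnj (mon n J' I' U) + mon n J I U * cnj (L1 U I' J')" for U
  have mon_lim: "(\<lambda>m. of_nat m * (mon n J I (tr m U) - mon n J I U)) \<longlonglongrightarrow> L1 U I J"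
    if U: "U \<in> space H" and I: "I \<in> rowtup n" and J: "J \<in> coltup n" for U I J
    unfolding mon_def L1_def
    by (intro diffquot_prod entry_lim[OF U]) (use rowsD[OF I] colsD[OF J] in auto)
  have D_lim: "(\<lambda>m. D m U) \<longlonglongrightarrow> L U" if U: "U \<in> space H" for U
    unfolding D_def f_def L_def
  proof (rule diffquot_mult[OF mon_lim[OF U I(1) J(1)]])
    have "(\<lambda>m. cnj (of_nat m * (mon n J' I' (tr m U) - mon n J' I' U))) \<longlonglongrightarrow> cnj (L1 U I' J')"
      by (rule tendsto_cnj[OF mon_lim[OF U I(2) J(2)]])
    then show "(\<lambda>m. of_nat m * (cnj (mon n J' I' (tr m U)) - cnj (mon n J' I' U))) \<longlonglongrightarrow> cnj (L1 U I' J')"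
      by simp
  qed
  define R where "R U = (\<Sum>a<n. if fst (I a) = j then \<Sum>k<d. K (snd (I a)) k * (mon n J (I(a := (j, k))) U * cnj (mon n J' I' U)) else 0)
    + (\<Sum>b<n. if fst (I' b) = j then \<Sum>k<d. cnj (K (snd (I' b)) k) * (mon n J I U * cnj (mon n J' (I'(b := (j, k))) U)) else 0)" for U
  have L1_eq: "L1 U I J = (\<Sum>a<n. if fst (I a) = j then \<Sum>k<d. K (snd (I a)) k * mon n J (I(a := (j, k))) U else 0)" for U I J
    unfolding L1_def E_def by (intro sum.cong refl) (auto simp: mon_upd sum_distrib_right mult.assoc)
  have if_mult: "(if b then x else 0) * y = (if b then x * y else 0)" "y * (if b then x else 0) = (if b then y * x else 0)"
    "cnj (if b then x else 0) = (if b then cnj x else 0)" for b and x y :: complex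
    by auto
  have L_eq: "L U = R U" for U
    unfolding L_def L1_eq R_def cnj_sum sum_distrib_right sum_distrib_left if_mult complex_cnj_mult
    by (simp only: mult.assoc mult.left_commute)
  have upd: "I(a := (j, k)) \<in> rowtup n" if "I \<in> rowtup n" "a < n" "k < d" for I a k
    using that j by (intro tuples_upd) auto
  have bm1: "bounded_measurable H (\<lambda>U. mon n J (I(a := (j, k))) U * cnj (mon n J' I' U))" if "a < n" "k < d" for a k
    by (intro mon_mult_bounded_measurable upd I J that)
  have bm2: "bounded_measurable H (\<lambda>U. mon n J I U * cnj (mon n J' (I'(a := (j, k))) U))" if "a < n" "k < d" for a k
    by (intro mon_mult_bounded_measurable upd I J that)
  have s1: "bounded_measurable H (\<lambda>U. if fst (I a) = j then \<Sum>k<d. K (snd (I a)) k * (mon n J (I(a := (j, k))) U * cnj (mon n J' I' U)) else 0)" if "a < n" for a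
  proof (cases "fst (I a) = j")
    case True
    show ?thesis
      unfolding if_P[OF True]
      by (intro bounded_measurable_sum bounded_measurable_mult[OF bounded_measurable_const] bm1 that) simp
  qed (simp add: bounded_measurable_const)
  have s2: "bounded_measurable H (\<lambda>U. if fst (I' b) = j then \<Sum>k<d. cnj (K (snd (I' b)) k) * (mon n J I U * cnj (mon n J' (I'(b := (j, k))) U)) else 0)" if "b < n" for b
  proof (cases "fst (I' b) = j")
    case True
    show ?thesis
      unfolding if_P[OF True]
      by (intro bounded_measurable_sum bounded_measurable_mult[OF bounded_measurable_const] bm2 that) simp
  qed (simp add: bounded_measurable_const)
  have bmR: "bounded_measurable H R"
    unfolding R_def[abs_def] by (intro bounded_measurable_add bounded_measurable_sum s1 s2) auto
  have "(\<lambda>m. LINT U|H. D m U) \<longlonglongrightarrow> (LINT U|H. R U)"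
  proof (rule integral_dominated_convergence[where w = "\<lambda>_. n * B + n * B"])
    show "R \<in> borel_measurable H"
      using bmR by (simp add: bounded_measurable_def)
    show "D m \<in> borel_measurable H" for m
      using ft_bm[of m] f_bm unfolding D_def[abs_def] bounded_measurable_def
      by (intro borel_measurable_times borel_measurable_diff borel_measurable_const) auto
    show "AE U in H. (\<lambda>m. D m U) \<longlonglongrightarrow> R U"
      using D_lim L_eq by (intro AE_I2) auto
    show "AE U in H. norm (D m U) \<le> n * B + n * B" for m
      using D_bound by (intro AE_I2) auto
  qed simp
  then have int_R: "(LINT U|H. R U) = 0"
    by (simp add: int_D LIMSEQ_const_iff)
  have split: "(LINT U|H. R U)
    = (\<Sum>a<n. LINT U|H. (if fst (I a) = j then \<Sum>k<d. K (snd (I a)) k * (mon n J (I(a := (j, k))) U * cnj (mon n J' I' U)) else 0))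
    + (\<Sum>b<n. LINT U|H. (if fst (I' b) = j then \<Sum>k<d. cnj (K (snd (I' b)) k) * (mon n J I U * cnj (mon n J' (I'(b := (j, k))) U)) else 0))"
    unfolding R_def
    by (subst Bochner_Integration.integral_add)
      (auto intro!: integrable_H bounded_measurable_sum s1 s2 arg_cong2[of _ _ _ _ "(+)"] Bochner_Integration.integral_sum)
  have part1: "(LINT U|H. (if fst (I a) = j then \<Sum>k<d. K (snd (I a)) k * (mon n J (I(a := (j, k))) U * cnj (mon n J' I' U)) else 0))
      = (if fst (I a) = j then \<Sum>k<d. K (snd (I a)) k * moment n J J' (I(a := (j, k))) I' else 0)" if "a < n" for a
  proof (cases "fst (I a) = j")
    case True
    have "(LINT U|H. (\<Sum>k<d. K (snd (I a)) k * (mon n J (I(a := (j, k))) U * cnj (mon n J' I' U))))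
        = (\<Sum>k<d. (LINT U|H. K (snd (I a)) k * (mon n J (I(a := (j, k))) U * cnj (mon n J' I' U))))"
      by (intro Bochner_Integration.integral_sum integrable_H bounded_measurable_mult[OF bounded_measurable_const] bm1 that) auto
    then show ?thesis
      using True by (simp add: moment_def)
  qed simp
  have part2: "(LINT U|H. (if fst (I' b) = j then \<Sum>k<d. cnj (K (snd (I' b)) k) * (mon n J I U * cnj (mon n J' (I'(b := (j, k))) U)) else 0))
      = (if fst (I' b) = j then \<Sum>k<d. cnj (K (snd (I' b)) k) * moment n J J' I (I'(b := (j, k))) else 0)" if "b < n" for b
  proof (cases "fst (I' b) = j")
    case True
    have "(LINT U|H. (\<Sum>k<d. cnj (K (snd (I' b)) k) * (mon n J I U * cnj (mon n J' (I'(b := (j, k))) U))))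
        = (\<Sum>k<d. (LINT U|H. cnj (K (snd (I' b)) k) * (mon n J I U * cnj (mon n J' (I'(b := (j, k))) U))))"
      by (intro Bochner_Integration.integral_sum integrable_H bounded_measurable_mult[OF bounded_measurable_const] bm2 that) auto
    then show ?thesis
      using True by (simp add: moment_def)
  qed simp
  show ?thesis
    by (rule trans[OF _ trans[OF split[symmetric] int_R]], rule arg_cong2[of _ _ _ _ "(+)"])
      (rule sum.cong[OF refl], rule part1[symmetric], simp, rule sum.cong[OF refl], rule part2[symmetric], simp)
qed

end

subsection \<open>Limits of the moments of word traces\<close>

text \<open>This matrix multiplies the vector \<open>u\<close> by \<open>z\<close> and fixes its
  orthogonal complement. As \<open>z\<close> leaves 1 along the unit circle it gives an explicit
  unitary path whose derivative is a multiple of the rank one matrix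
  \<open>u x * cnj (u y)\<close>.\<close>

lemma rank_one_unitary:
  fixes u :: "nat \<Rightarrow> complex"
  assumes N: "(\<Sum>x<d. u x * cnj (u x)) = N" "N \<noteq> 0" and z: "norm z = 1"
  shows "Matrix.mat d d (\<lambda>(x, y). (if x = y then 1 else 0) + (z - 1) / N * (u x * cnj (u y))) \<in> unitary_group d"
proof -
  define s where "s = (z - 1) / N"
  have cN: "cnj N = N"
    unfolding N(1)[symmetric] by (simp add: mult.commute)
  have zz: "z * cnj z = 1"
    using z by (simp add: complex_norm_square[symmetric])
  \<comment> \<open>Multiplied by the real number \<open>N\<close>, the left side is
    \<open>|1 + s * N|^2 - 1\<close>, and \<open>1 + s * N = z\<close> has modulus 1.\<close>
  have s0: "s + cnj s + s * cnj s * N = 0"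
  proof -
    have "(s + cnj s + s * cnj s * N) * N = (z - 1) + (cnj z - 1) + (z - 1) * (cnj z - 1)"
      using N(2) by (simp add: s_def cN field_simps)
    also have "\<dots> = 0"
      using zz by (simp add: algebra_simps)
    finally show ?thesis
      using N(2) by simp
  qed
  have delta: "(\<Sum>k<d. (if x = k then 1 else 0) * h k) = h x" "(\<Sum>k<d. (if k = x then 1 else 0) * h k) = h x"
    if "x < d" for x and h :: "nat \<Rightarrow> complex"
    using that by (simp_all add: if_distrib[of "\<lambda>x. x * _"] cong: if_cong)
  define W where "W = Matrix.mat d d (\<lambda>(x, y). (if x = y then 1 else 0) + (z - 1) / N * (u x * cnj (u y)))"
  have V: "W $$ (x, y) = (if x = y then 1 else 0) + s * (u x * cnj (u y))" if "x < d" "y < d" for x y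
    using that by (simp add: W_def s_def)
  have "W \<in> unitary_group d"
  proof (rule unitary_groupI)
  fix x y assume xy: "x < d" "y < d"
  have "(\<Sum>k<d. W $$ (x, k) * cnj (W $$ (y, k)))
      = (\<Sum>k<d. (if x = k then 1 else 0) * (if y = k then 1 else 0) + (if x = k then 1 else 0) * (cnj s * (cnj (u y) * u k))
        + (if y = k then 1 else 0) * (s * (u x * cnj (u k))) + s * cnj s * (u x * cnj (u y)) * (u k * cnj (u k)))"
    using xy by (intro sum.cong) (auto simp: V algebra_simps)
  also have "\<dots> = (if y = x then 1 else 0) + cnj s * (cnj (u y) * u x) + s * (u x * cnj (u y)) + s * cnj s * (u x * cnj (u y)) * N"
    unfolding sum.distrib sum_distrib_left[symmetric] N(1) using xy by (simp only: delta)
  also have "\<dots> = (if y = x then 1 else 0) + (s + cnj s + s * cnj s * N) * (u x * cnj (u y))"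
    by (simp add: algebra_simps)
  finally show "(\<Sum>k<d. W $$ (x, k) * cnj (W $$ (y, k))) = (if x = y then 1 else 0)"
    by (simp add: s0)
  have "(\<Sum>k<d. cnj (W $$ (k, x)) * W $$ (k, y))
      = (\<Sum>k<d. (if k = x then 1 else 0) * (if k = y then 1 else 0) + (if k = x then 1 else 0) * (s * (u k * cnj (u y)))
        + (if k = y then 1 else 0) * (cnj s * (cnj (u k) * u x)) + s * cnj s * (u x * cnj (u y)) * (u k * cnj (u k)))"
    using xy by (intro sum.cong) (auto simp: V algebra_simps)
  also have "\<dots> = (if x = y then 1 else 0) + s * (u x * cnj (u y)) + cnj s * (cnj (u y) * u x) + s * cnj s * (u x * cnj (u y)) * N"
    unfolding sum.distrib sum_distrib_left[symmetric] N(1) using xy by (simp only: delta)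
  also have "\<dots> = (if x = y then 1 else 0) + (s + cnj s + s * cnj s * N) * (u x * cnj (u y))"
    by (simp add: algebra_simps)
  finally show "(\<Sum>k<d. cnj (W $$ (k, x)) * W $$ (k, y)) = (if x = y then 1 else 0)"
    by (simp add: s0)
  qed (simp add: W_def)
  then show ?thesis
    by (simp only: W_def)
qed

lemma cis_diffquot: "(\<lambda>m. of_nat m * (cis (1 / real m) - 1)) \<longlonglongrightarrow> \<i>"
proof -
  have "(\<lambda>m. real m * (cos (1 / real m) - 1)) \<longlonglongrightarrow> 0" "(\<lambda>m. real m * sin (1 / real m)) \<longlonglongrightarrow> 1"
    by real_asymp+
  then have "(\<lambda>m. Complex (real m * (cos (1 / real m) - 1)) (real m * sin (1 / real m))) \<longlonglongrightarrow> Complex 0 1"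
    by (rule tendsto_Complex)
  moreover have "Complex (real m * (cos (1 / real m) - 1)) (real m * sin (1 / real m)) = of_nat m * (cis (1 / real m) - 1)" for m
    by (simp add: complex_eq_iff)
  moreover have "Complex 0 1 = \<i>"
    by (simp add: complex_eq_iff)
  ultimately show ?thesis
    by simp
qed

text \<open>A product over the cycles of \<open>s\<close>: each factor is the trace of the word in
  the \<open>U j\<close> that the colours \<open>c\<close> spell along the cycle.\<close>

definition word_trace :: "nat \<Rightarrow> nat \<Rightarrow> (nat \<Rightarrow> nat) \<Rightarrow> (nat \<Rightarrow> nat) \<Rightarrow> (nat \<Rightarrow> complex mat) \<Rightarrow> complex" where
  "word_trace d n s c U = ptr n s {..<d} (\<lambda>a x y. U (c a) $$ (x, y))"

context haar_unitary
begin

text \<open>The defect of invariance under the matrix \<open>h\<close> in factor \<open>j\<close>.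
  In the second sum \<open>h\<close> is transposed and carries a minus sign. This is what the
  conjugate of an anti-Hermitian matrix becomes, and it makes the expression complex linear in
  \<open>h\<close>, so that generators can be combined freely.\<close>

definition generator_action where
  "generator_action n j J J' I I' h
    = (\<Sum>a<n. if fst (I a) = j then \<Sum>k<d. h (snd (I a)) k * moment n J J' (I(a := (j, k))) I' else 0)
    - (\<Sum>b<n. if fst (I' b) = j then \<Sum>k<d. h k (snd (I' b)) * moment n J J' I (I'(b := (j, k))) else 0)"

lemma generator_action_add:
  "generator_action n j J J' I I' (\<lambda>x y. h x y + h' x y)
    = generator_action n j J J' I I' h + generator_action n j J J' I I' h'"
proof -
  have if_add: "(if b then x + y else 0) = (if b then x else 0) + (if b then y else 0)" for b and x y :: complex
    by auto
  show ?thesis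
    unfolding generator_action_def distrib_right sum.distrib if_add by simp
qed

lemma generator_action_scale:
  "generator_action n j J J' I I' (\<lambda>x y. c * h x y) = c * generator_action n j J J' I I' h"
proof -
  have if_mult: "(if b then c * x else 0) = c * (if b then x else 0)" for b and x :: complex
    by auto
  show ?thesis
    unfolding generator_action_def mult.assoc sum_distrib_left[symmetric] if_mult right_diff_distrib ..
qed

lemma generator_action_rank_one:
  assumes N: "(\<Sum>x<d. u x * cnj (u x)) \<noteq> 0" and j: "j < g"
    and I: "I \<in> rowtup n" "I' \<in> rowtup n" and J: "J \<in> coltup n" "J' \<in> coltup n"
  shows "generator_action n j J J' I I' (\<lambda>x y. u x * cnj (u y)) = 0"
proof -
  define N where "N = (\<Sum>x<d. u x * cnj (u x))"
  define V where "V m = Matrix.mat d d (\<lambda>(x, y). (if x = y then 1 else 0) + (cis (1 / real m) - 1) / N * (u x * cnj (u y)))" for m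
  define K where "K x y = \<i> / N * (u x * cnj (u y))" for x y
  have cN: "cnj N = N"
    by (simp add: N_def mult.commute)
  have N0: "N \<noteq> 0"
    using N by (simp add: N_def)
  have V: "V m \<in> unitary_group d" for m
    unfolding V_def by (rule rank_one_unitary[OF N_def[symmetric] N0]) simp
  have K: "(\<lambda>m. of_nat m * (V m $$ (x, y) - (if x = y then 1 else 0))) \<longlonglongrightarrow> K x y" if "x < d" "y < d" for x y
  proof -
    have "(\<lambda>m. of_nat m * (cis (1 / real m) - 1) / N * (u x * cnj (u y))) \<longlonglongrightarrow> K x y"
      unfolding K_def by (intro tendsto_intros cis_diffquot N0)
    moreover have "of_nat m * (V m $$ (x, y) - (if x = y then 1 else 0)) = of_nat m * (cis (1 / real m) - 1) / N * (u x * cnj (u y))" for m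
      using that by (simp add: V_def)
    ultimately show ?thesis
      by (simp only:)
  qed
  have cK: "cnj (K x y) = - (\<i> / N * (u y * cnj (u x)))" for x y
    by (simp add: K_def cN)
  have if_neg: "(if b then - x else 0) = - (if b then x else 0)" for b and x :: complex
    by auto
  have "generator_action n j J J' I I' (\<lambda>x y. \<i> / N * (u x * cnj (u y))) = 0"
  proof -
    have "(\<Sum>a<n. if fst (I a) = j then \<Sum>k<d. K (snd (I a)) k * moment n J J' (I(a := (j, k))) I' else 0)
      + (\<Sum>b<n. if fst (I' b) = j then \<Sum>k<d. cnj (K (snd (I' b)) k) * moment n J J' I (I'(b := (j, k))) else 0) = 0"
      by (rule moment_derivative[OF V j K I J])
    then show ?thesis
      unfolding cK mult_minus_left sum_negf if_neg unfolding K_def generator_action_def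
      by (simp only: diff_conv_add_uminus)
  qed
  then have "\<i> / N * generator_action n j J J' I I' (\<lambda>x y. u x * cnj (u y)) = 0"
    by (simp only: generator_action_scale)
  then show ?thesis
    using N0 by simp
qed

text \<open>The unitary paths reach only the matrices \<open>u x * cnj (u y)\<close>, but these span
  all complex matrices. By linearity the matrix units are reached as well.\<close>

lemma moment_infinitesimally_invariant:
  assumes J: "J \<in> coltup n" "J' \<in> coltup n"
  shows "infinitesimally_invariant n g d (moment n J J')"
  unfolding infinitesimally_invariant_def
proof (intro allI impI ballI)
  fix j p q I I'
  assume j: "j < g" and p: "p < d" and q: "q < d" and I: "I \<in> rowtup n" "I' \<in> rowtup n"
  let ?R = "generator_action n j J J' I I'"
  define e where "e p x y = (if x = p \<and> y = (p :: nat) then 1 else (0 :: complex))" for p x y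
  define h where "h w x y = ((if x = p then 1 else 0) + w * (if x = q then 1 else 0)) * cnj ((if y = p then 1 else 0) + w * (if y = q then 1 else 0))" for w and x y :: nat
  have Re: "?R (e r) = 0" if r: "r < d" for r
  proof -
    have "?R (\<lambda>x y. (if x = r then 1 else 0) * cnj (if y = r then 1 else 0)) = 0"
    proof (rule generator_action_rank_one[OF _ j I J])
      have "(\<Sum>x<d. (if x = r then 1 else 0) * cnj (if x = r then 1 else 0)) = (\<Sum>x<d. if x = r then 1 else (0 :: complex))"
        by (intro sum.cong) auto
      then show "(\<Sum>x<d. (if x = r then 1 else 0) * cnj (if x = r then 1 else 0)) \<noteq> (0 :: complex)"
        using r by simp
    qed
    moreover have "(\<lambda>x y. (if x = r then 1 else 0) * cnj (if y = r then 1 else 0)) = e r"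
      by (auto simp: fun_eq_iff e_def)
    ultimately show ?thesis
      by simp
  qed
  have main: "?R (\<lambda>x y. if x = p \<and> y = q then 1 else 0) = 0"
  proof (cases "p = q")
    case True
    then show ?thesis
      using Re[OF p] by (simp add: e_def[abs_def])
  next
    case False
    have Rh: "?R (h w) = 0" if w: "norm w = 1" for w
      unfolding h_def[abs_def]
    proof (rule generator_action_rank_one[OF _ j I J])
      have ww: "w * cnj w = 1"
        using w by (simp add: complex_norm_square[symmetric])
      have "(\<Sum>x<d. ((if x = p then 1 else 0) + w * (if x = q then 1 else 0)) * cnj ((if x = p then 1 else 0) + w * (if x = q then 1 else 0)))
        = (\<Sum>x<d. (if x = p then 1 else 0) + (if x = q then 1 else 0))"
        using False ww by (intro sum.cong) auto
      also have "\<dots> = 2"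
        using p q by (simp add: sum.distrib)
      finally show "(\<Sum>x<d. ((if x = p then 1 else 0) + w * (if x = q then 1 else 0)) * cnj ((if x = p then 1 else 0) + w * (if x = q then 1 else 0))) \<noteq> 0"
        by simp
    qed
    \<comment> \<open>Polarization. For \<open>w\<close> of modulus 1, \<open>h w\<close> is
      \<open>e p + e q\<close> plus \<open>w\<close> times the unit at \<open>(q, p)\<close> plus
      \<open>cnj w\<close> times the unit at \<open>(p, q)\<close>. The factors \<open>1 / 2\<close>
      and \<open>\<i> / 2\<close> cancel the unit at \<open>(q, p)\<close>, and the multiples of
      \<open>e p\<close> and \<open>e q\<close> remove the diagonal.\<close>
    have "(\<lambda>x y. if x = p \<and> y = q then 1 else 0)
        = (\<lambda>x y. (1 / 2 * h 1 x y + \<i> / 2 * h \<i> x y) + (- (1 + \<i>) / 2 * e p x y + - (1 + \<i>) / 2 * e q x y))"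
    proof (intro ext)
      fix x y
      show "(if x = p \<and> y = q then 1 else 0)
          = (1 / 2 * h 1 x y + \<i> / 2 * h \<i> x y) + (- (1 + \<i>) / 2 * e p x y + - (1 + \<i>) / 2 * e q x y)"
        using False by (cases "x = p"; cases "x = q"; cases "y = p"; cases "y = q") (simp_all add: h_def e_def field_simps)
    qed
    then show ?thesis
      by (simp only: generator_action_add generator_action_scale Rh Re[OF p] Re[OF q] norm_one norm_ii)
        simp
  qed
  have rhs: "(if fst x = j then \<Sum>k<d. (if snd x = p \<and> k = q then 1 else 0) * T k else 0) = (if x = (j, p) then T q else 0)"
    for x :: "nat \<times> nat" and T :: "nat \<Rightarrow> complex"
  proof -
    have "(\<Sum>k<d. (if snd x = p \<and> k = q then 1 else 0) * T k) = (\<Sum>k<d. if k = q then (if snd x = p then T q else 0) else 0)"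
      by (intro sum.cong) auto
    then show ?thesis
      using q by (cases x) auto
  qed
  have lhs: "(if fst x = j then \<Sum>k<d. (if k = p \<and> snd x = q then 1 else 0) * T k else 0) = (if x = (j, q) then T p else 0)"
    for x :: "nat \<times> nat" and T :: "nat \<Rightarrow> complex"
  proof -
    have "(\<Sum>k<d. (if k = p \<and> snd x = q then 1 else 0) * T k) = (\<Sum>k<d. if k = p then (if snd x = q then T p else 0) else 0)"
      by (intro sum.cong) auto
    then show ?thesis
      using p by (cases x) auto
  qed
  show "(\<Sum>a<n. if I a = (j, p) then moment n J J' (I(a := (j, q))) I' else 0)
      = (\<Sum>b<n. if I' b = (j, q) then moment n J J' I (I'(b := (j, p))) else 0)"
    using main unfolding generator_action_def rhs lhs by (simp only: right_minus_eq)
qed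

text \<open>The identity holds pointwise, before integration. Summed over all rows, the integrand
  factors over the positions; since the colours are permuted along with the rows, each factor is the
  inner product of two columns of one and the same unitary matrix.\<close>

lemma moment_gram:
  assumes J: "J \<in> coltup n" "J' \<in> coltup n" and c: "c \<in> tuples n {..<g}" and be: "be permutes {..<n}"
  shows "(\<Sum>i\<in>coltup n. moment n J J' (ctup n c i) (ctup n c i \<circ> be)) = (if J \<circ> be = J' then 1 else 0)"
proof -
  interpret H: prob_space H by (rule prob_H)
  have ben: "be a < n \<longleftrightarrow> a < n" for a
    using permutes_in_image[OF be] by (metis lessThan_iff)
  have cg: "c a < g" if "a < n" for a
    using c that by auto
  have ct: "ctup n c i \<in> rowtup n" if "i \<in> coltup n" for i
    using that cg by (intro ctup_in) auto
  have "(\<Sum>i\<in>coltup n. moment n J J' (ctup n c i) (ctup n c i \<circ> be))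
      = (LINT U|H. (\<Sum>i\<in>coltup n. mon n J (ctup n c i) U * cnj (mon n J' (ctup n c i \<circ> be) U)))"
    unfolding moment_def
    by (rule Bochner_Integration.integral_sum[symmetric], rule integrable_H,
        rule mon_mult_bounded_measurable[OF ct tuples_comp_permutes[OF be ct] J])
  also have "\<dots> = (LINT U|H. (if J \<circ> be = J' then 1 else 0))"
  proof (rule Bochner_Integration.integral_cong[OF refl])
    fix U assume U: "U \<in> space H"
    let ?u = "\<lambda>a i l. U (c (be a)) $$ (i, l)"
    have "mon n J (ctup n c i) U * cnj (mon n J' (ctup n c i \<circ> be) U)
        = (\<Prod>a<n. ?u a ((i \<circ> be) a) (J (be a)) * cnj (?u a ((i \<circ> be) a) (J' a)))" for i
    proof -
      have "mon n J (ctup n c i) U = (\<Prod>a<n. U (c a) $$ (i a, J a))"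
        unfolding mon_def by (rule prod.cong) (auto simp: ctup_def)
      also have "\<dots> = (\<Prod>a<n. ?u a (i (be a)) (J (be a)))"
        by (subst prod.permute[OF be]) (simp add: o_def)
      moreover have "mon n J' (ctup n c i \<circ> be) U = (\<Prod>a<n. ?u a (i (be a)) (J' a))"
        unfolding mon_def by (rule prod.cong) (auto simp: ctup_def ben)
      ultimately show ?thesis
        by (simp add: prod.distrib)
    qed
    then have "(\<Sum>i\<in>coltup n. mon n J (ctup n c i) U * cnj (mon n J' (ctup n c i \<circ> be) U))
        = (\<Sum>i\<in>coltup n. \<Prod>a<n. ?u a ((i \<circ> be) a) (J (be a)) * cnj (?u a ((i \<circ> be) a) (J' a)))"
      by (simp only:)
    also have "\<dots> = (\<Sum>i\<in>coltup n. \<Prod>a<n. ?u a (i a) (J (be a)) * cnj (?u a (i a) (J' a)))"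
      by (rule sum_tuples_permute[OF be])
    also have "\<dots> = (\<Prod>a<n. \<Sum>i<d. ?u a i (J (be a)) * cnj (?u a i (J' a)))"
      by (rule prod_sum_PiE[symmetric]) auto
    also have "\<dots> = (\<Prod>a<n. if J (be a) = J' a then 1 else 0)"
    proof (rule prod.cong[OF refl])
      fix a assume "a \<in> {..<n}"
      then have "a < n" "be a < n"
        by (auto simp: ben)
      then show "(\<Sum>i<d. ?u a i (J (be a)) * cnj (?u a i (J' a))) = (if J (be a) = J' a then 1 else 0)"
        by (intro unitary_group_columns[OF space_H[OF U cg]] colsD[OF J(1)] colsD[OF J(2)])
    qed
    also have "\<dots> = (if J \<circ> be = J' then 1 else 0)"
    proof (cases "J \<circ> be = J'")
      case True
      then show ?thesis
        by (auto simp: fun_eq_iff intro!: prod.neutral)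
    next
      case False
      have "\<exists>a<n. J (be a) \<noteq> J' a"
      proof (rule ccontr)
        assume "\<not> ?thesis"
        then have "J \<circ> be = J'"
          by (intro PiE_ext[OF tuples_comp_permutes[OF be J(1)] J(2)]) auto
        with False show False ..
      qed
      then obtain a where "a < n" "J (be a) \<noteq> J' a"
        by blast
      then have "(\<Prod>a<n. if J (be a) = J' a then 1 else (0::complex)) = 0"
        by (intro prod_zero) auto
      then show ?thesis
        using False by simp
    qed
    finally show "(\<Sum>i\<in>coltup n. mon n J (ctup n c i) U * cnj (mon n J' (ctup n c i \<circ> be) U)) = (if J \<circ> be = J' then 1 else 0)" .
  qed
  also have "\<dots> = (if J \<circ> be = J' then 1 else 0)"
    by (simp add: H.prob_space)
  finally show ?thesis .
qed

lemma word_trace_eq_sum_mon: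
  "word_trace d n s c U = (\<Sum>i\<in>coltup n. mon n (i \<circ> s) (ctup n c i) U)"
  unfolding word_trace_def ptr_def mon_def by (intro sum.cong prod.cong) (auto simp: ctup_def)

lemma word_trace_bounded_measurable:
  assumes s: "s permutes {..<n}" and c: "c \<in> tuples n {..<g}"
  shows "bounded_measurable H (word_trace d n s c)"
  unfolding word_trace_eq_sum_mon[abs_def]
  by (intro bounded_measurable_sum mon_bounded_measurable ctup_in tuples_comp_permutes[OF s]) (use c in auto)

lemma word_trace_moment:
  assumes s: "s permutes {..<n}" and t: "t permutes {..<n}"
    and c: "c \<in> tuples n {..<g}" and c': "c' \<in> tuples n {..<g}"
  shows "(LINT U|H. word_trace d n s c U * cnj (word_trace d n t c' U))
    = (\<Sum>i\<in>coltup n. \<Sum>i'\<in>coltup n. moment n (i \<circ> s) (i' \<circ> t) (ctup n c i) (ctup n c' i'))"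
proof -
  have bm: "bounded_measurable H (\<lambda>U. mon n (i \<circ> s) (ctup n c i) U * cnj (mon n (i' \<circ> t) (ctup n c' i') U))"
    if "i \<in> coltup n" "i' \<in> coltup n" for i i'
    by (intro mon_mult_bounded_measurable ctup_in tuples_comp_permutes[OF s] tuples_comp_permutes[OF t]) (use c c' that in auto)
  have "(LINT U|H. word_trace d n s c U * cnj (word_trace d n t c' U))
      = (LINT U|H. (\<Sum>i\<in>coltup n. \<Sum>i'\<in>coltup n. mon n (i \<circ> s) (ctup n c i) U * cnj (mon n (i' \<circ> t) (ctup n c' i') U)))"
    unfolding word_trace_eq_sum_mon cnj_sum sum_product ..
  also have "\<dots> = (\<Sum>i\<in>coltup n. LINT U|H. (\<Sum>i'\<in>coltup n. mon n (i \<circ> s) (ctup n c i) U * cnj (mon n (i' \<circ> t) (ctup n c' i') U)))"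
    by (rule Bochner_Integration.integral_sum, rule integrable_H, rule bounded_measurable_sum, rule bm)
  also have "\<dots> = (\<Sum>i\<in>coltup n. \<Sum>i'\<in>coltup n. moment n (i \<circ> s) (i' \<circ> t) (ctup n c i) (ctup n c' i'))"
    unfolding moment_def
    by (rule sum.cong[OF refl], rule Bochner_Integration.integral_sum, rule integrable_H, rule bm)
  finally show ?thesis .
qed

end

text \<open>The limit counts the relabellings that carry the coloured permutation
  \<open>(s, c)\<close> to \<open>(t, c')\<close>. It is nonzero only if the cycles of both spell
  the same words up to rotation and order.\<close>

lemma word_trace_moment_limit:
  assumes haar: "\<And>d. d \<ge> 1 \<Longrightarrow> is_haar_unitary d (haar d)"
    and s: "s permutes {..<n}" and t: "t permutes {..<n}"
    and c: "c \<in> tuples n {..<g}" and c': "c' \<in> tuples n {..<g}"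
  shows "(\<lambda>d. LINT U|haar_power g (haar d). word_trace d n s c U * cnj (word_trace d n t c' U))
    \<longlonglongrightarrow> (\<Sum>al\<in>perms n. if c \<circ> al = c' \<and> s \<circ> al = al \<circ> t then 1 else 0)"
proof -
  have L: "(\<lambda>d. \<Sum>i\<in>tuples n {..<d}. \<Sum>i'\<in>tuples n {..<d}.
        haar_unitary.moment g (haar d) n (i \<circ> s) (i' \<circ> t) (ctup n c i) (ctup n c' i'))
    \<longlonglongrightarrow> (\<Sum>al\<in>perms n. if c \<circ> al = c' \<and> s \<circ> al = al \<circ> t then 1 else 0)"
  proof (rule invariant_moment_limit[OF _ _ s t c c'])
    fix d :: nat and J J' assume d: "d \<ge> 1" and J: "J \<in> tuples n {..<d}" "J' \<in> tuples n {..<d}"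
    interpret haar_unitary d g "haar d"
      by standard (rule haar[OF d])
    show "infinitesimally_invariant n g d (moment n J J')"
      by (rule moment_infinitesimally_invariant[OF J])
    fix c be assume "c \<in> tuples n {..<g}" "be permutes {..<n}"
    then show "(\<Sum>i\<in>tuples n {..<d}. moment n J J' (ctup n c i) (ctup n c i \<circ> be)) = (if J \<circ> be = J' then 1 else 0)"
      by (rule moment_gram[OF J])
  qed
  show ?thesis
  proof (rule Lim_transform_eventually[OF L])
    show "eventually (\<lambda>d. (\<Sum>i\<in>tuples n {..<d}. \<Sum>i'\<in>tuples n {..<d}.
        haar_unitary.moment g (haar d) n (i \<circ> s) (i' \<circ> t) (ctup n c i) (ctup n c' i'))
      = (LINT U|haar_power g (haar d). word_trace d n s c U * cnj (word_trace d n t c' U))) sequentially"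
      using eventually_ge_at_top[of 1]
    proof eventually_elim
      case (elim d)
      interpret haar_unitary d g "haar d"
        by standard (rule haar[OF elim])
      show ?case
        by (rule word_trace_moment[OF s t c c', symmetric])
    qed
  qed
qed

subsection \<open>Quadratic forms and row contractions\<close>

lemma sum_div_mod:
  fixes h :: "nat \<Rightarrow> 'a :: comm_monoid_add"
  shows "(\<Sum>l<m * n. h l) = (\<Sum>c<m. \<Sum>f<n. h (c * n + f))"
proof -
  have "sum h {c * n..<c * n + n} = (\<Sum>f<n. h (c * n + f))" for c
    using sum.shift_bounds_nat_ivl[of h 0 "c * n" n] by (simp add: atLeast0LessThan add.commute)
  then show ?thesis
    by (simp only: sum.nat_group[symmetric])
qed

lemma div_mod_bound: "(c :: nat) < m \<Longrightarrow> f < n \<Longrightarrow> c * n + f < m * n"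
  using mult_le_mono1[of "Suc c" m n] by simp

lemma kron_index:
  assumes "A \<in> carrier_mat m m" "B \<in> carrier_mat n n" "a < m" "b < m" "i < n" "l < n"
  shows "(A \<otimes>\<^sub>K B) $$ (a * n + i, b * n + l) = A $$ (a, b) * B $$ (i, l)"
  using assms div_mod_bound by (simp add: kron_def)

lemma mat_sum_carrier: "mat_sum n g F \<in> carrier_mat n n"
  by (simp add: mat_sum_def)

lemma mat_sum_index: "i < n \<Longrightarrow> l < n \<Longrightarrow> mat_sum n g F $$ (i, l) = (\<Sum>j<g. F j $$ (i, l))"
  by (simp add: mat_sum_def)

lemma conj_mat_carrier: "A \<in> carrier_mat n n \<Longrightarrow> conj_mat A \<in> carrier_mat n n"
  by (simp add: conj_mat_def)

lemma conj_mat_index: "A \<in> carrier_mat n n \<Longrightarrow> i < n \<Longrightarrow> l < n \<Longrightarrow> conj_mat A $$ (i, l) = cnj (A $$ (i, l))"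
  by (simp add: conj_mat_def)

text \<open>\<open>A\<close> is enlarged by a factor \<open>c > 1\<close> that still keeps the
  spectral radius below 1. The powers of the enlarged matrix are bounded, so those of
  \<open>A\<close> decay like \<open>inverse c ^ N\<close>.\<close>

lemma mat_pow_entries_null:
  fixes A :: "complex mat"
  assumes A: "A \<in> carrier_mat n n" and sr: "spectral_radius A < 1" and ij: "i < n" "l < n"
  shows "(\<lambda>N. (A ^\<^sub>m N) $$ (i, l)) \<longlonglongrightarrow> 0"
proof -
  have n: "n > 0"
    using ij by simp
  have sr0: "0 \<le> spectral_radius A"
    using spectral_radius_mem_max(1)[OF A n] by auto
  define c where "c = 2 / (1 + spectral_radius A)"
  have c: "c > 1" "c * spectral_radius A < 1"
    using sr sr0 by (auto simp: c_def field_simps)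
  define B where "B = of_real c \<cdot>\<^sub>m A"
  have B: "B \<in> carrier_mat n n"
    using A by (simp add: B_def)
  obtain e where e: "e \<in> spectrum B" "spectral_radius B = norm e"
    using spectral_radius_mem_max(1)[OF B n] by auto
  then obtain v where v: "v \<in> carrier_vec n" "v \<noteq> 0\<^sub>v n" "B *\<^sub>v v = e \<cdot>\<^sub>v v"
    using B by (auto simp: spectrum_def eigenvalue_def eigenvector_def)
  have "of_real c \<cdot>\<^sub>v (A *\<^sub>v v) = e \<cdot>\<^sub>v v"
  proof -
    have "B *\<^sub>v v = of_real c \<cdot>\<^sub>v (A *\<^sub>v v)"
      unfolding B_def using v(1) A by (intro eq_vecI) (auto simp: scalar_prod_def sum_distrib_left mult.assoc)
    then show ?thesis
      using v(3) by (simp only:)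
  qed
  then have "inverse (of_real c) \<cdot>\<^sub>v (of_real c \<cdot>\<^sub>v (A *\<^sub>v v)) = inverse (of_real c) \<cdot>\<^sub>v (e \<cdot>\<^sub>v v)"
    by (rule arg_cong)
  then have "A *\<^sub>v v = (inverse (of_real c) * e) \<cdot>\<^sub>v v"
    using c by (simp add: smult_smult_assoc)
  then have "inverse (of_real c) * e \<in> spectrum A"
    using A v by (auto simp: spectrum_def eigenvalue_def eigenvector_def)
  then have "norm (inverse (of_real c) * e) \<le> spectral_radius A"
    by (intro spectral_radius_mem_max(2)[OF A n]) auto
  then have "norm e \<le> c * spectral_radius A"
    using c by (simp add: norm_mult norm_inverse norm_divide divide_simps mult.commute)
  then have "spectral_radius B < 1"
    using c e by simp
  then obtain C where C: "\<And>N. norm_bound (B ^\<^sub>m N) C"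
    using spectral_radius_jnf_norm_bound_less_1_upper_triangular[OF B] by blast
  have pow: "B ^\<^sub>m N = of_real c ^ N \<cdot>\<^sub>m (A ^\<^sub>m N)" for N
  proof (induction N)
    case (Suc N)
    have "B ^\<^sub>m Suc N = (of_real c ^ N \<cdot>\<^sub>m (A ^\<^sub>m N)) * (of_real c \<cdot>\<^sub>m A)"
      by (simp only: pow_mat.simps Suc) (simp only: B_def)
    also have "\<dots> = of_real c ^ N \<cdot>\<^sub>m (of_real c \<cdot>\<^sub>m (A ^\<^sub>m N * A))"
      using A by (subst mult_smult_assoc_mat[of _ n n _ n], simp, simp, subst mult_smult_distrib[of _ n n _ n]) auto
    also have "\<dots> = of_real c ^ Suc N \<cdot>\<^sub>m (A ^\<^sub>m Suc N)"
      by (rule eq_matI) auto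
    finally show ?case .
  qed (use A in \<open>auto simp: B_def\<close>)
  have bound: "norm ((A ^\<^sub>m N) $$ (i, l)) \<le> C * inverse c ^ N" for N
  proof -
    have AN: "A ^\<^sub>m N \<in> carrier_mat n n"
      using A by simp
    have "norm ((B ^\<^sub>m N) $$ (i, l)) \<le> C"
      using C[of N] B ij by (auto simp: norm_bound_def)
    then have "c ^ N * norm ((A ^\<^sub>m N) $$ (i, l)) \<le> C"
      using carrier_matD[OF AN] ij c by (simp add: pow norm_mult norm_power)
    then have "c ^ N * norm ((A ^\<^sub>m N) $$ (i, l)) * inverse c ^ N \<le> C * inverse c ^ N"
      using c by (intro mult_right_mono) auto
    moreover have "c ^ N * x * inverse c ^ N = x" for x
      using c by (simp add: power_inverse)
    ultimately show ?thesis
      by (simp only:)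
  qed
  have "(\<lambda>N. C * inverse c ^ N) \<longlonglongrightarrow> 0"
    using c by (intro tendsto_mult_right_zero LIMSEQ_power_zero) (simp add: divide_simps)
  then show ?thesis
    by (rule Lim_null_comparison[OF always_eventually, rule_format, OF bound])
qed

section \<open>Quadratic forms, Cholesky factors and the row norm\<close>

definition qform :: "nat \<Rightarrow> (nat \<Rightarrow> nat \<Rightarrow> complex) \<Rightarrow> (nat \<Rightarrow> complex) \<Rightarrow> complex" where
  "qform k A v = (\<Sum>a<k. \<Sum>b<k. cnj (v a) * A a b * v b)"

definition adjv :: "nat \<Rightarrow> (nat \<Rightarrow> nat \<Rightarrow> complex) \<Rightarrow> (nat \<Rightarrow> complex) \<Rightarrow> nat \<Rightarrow> complex" where
  "adjv k A v c = (\<Sum>a<k. cnj (A a c) * v a)"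

definition sqnorm :: "nat \<Rightarrow> (nat \<Rightarrow> complex) \<Rightarrow> real" where
  "sqnorm k v = (\<Sum>a<k. (norm (v a))\<^sup>2)"

text \<open>What makes the map \<open>Phi\<close> below tractable: the form of \<open>Phi B\<close>
  at \<open>v\<close> becomes a sum of values of the form of \<open>B\<close> at the vectors
  \<open>adjv k (x j) v\<close>.\<close>

lemma qform_adjv: "qform k A (adjv k X v)
    = qform k (\<lambda>a b. \<Sum>c<k. \<Sum>e<k. X a c * A c e * cnj (X b e)) v"
proof -
  have "qform k A (adjv k X v) = (\<Sum>c<k. \<Sum>e<k. (\<Sum>a<k. X a c * cnj (v a)) * A c e * (\<Sum>b<k. cnj (X b e) * v b))"
    by (simp add: qform_def adjv_def)
  also have "\<dots> = (\<Sum>c<k. \<Sum>e<k. \<Sum>a<k. \<Sum>b<k. cnj (v a) * (X a c * A c e * cnj (X b e)) * v b)"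
    by (intro sum.cong refl) (simp add: sum_distrib_left sum_distrib_right mult_ac)
  also have "\<dots> = (\<Sum>c<k. \<Sum>a<k. \<Sum>e<k. \<Sum>b<k. cnj (v a) * (X a c * A c e * cnj (X b e)) * v b)"
    by (intro sum.cong refl sum.swap)
  also have "\<dots> = (\<Sum>a<k. \<Sum>c<k. \<Sum>e<k. \<Sum>b<k. cnj (v a) * (X a c * A c e * cnj (X b e)) * v b)"
    by (rule sum.swap)
  also have "\<dots> = (\<Sum>a<k. \<Sum>c<k. \<Sum>b<k. \<Sum>e<k. cnj (v a) * (X a c * A c e * cnj (X b e)) * v b)"
    by (intro sum.cong refl sum.swap)
  also have "\<dots> = (\<Sum>a<k. \<Sum>b<k. \<Sum>c<k. \<Sum>e<k. cnj (v a) * (X a c * A c e * cnj (X b e)) * v b)"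
    by (intro sum.cong refl sum.swap)
  finally show ?thesis
    by (simp add: qform_def sum_distrib_left sum_distrib_right)
qed

lemma qform_sum: "qform k (\<lambda>a b. \<Sum>j\<in>J. A j a b) v = (\<Sum>j\<in>J. qform k (A j) v)"
proof -
  have "qform k (\<lambda>a b. \<Sum>j\<in>J. A j a b) v = (\<Sum>a<k. \<Sum>b<k. \<Sum>j\<in>J. cnj (v a) * A j a b * v b)"
    by (simp add: qform_def sum_distrib_left sum_distrib_right)
  also have "\<dots> = (\<Sum>a<k. \<Sum>j\<in>J. \<Sum>b<k. cnj (v a) * A j a b * v b)"
    by (intro sum.cong refl sum.swap)
  also have "\<dots> = (\<Sum>j\<in>J. qform k (A j) v)"
    unfolding qform_def by (rule sum.swap)
  finally show ?thesis .
qed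

lemma qform_delta: "qform k (\<lambda>a b. if a = b then 1 else 0) v = of_real (sqnorm k v)"
proof -
  have "qform k (\<lambda>a b. if a = b then 1 else 0) v = (\<Sum>a<k. \<Sum>b<k. if b = a then cnj (v a) * v a else 0)"
    unfolding qform_def by (intro sum.cong) auto
  also have "\<dots> = (\<Sum>a<k. v a * cnj (v a))"
    by (simp add: mult.commute)
  also have "\<dots> = of_real (sqnorm k v)"
    by (simp only: sqnorm_def of_real_sum complex_norm_square)
  finally show ?thesis .
qed

lemma qform_gram:
  assumes "\<And>a b. a < k \<Longrightarrow> b < k \<Longrightarrow> A a b = (\<Sum>c<k. S a c * cnj (S b c))"
  shows "qform k A v = of_real (sqnorm k (adjv k S v))"
proof -
  have "of_real (sqnorm k (adjv k S v)) = qform k (\<lambda>a b. if a = b then 1 else 0) (adjv k S v)"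
    by (rule qform_delta[symmetric])
  also have "\<dots> = qform k (\<lambda>a b. \<Sum>c<k. \<Sum>e<k. S a c * (if c = e then 1 else 0) * cnj (S b e)) v"
    by (rule qform_adjv)
  also have "\<dots> = qform k A v"
    unfolding qform_def
    by (intro sum.cong refl) (simp add: assms if_distrib[of "(*) _"] if_distrib[of "\<lambda>x. x * _"] cong: if_cong)
  finally show ?thesis ..
qed

lemma sqnorm_nonneg: "0 \<le> sqnorm k v"
  unfolding sqnorm_def by (intro sum_nonneg) auto

lemma norm_qform_le:
  assumes "\<And>a b. a < k \<Longrightarrow> b < k \<Longrightarrow> norm (A a b) \<le> h" "0 \<le> h"
  shows "norm (qform k A v) \<le> h * k * sqnorm k v"
proof -
  have "norm (qform k A v) \<le> (\<Sum>a<k. \<Sum>b<k. h * (((norm (v a))\<^sup>2 + (norm (v b))\<^sup>2) / 2))"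
    unfolding qform_def
  proof (intro order_trans[OF norm_sum] sum_mono)
    fix a b assume ab: "a \<in> {..<k}" "b \<in> {..<k}"
    have "norm (v a) * norm (v b) \<le> ((norm (v a))\<^sup>2 + (norm (v b))\<^sup>2) / 2"
      using sum_squares_bound[of "norm (v a)" "norm (v b)"] by simp
    moreover have "norm (A a b) \<le> h"
      using assms ab by simp
    ultimately have "norm (A a b) * (norm (v a) * norm (v b)) \<le> h * (((norm (v a))\<^sup>2 + (norm (v b))\<^sup>2) / 2)"
      using assms(2) by (intro mult_mono) auto
    then show "norm (cnj (v a) * A a b * v b) \<le> h * (((norm (v a))\<^sup>2 + (norm (v b))\<^sup>2) / 2)"
      by (simp only: norm_mult complex_mod_cnj mult_ac)
  qed
  also have "\<dots> = h * k * sqnorm k v"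
    by (simp add: sqnorm_def sum_distrib_left[symmetric] sum_divide_distrib[symmetric] sum.distrib)
  finally show ?thesis .
qed

text \<open>The last index is eliminated: the Schur complement of \<open>A n n\<close> is again
  positive definite, and \<open>S\<close> gains the last column \<open>A a n / r\<close>, where
  \<open>r\<close> is the square root of \<open>A n n\<close>. Eliminating the last index leaves the
  other indices as they are and makes \<open>S\<close> upper triangular.\<close>

lemma cholesky:
  assumes herm: "\<And>a b. a < n \<Longrightarrow> b < n \<Longrightarrow> cnj (A a b) = A b a"
    and pos: "\<And>v. \<exists>a<n. v a \<noteq> 0 \<Longrightarrow> 0 < Re (qform n A v)"
  shows "\<exists>S. (\<forall>a<n. \<forall>b<n. A a b = (\<Sum>c<n. S a c * cnj (S b c))) \<and>
    (\<forall>a<n. \<forall>c<a. S a c = 0) \<and> (\<forall>a<n. S a a \<noteq> 0)"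
  using assms
proof (induction n arbitrary: A)
  case (Suc n)
  define al where "al = A n n"
  have "qform (Suc n) A (\<lambda>a. if a = n then 1 else 0) = al"
    by (simp add: qform_def al_def if_distrib[of cnj] if_distrib[of "(*) _"] if_distrib[of "\<lambda>x. x * _"] cong: if_cong)
  then have al_pos: "0 < Re al"
    using Suc.prems(2)[of "\<lambda>a. if a = n then 1 else 0"] by auto
  have cal: "cnj al = al"
    using Suc.prems(1)[of n n] by (simp add: al_def)
  then have al_real: "al = of_real (Re al)"
    by (simp add: complex_eq_iff)
  have al0: "al \<noteq> 0"
    using al_pos by auto
  define B where "B a b = A a b - A a n * A n b / al" for a b
  have hermA: "cnj (A a b) = A b a" if "a \<le> n" "b \<le> n" for a b
    using Suc.prems(1) that by simp
  have "\<exists>S. (\<forall>a<n. \<forall>b<n. B a b = (\<Sum>c<n. S a c * cnj (S b c))) \<and>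
    (\<forall>a<n. \<forall>c<a. S a c = 0) \<and> (\<forall>a<n. S a a \<noteq> 0)"
  proof (rule Suc.IH)
    fix a b assume "a < n" "b < n"
    then show "cnj (B a b) = B b a"
      by (simp add: B_def hermA cal mult.commute)
  next
    fix v :: "nat \<Rightarrow> complex" assume v: "\<exists>a<n. v a \<noteq> 0"
    define s where "s = (\<Sum>b<n. A n b * v b)"
    \<comment> \<open>The last entry completes the square, so that the form of \<open>A\<close> at
      \<open>w\<close> equals the form of the Schur complement at \<open>v\<close>.\<close>
    define w where "w a = (if a = n then - s / al else v a)" for a
    have cs: "(\<Sum>a<n. cnj (v a) * A a n) = cnj s"
      unfolding s_def cnj_sum complex_cnj_mult by (intro sum.cong refl) (simp add: hermA)
    have wv: "w a = v a" if "a < n" for a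
      using that by (simp add: w_def)
    have wn: "w n = - s / al"
      by (simp add: w_def)
    have h1: "(\<Sum>a<n. cnj (v a) * A a n * w n) = cnj s * w n"
      by (simp only: sum_distrib_right[symmetric] cs)
    have h2: "(\<Sum>b<n. cnj (w n) * A n b * v b) = cnj (w n) * s"
      by (simp only: s_def sum_distrib_left mult.assoc)
    have "qform (Suc n) A w = (\<Sum>a<n. (\<Sum>b<n. cnj (v a) * A a b * v b) + cnj (v a) * A a n * w n)
        + ((\<Sum>b<n. cnj (w n) * A n b * v b) + cnj (w n) * al * w n)"
      by (simp add: qform_def wv al_def)
    also have "\<dots> = qform n A v + cnj s * w n + (cnj (w n) * s + cnj (w n) * al * w n)"
      by (simp only: sum.distrib h1 h2 qform_def)
    also have "\<dots> = qform n A v - cnj s * s / al"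
    proof -
      have 1: "cnj (w n) * al = - cnj s" "cnj (w n) * s = - (cnj s * s / al)"
        using al0 by (simp_all add: wn cal)
      show ?thesis
        unfolding 1 by simp
    qed
    also have "\<dots> = qform n B v"
    proof -
      have "qform n B v = qform n A v - (\<Sum>a<n. \<Sum>b<n. (cnj (v a) * A a n) * (A n b * v b) / al)"
        unfolding qform_def B_def sum_subtractf[symmetric] by (intro sum.cong refl) (simp add: algebra_simps)
      also have "(\<Sum>a<n. \<Sum>b<n. (cnj (v a) * A a n) * (A n b * v b) / al) = cnj s * s / al"
      proof -
        have "cnj s * s / al = (\<Sum>a<n. cnj (v a) * A a n) * (\<Sum>b<n. A n b * v b) / al"
          by (simp only: cs s_def[symmetric])
        then show ?thesis
          by (simp only: sum_product sum_divide_distrib)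
      qed
      finally show ?thesis ..
    qed
    finally have "qform n B v = qform (Suc n) A w" ..
    moreover have "\<exists>a<Suc n. w a \<noteq> 0"
    proof -
      obtain a where "a < n" "v a \<noteq> 0"
        using v by blast
      then show ?thesis
        using wv by (intro exI[of _ a]) simp
    qed
    ultimately show "0 < Re (qform n B v)"
      using Suc.prems(2) by simp
  qed
  then obtain S where S0: "(\<forall>a<n. \<forall>b<n. B a b = (\<Sum>c<n. S a c * cnj (S b c))) \<and>
    (\<forall>a<n. \<forall>c<a. S a c = 0) \<and> (\<forall>a<n. S a a \<noteq> 0)" ..
  have S: "a < n \<Longrightarrow> b < n \<Longrightarrow> B a b = (\<Sum>c<n. S a c * cnj (S b c))"
    "a < n \<Longrightarrow> c < a \<Longrightarrow> S a c = 0" "a < n \<Longrightarrow> S a a \<noteq> 0" for a b c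
    using S0 by simp_all
  define r where "r = complex_of_real (sqrt (Re al))"
  have rr2: "cnj r = r" "r \<noteq> 0"
    using al_pos by (auto simp: r_def)
  have "r * cnj r = of_real (Re al)"
    using al_pos by (simp add: r_def of_real_mult[symmetric] del: of_real_mult)
  then have rr1: "r * cnj r = al"
    by (rule trans[OF _ al_real[symmetric]])
  define S' where "S' a c = (if c < n then (if a < n then S a c else 0) else A a n / r)" for a c
  have "A a b = (\<Sum>c<Suc n. S' a c * cnj (S' b c))" if ab: "a < Suc n" "b < Suc n" for a b
  proof -
    have cAb: "cnj (A b n) = A n b"
      using ab by (intro hermA) auto
    have last: "A a n / r * cnj (A b n / r) = A a n * A n b / al"
      using rr1 by (simp add: cAb)
    have "(\<Sum>c<Suc n. S' a c * cnj (S' b c)) = (\<Sum>c<n. S' a c * cnj (S' b c)) + A a n * A n b / al"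
      using last by (simp add: S'_def)
    also have "(\<Sum>c<n. S' a c * cnj (S' b c)) = (if a < n \<and> b < n then B a b else 0)"
    proof (cases "a < n \<and> b < n")
      case True
      have "(\<Sum>c<n. S' a c * cnj (S' b c)) = (\<Sum>c<n. S a c * cnj (S b c))"
        using True by (intro sum.cong refl) (simp add: S'_def)
      then show ?thesis
        using True S(1)[of a b] by simp
    next
      case False
      then show ?thesis
        by (intro trans[OF sum.neutral]) (auto simp: S'_def)
    qed
    also have "(if a < n \<and> b < n then B a b else 0) + A a n * A n b / al = A a b"
    proof (cases "a < n \<and> b < n")
      case True
      then show ?thesis
        by (simp add: B_def)
    next
      case False
      then have "a = n \<or> b = n"
        using ab by linarith
      then have "A a n * A n b = A a b * al"
        by (auto simp: al_def)
      then show ?thesis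
        unfolding if_not_P[OF False] using al0 by simp
    qed
    finally show ?thesis ..
  qed
  moreover have "S' a c = 0" if "a < Suc n" "c < a" for a c
  proof -
    have "c < n"
      using that by linarith
    then show ?thesis
      using that S(2)[of a c] by (simp add: S'_def)
  qed
  moreover have "S' a a \<noteq> 0" if "a < Suc n" for a
  proof (cases "a = n")
    case True
    then show ?thesis
      using rr2(2) al0 by (simp add: S'_def al_def)
  next
    case False
    then show ?thesis
      using that S(3)[of a] by (simp add: S'_def)
  qed
  ultimately show ?case
    by blast
qed simp

lemma qform_cong: "(\<And>a b. a < k \<Longrightarrow> b < k \<Longrightarrow> A a b = B a b) \<Longrightarrow> qform k A v = qform k B v"
  unfolding qform_def by (intro sum.cong refl) auto

lemma sqnorm_cong: "(\<And>a. a < k \<Longrightarrow> v a = w a) \<Longrightarrow> sqnorm k v = sqnorm k w"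
  unfolding sqnorm_def by (intro sum.cong refl) auto

text \<open>The Frobenius bound for the adjoint. The added 1 makes the constant positive, so that
  one can divide by it.\<close>

lemma sqnorm_adjv_le: "sqnorm k (adjv k S w) \<le> (1 + (\<Sum>c<k. \<Sum>a<k. (norm (S a c))\<^sup>2)) * sqnorm k w"
proof -
  have "(norm (adjv k S w c))\<^sup>2 \<le> (\<Sum>a<k. (norm (S a c))\<^sup>2) * sqnorm k w" for c
  proof -
    have "norm (adjv k S w c) \<le> (\<Sum>a<k. norm (S a c) * norm (w a))"
      unfolding adjv_def by (rule order_trans[OF norm_sum]) (simp add: norm_mult)
    then have "(norm (adjv k S w c))\<^sup>2 \<le> (\<Sum>a<k. norm (S a c) * norm (w a))\<^sup>2"
      by (intro power_mono) auto
    also have "\<dots> \<le> (\<Sum>a<k. (norm (S a c))\<^sup>2) * (\<Sum>a<k. (norm (w a))\<^sup>2)"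
      by (rule Cauchy_Schwarz_ineq_sum)
    finally show ?thesis
      by (simp only: sqnorm_def)
  qed
  then have "sqnorm k (adjv k S w) \<le> (\<Sum>c<k. (\<Sum>a<k. (norm (S a c))\<^sup>2) * sqnorm k w)"
    unfolding sqnorm_def[of k "adjv k S w"] by (intro sum_mono)
  also have "\<dots> \<le> (1 + (\<Sum>c<k. \<Sum>a<k. (norm (S a c))\<^sup>2)) * sqnorm k w"
    unfolding sum_distrib_right[symmetric] by (intro mult_right_mono sqnorm_nonneg) auto
  finally show ?thesis .
qed

lemma adjv_comp:
  "adjv k (\<lambda>a b. \<Sum>c<k. X a c * Y c b) v = adjv k Y (adjv k X v)"
proof
  fix b
  have "adjv k (\<lambda>a b. \<Sum>c<k. X a c * Y c b) v b = (\<Sum>a<k. \<Sum>c<k. cnj (Y c b) * (cnj (X a c) * v a))"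
    unfolding adjv_def cnj_sum sum_distrib_right by (intro sum.cong refl) simp
  also have "\<dots> = (\<Sum>c<k. \<Sum>a<k. cnj (Y c b) * (cnj (X a c) * v a))"
    by (rule sum.swap)
  finally show "adjv k (\<lambda>a b. \<Sum>c<k. X a c * Y c b) v b = adjv k Y (adjv k X v) b"
    by (simp add: adjv_def sum_distrib_left)
qed

text \<open>The operator norm of \<open>\<Sum> Z\<^sub>j Z\<^sub>j\<^sup>*\<close> is bounded through \<open>\<Sum> \<parallel>Z\<^sub>j\<^sup>* v\<parallel>\<^sup>2\<close> by Cauchy-Schwarz.\<close>

lemma row_norm_le:
  assumes Z: "mat_tuple g k Z" and t: "0 \<le> t"
    and bound: "\<And>v. (\<Sum>j<g. sqnorm k (adjv k (\<lambda>a b. Z j $$ (a, b)) v)) \<le> t\<^sup>2 * sqnorm k v"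
  shows "row_norm g k Z \<le> t"
proof -
  have ZC: "Z j \<in> carrier_mat k k" if "j < g" for j
    using Z that by (simp add: mat_tuple_def)
  let ?R = "mat_sum k g (\<lambda>j. Z j * mat_adjoint (Z j))"
  have R: "?R \<in> carrier_mat k k"
    by (rule mat_sum_carrier)
  define z where "z j a b = Z j $$ (a, b)" for j a b
  have main: "l2_norm_vec (?R *\<^sub>v v) \<le> t\<^sup>2 * l2_norm_vec v" if v: "v \<in> carrier_vec k" for v
  proof -
    define f where "f a = vec_index v a" for a
    define u where "u a = (\<Sum>j<g. \<Sum>c<k. z j a c * adjv k (z j) f c)" for a
    have ent: "vec_index (?R *\<^sub>v v) a = u a" if a: "a < k" for a
    proof -
      have "vec_index (?R *\<^sub>v v) a = (\<Sum>b<k. ?R $$ (a, b) * f b)"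
        using R v a by (auto simp: scalar_prod_def atLeast0LessThan f_def intro!: sum.cong)
      also have "\<dots> = (\<Sum>b<k. \<Sum>j<g. \<Sum>c<k. z j a c * (cnj (z j b c) * f b))"
      proof (intro sum.cong refl)
        fix b assume "b \<in> {..<k}"
        then have b: "b < k" by simp
        have "?R $$ (a, b) = (\<Sum>j<g. \<Sum>c<k. z j a c * cnj (z j b c))"
          unfolding mat_sum_index[OF a b]
        proof (intro sum.cong refl)
          fix j assume "j \<in> {..<g}"
          then have C: "Z j \<in> carrier_mat k k"
            using ZC by simp
          show "(Z j * mat_adjoint (Z j)) $$ (a, b) = (\<Sum>c<k. z j a c * cnj (z j b c))"
            unfolding index_mult_mat_sum[OF C mat_adjoint_carrier[OF C] a b]
            by (intro sum.cong refl) (simp add: mat_adjoint_index[OF C _ b] z_def)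
        qed
        then show "?R $$ (a, b) * f b = (\<Sum>j<g. \<Sum>c<k. z j a c * (cnj (z j b c) * f b))"
          by (simp only: sum_distrib_right mult.assoc)
      qed
      also have "\<dots> = (\<Sum>j<g. \<Sum>b<k. \<Sum>c<k. z j a c * (cnj (z j b c) * f b))"
        by (rule sum.swap)
      also have "\<dots> = (\<Sum>j<g. \<Sum>c<k. \<Sum>b<k. z j a c * (cnj (z j b c) * f b))"
        by (intro sum.cong refl sum.swap)
      finally show ?thesis
        by (simp add: u_def adjv_def sum_distrib_left)
    qed
    have l2v: "l2_norm_vec v = sqrt (sqnorm k f)"
      using v by (simp add: l2_norm_vec_def L2_set_def sqnorm_def f_def)
    have l2u: "l2_norm_vec (?R *\<^sub>v v) = sqrt (sqnorm k u)"
      using carrier_matD[OF R] by (simp add: l2_norm_vec_def L2_set_def sqnorm_def ent del: index_mult_mat_vec)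
    \<comment> \<open>Pairing \<open>u\<close> with itself and moving each \<open>z j\<close> across
      gives the inner product of the families \<open>adjv k (z j) u\<close> and
      \<open>adjv k (z j) f\<close>. The assumed bound applies to both, and one factor
      \<open>sqrt (sqnorm k u)\<close> cancels in the end.\<close>
    have "complex_of_real (sqnorm k u) = (\<Sum>a<k. cnj (u a) * u a)"
      by (simp only: sqnorm_def of_real_sum complex_norm_square mult.commute)
    also have "\<dots> = (\<Sum>a<k. \<Sum>j<g. \<Sum>c<k. cnj (u a) * (z j a c * adjv k (z j) f c))"
      by (subst (2) u_def) (simp only: sum_distrib_left)
    also have "\<dots> = (\<Sum>j<g. \<Sum>a<k. \<Sum>c<k. cnj (u a) * (z j a c * adjv k (z j) f c))"
      by (rule sum.swap)
    also have "\<dots> = (\<Sum>j<g. \<Sum>c<k. \<Sum>a<k. cnj (u a) * (z j a c * adjv k (z j) f c))"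
      by (intro sum.cong refl sum.swap)
    also have "\<dots> = (\<Sum>j<g. \<Sum>c<k. cnj (adjv k (z j) u c) * adjv k (z j) f c)"
      by (intro sum.cong refl) (simp add: adjv_def[of k _ u] sum_distrib_right sum_distrib_left mult_ac)
    also have "\<dots> = (\<Sum>(j, c)\<in>{..<g} \<times> {..<k}. cnj (adjv k (z j) u c) * adjv k (z j) f c)"
      by (rule sum.cartesian_product)
    finally have "complex_of_real (sqnorm k u) = (\<Sum>(j, c)\<in>{..<g} \<times> {..<k}. cnj (adjv k (z j) u c) * adjv k (z j) f c)" .
    then have "norm (complex_of_real (sqnorm k u)) \<le> (\<Sum>x\<in>{..<g} \<times> {..<k}. \<bar>norm (adjv k (z (fst x)) u (snd x))\<bar> * \<bar>norm (adjv k (z (fst x)) f (snd x))\<bar>)"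
      by (simp only:) (rule order_trans[OF norm_sum], simp add: norm_mult case_prod_beta)
    also have "\<dots> \<le> L2_set (\<lambda>x. norm (adjv k (z (fst x)) u (snd x))) ({..<g} \<times> {..<k})
        * L2_set (\<lambda>x. norm (adjv k (z (fst x)) f (snd x))) ({..<g} \<times> {..<k})"
      by (rule L2_set_mult_ineq)
    also have "\<dots> \<le> (t * sqrt (sqnorm k u)) * (t * sqrt (sqnorm k f))"
    proof -
      have L2: "L2_set (\<lambda>x. norm (adjv k (z (fst x)) h (snd x))) ({..<g} \<times> {..<k}) \<le> t * sqrt (sqnorm k h)" for h
      proof -
        have "(\<Sum>x\<in>{..<g} \<times> {..<k}. (norm (adjv k (z (fst x)) h (snd x)))\<^sup>2) = (\<Sum>j<g. sqnorm k (adjv k (z j) h))"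
          by (simp add: sqnorm_def sum.cartesian_product case_prod_beta)
        also have "\<dots> \<le> t\<^sup>2 * sqnorm k h"
          using bound[of h] by (simp only: z_def[abs_def])
        finally have "sqrt (\<Sum>x\<in>{..<g} \<times> {..<k}. (norm (adjv k (z (fst x)) h (snd x)))\<^sup>2) \<le> sqrt (t\<^sup>2 * sqnorm k h)"
          by (rule real_sqrt_le_mono)
        then show ?thesis
          using t by (simp add: L2_set_def real_sqrt_mult)
      qed
      show ?thesis
        using t by (intro mult_mono L2) (auto simp: sqnorm_nonneg L2_set_nonneg)
    qed
    finally have le: "sqnorm k u \<le> (t * sqrt (sqnorm k u)) * (t * sqrt (sqnorm k f))"
      by (simp add: sqnorm_nonneg)
    show ?thesis
    proof (cases "sqnorm k u = 0")
      case True
      then show ?thesis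
        by (simp add: l2u l2v sqnorm_nonneg)
    next
      case False
      then have pos: "0 < sqrt (sqnorm k u)"
        using sqnorm_nonneg[of k u] by simp
      have "sqrt (sqnorm k u) * sqrt (sqnorm k u) \<le> sqrt (sqnorm k u) * (t\<^sup>2 * sqrt (sqnorm k f))"
        using le sqnorm_nonneg[of k u] by (simp add: power2_eq_square mult_ac)
      then have "sqrt (sqnorm k u) \<le> t\<^sup>2 * sqrt (sqnorm k f)"
        by (rule mult_left_le_imp_le[OF _ pos])
      then show ?thesis
        by (simp only: l2u l2v)
    qed
  qed
  have "op_norm_mat ?R \<le> t\<^sup>2"
    unfolding op_norm_mat_def
  proof (rule cSUP_least)
    have "0\<^sub>v k \<in> {v \<in> carrier_vec (dim_col ?R). l2_norm_vec v \<le> 1}"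
      using R by (simp add: l2_norm_vec_def L2_set_def)
    then show "{v \<in> carrier_vec (dim_col ?R). l2_norm_vec v \<le> 1} \<noteq> {}"
      by blast
    fix v assume v: "v \<in> {v \<in> carrier_vec (dim_col ?R). l2_norm_vec v \<le> 1}"
    then have "l2_norm_vec (?R *\<^sub>v v) \<le> t\<^sup>2 * l2_norm_vec v"
      using R by (intro main) simp
    also have "\<dots> \<le> t\<^sup>2 * 1"
      using v by (intro mult_left_mono) auto
    finally show "l2_norm_vec (?R *\<^sub>v v) \<le> t\<^sup>2"
      by simp
  qed
  then have "sqrt (op_norm_mat ?R) \<le> sqrt (t\<^sup>2)"
    by (rule real_sqrt_le_mono)
  then show ?thesis
    using t by (simp add: row_norm_def)
qed

text \<open>If \<open>P = S S^*\<close>, the form of \<open>P\<close> at \<open>v\<close> is the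
  squared length of the adjoint of \<open>S\<close> applied to \<open>v\<close>. In these
  coordinates the decrease of the form under \<open>Phi\<close> is a bound by \<open>th < 1\<close>
  for the conjugated tuple. All dilations \<open>t\<close> are covered because a slight dilation is
  still to be applied.\<close>

lemma similar_row_contraction:
  assumes X: "mat_tuple g k X" and k: "k \<ge> 1" and rad: "tuple_rad g k X < 1"
  obtains P Q r where "P \<in> carrier_mat k k" "Q \<in> carrier_mat k k" "Q * P = 1\<^sub>m k" "0 \<le> r" "r < 1"
    "\<And>t. 0 \<le> t \<Longrightarrow> row_norm g k (\<lambda>j. of_real t \<cdot>\<^sub>m (Q * X j * P)) \<le> t * r"
proof -
  have XC: "X j \<in> carrier_mat k k" if "j < g" for j
    using X that by (simp add: mat_tuple_def)
  define x where "x j a b = X j $$ (a, b)" for j a b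
  \<comment> \<open>The matrix of \<open>Phi\<close> on \<open>k \<times> k\<close> matrices written
    as vectors, with entry \<open>(a, b)\<close> at place \<open>a * k + b\<close>.\<close>
  define M where "M = mat_sum (k * k) g (\<lambda>j. X j \<otimes>\<^sub>K conj_mat (X j))"
  have M: "M \<in> carrier_mat (k * k) (k * k)"
    unfolding M_def by (rule mat_sum_carrier)
  have srM: "spectral_radius M < 1"
    using rad by (simp add: tuple_rad_def M_def)
  have Ment: "M $$ (a * k + b, c * k + e) = (\<Sum>j<g. x j a c * cnj (x j b e))"
    if "a < k" "b < k" "c < k" "e < k" for a b c e
    unfolding M_def mat_sum_index[OF div_mod_bound[OF that(1,2)] div_mod_bound[OF that(3,4)]]
  proof (intro sum.cong refl)
    fix j assume "j \<in> {..<g}"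
    then have C: "X j \<in> carrier_mat k k"
      using XC by simp
    show "(X j \<otimes>\<^sub>K conj_mat (X j)) $$ (a * k + b, c * k + e) = x j a c * cnj (x j b e)"
      using that by (simp add: kron_index[OF C conj_mat_carrier[OF C]] conj_mat_index[OF C] x_def)
  qed
  \<comment> \<open>The identity matrix, written as a vector, has its ones at the places
    \<open>e * k + e\<close>. Summing these columns of the power therefore gives the
    \<open>n\<close>-th iterate of \<open>Phi\<close> at the identity.\<close>
  define A where "A n a b = (\<Sum>e<k. (M ^\<^sub>m n) $$ (a * k + b, e * k + e))" for n a b
  define Phi where "Phi B a b = (\<Sum>j<g. \<Sum>c<k. \<Sum>e<k. x j a c * B c e * cnj (x j b e))" for B a b
  have MM: "M ^\<^sub>m Suc n = M * M ^\<^sub>m n" for n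
  proof (induction n)
    case (Suc n)
    have "M ^\<^sub>m Suc (Suc n) = M * M ^\<^sub>m n * M"
      using Suc by simp
    also have "\<dots> = M * (M ^\<^sub>m n * M)"
      by (rule assoc_mult_mat[OF M pow_carrier_mat[OF M] M])
    finally show ?case
      by simp
  qed (use M in simp)
  have A0: "A 0 a b = (if a = b then 1 else 0)" if ab: "a < k" "b < k" for a b
  proof -
    have eq: "a * k + b = e * k + e \<longleftrightarrow> a = e \<and> b = e" if "e < k" for e
    proof
      assume h: "a * k + b = e * k + e"
      have "(a * k + b) div k = a" "(a * k + b) mod k = b" "(e * k + e) div k = e" "(e * k + e) mod k = e"
        using ab that by simp_all
      then show "a = e \<and> b = e"
        using h by metis
    qed simp
    have "A 0 a b = (\<Sum>e<k. if e = a then (if a = b then 1 else 0) else 0)"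
      unfolding A_def
    proof (rule sum.cong[OF refl])
      fix e assume "e \<in> {..<k}"
      then have e: "e < k" by simp
      have "(M ^\<^sub>m 0) $$ (a * k + b, e * k + e) = (if a * k + b = e * k + e then 1 else 0)"
        using carrier_matD[OF M] div_mod_bound[OF ab] div_mod_bound[OF e e] by simp
      also have "\<dots> = (if e = a then (if a = b then 1 else 0) else 0)"
        unfolding eq[OF e] by auto
      finally show "(M ^\<^sub>m 0) $$ (a * k + b, e * k + e) = (if e = a then (if a = b then 1 else 0) else 0)" .
    qed
    then show ?thesis
      using ab by simp
  qed
  have AS: "A (Suc n) a b = Phi (A n) a b" if ab: "a < k" "b < k" for n a b
  proof -
    have "A (Suc n) a b = (\<Sum>e<k. \<Sum>l<k * k. M $$ (a * k + b, l) * (M ^\<^sub>m n) $$ (l, e * k + e))"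
      unfolding A_def MM
      by (intro sum.cong refl index_mult_mat_sum[OF M pow_carrier_mat[OF M] div_mod_bound[OF ab] div_mod_bound]) auto
    also have "\<dots> = (\<Sum>l<k * k. \<Sum>e<k. M $$ (a * k + b, l) * (M ^\<^sub>m n) $$ (l, e * k + e))"
      by (rule sum.swap)
    also have "\<dots> = (\<Sum>c<k. \<Sum>f<k. M $$ (a * k + b, c * k + f) * A n c f)"
      unfolding sum_div_mod A_def sum_distrib_left ..
    also have "\<dots> = (\<Sum>c<k. \<Sum>f<k. \<Sum>j<g. x j a c * A n c f * cnj (x j b f))"
      by (intro sum.cong refl) (simp add: Ment ab sum_distrib_right sum_distrib_left mult_ac)
    also have "\<dots> = (\<Sum>c<k. \<Sum>j<g. \<Sum>f<k. x j a c * A n c f * cnj (x j b f))"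
      by (intro sum.cong refl sum.swap)
    also have "\<dots> = Phi (A n) a b"
      unfolding Phi_def by (rule sum.swap)
    finally show ?thesis .
  qed
  have Alim: "(\<lambda>n. A n a b) \<longlonglongrightarrow> 0" if ab: "a < k" "b < k" for a b
    unfolding A_def
    by (intro tendsto_null_sum mat_pow_entries_null[OF M srM div_mod_bound[OF ab] div_mod_bound]) auto
  \<comment> \<open>A form in \<open>k\<close> variables with entries of modulus at most
    \<open>h\<close> is bounded by \<open>h * k\<close> times the squared length; this
    \<open>h\<close> makes the bound one half.\<close>
  define h where "h = 1 / (2 * real k)"
  have h: "0 < h" "h * k = 1 / 2"
    using k by (auto simp: h_def)
  have "eventually (\<lambda>n. \<forall>a\<in>{..<k}. \<forall>b\<in>{..<k}. norm (A n a b) < h) sequentially"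
    using Alim h(1) by (intro eventually_ball_finite ballI) (auto simp: tendsto_iff dist_norm)
  then obtain N where "\<And>n. n \<ge> N \<Longrightarrow> \<forall>a\<in>{..<k}. \<forall>b\<in>{..<k}. norm (A n a b) < h"
    by (auto simp: eventually_sequentially)
  then have N: "norm (A (Suc N) a b) \<le> h" if "a < k" "b < k" for a b
    using that by (metis lessThan_iff le_SucI order_refl less_imp_le)
  have herm: "cnj (A n a b) = A n b a" if "a < k" "b < k" for n a b
    using that
  proof (induction n arbitrary: a b)
    case (Suc n)
    have "cnj (Phi (A n) a b) = (\<Sum>j<g. \<Sum>c<k. \<Sum>e<k. x j b e * A n e c * cnj (x j a c))"
      unfolding Phi_def cnj_sum by (intro sum.cong refl) (simp add: Suc.IH mult_ac)
    also have "\<dots> = Phi (A n) b a"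
      unfolding Phi_def by (intro sum.cong refl sum.swap)
    finally show ?case
      using Suc.prems by (simp add: AS)
  qed (simp add: A0)
  have qPhi: "qform k (Phi B) v = (\<Sum>j<g. qform k B (adjv k (x j) v))" for B v
    unfolding Phi_def qform_sum qform_adjv ..
  have nonneg: "0 \<le> Re (qform k (A n) v)" for n v
  proof (induction n arbitrary: v)
    case 0
    have "qform k (A 0) v = of_real (sqnorm k v)"
      unfolding qform_delta[symmetric] by (rule qform_cong) (rule A0)
    then show ?case
      by (simp add: sqnorm_nonneg)
  next
    case (Suc n)
    have "qform k (A (Suc n)) v = (\<Sum>j<g. qform k (A n) (adjv k (x j) v))"
      unfolding qPhi[symmetric] by (rule qform_cong) (rule AS)
    then show ?case
      using Suc by (simp add: sum_nonneg)
  qed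
  define P where "P a b = (\<Sum>n\<le>N. A n a b)" for a b
  have qA0: "qform k (A 0) v = of_real (sqnorm k v)" for v
    unfolding qform_delta[symmetric] by (rule qform_cong) (rule A0)
  have qP: "qform k P v = (\<Sum>n\<le>N. qform k (A n) v)" for v
    unfolding P_def[abs_def] by (rule qform_sum)
  have P_ge: "sqnorm k v \<le> Re (qform k P v)" for v
  proof -
    have "Re (qform k (A 0) v) \<le> (\<Sum>n\<le>N. Re (qform k (A n) v))"
      by (rule member_le_sum) (auto simp: nonneg)
    then show ?thesis
      by (simp add: qP qA0)
  qed
  \<comment> \<open>The partial sum telescopes: \<open>Phi P\<close> is \<open>P\<close> minus the
    identity plus \<open>A (Suc N)\<close>, and \<open>N\<close> was chosen so that the last term
    takes back at most half of the identity.\<close>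
  have PhiP: "Re (qform k (Phi P) v) \<le> Re (qform k P v) - sqnorm k v / 2" for v
  proof -
    have "qform k (Phi P) v = (\<Sum>j<g. \<Sum>n\<le>N. qform k (A n) (adjv k (x j) v))"
      by (simp add: qPhi qP)
    also have "\<dots> = (\<Sum>n\<le>N. \<Sum>j<g. qform k (A n) (adjv k (x j) v))"
      by (rule sum.swap)
    also have "\<dots> = (\<Sum>n\<le>N. qform k (A (Suc n)) v)"
      unfolding qPhi[symmetric] by (intro sum.cong refl qform_cong AS[symmetric])
    finally have "qform k (Phi P) v = (\<Sum>n\<le>N. qform k (A (Suc n)) v)" .
    moreover have "qform k (A 0) v + (\<Sum>n\<le>N. qform k (A (Suc n)) v) = (\<Sum>n\<le>Suc N. qform k (A n) v)"
      by (rule sum.atMost_Suc_shift[symmetric])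
    ultimately have eq: "of_real (sqnorm k v) + qform k (Phi P) v = qform k P v + qform k (A (Suc N)) v"
      by (simp add: qP qA0)
    have "norm (qform k (A (Suc N)) v) \<le> h * k * sqnorm k v"
      using N h(1) by (intro norm_qform_le) auto
    then have "Re (qform k (A (Suc N)) v) \<le> sqnorm k v / 2"
      using complex_Re_le_cmod[of "qform k (A (Suc N)) v"] by (simp add: h(2))
    moreover have "sqnorm k v + Re (qform k (Phi P) v) = Re (qform k P v) + Re (qform k (A (Suc N)) v)"
      using arg_cong[OF eq, of Re] by simp
    ultimately show ?thesis
      by linarith
  qed
  have "\<exists>S. (\<forall>a<k. \<forall>b<k. P a b = (\<Sum>c<k. S a c * cnj (S b c))) \<and>
    (\<forall>a<k. \<forall>c<a. S a c = 0) \<and> (\<forall>a<k. S a a \<noteq> 0)"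
  proof (rule cholesky)
    fix a b assume "a < k" "b < k"
    then show "cnj (P a b) = P b a"
      by (simp add: P_def herm)
  next
    fix v :: "nat \<Rightarrow> complex" assume "\<exists>a<k. v a \<noteq> 0"
    then obtain a where "a < k" "v a \<noteq> 0"
      by blast
    then have "0 < sqnorm k v"
      unfolding sqnorm_def by (intro sum_pos2[of _ a]) auto
    then show "0 < Re (qform k P v)"
      using P_ge[of v] by linarith
  qed
  then obtain S where S0: "(\<forall>a<k. \<forall>b<k. P a b = (\<Sum>c<k. S a c * cnj (S b c))) \<and>
    (\<forall>a<k. \<forall>c<a. S a c = 0) \<and> (\<forall>a<k. S a a \<noteq> 0)" ..
  have S: "a < k \<Longrightarrow> b < k \<Longrightarrow> P a b = (\<Sum>c<k. S a c * cnj (S b c))"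
    "a < k \<Longrightarrow> c < a \<Longrightarrow> S a c = 0" "a < k \<Longrightarrow> S a a \<noteq> 0" for a b c
    using S0 by simp_all
  define Sm where "Sm = Matrix.mat k k (\<lambda>(a, b). S a b)"
  have Sm: "Sm \<in> carrier_mat k k"
    by (simp add: Sm_def)
  have ut: "upper_triangular Sm"
    using S(2) by (auto simp: Sm_def upper_triangular_def)
  have det0: "Determinant.det Sm \<noteq> 0"
    using S(3) by (simp add: det_upper_triangular[OF ut Sm] prod_list_zero_iff diag_mat_def) (auto simp: Sm_def)
  define Q where "Q = inverse (Determinant.det Sm) \<cdot>\<^sub>m adj_mat Sm"
  have Q: "Q \<in> carrier_mat k k"
    using adj_mat(1)[OF Sm] by (simp add: Q_def)
  have QS: "Q * Sm = 1\<^sub>m k"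
    unfolding Q_def mult_smult_assoc_mat[OF adj_mat(1)[OF Sm] Sm] adj_mat(3)[OF Sm]
    using det0 by (intro eq_matI) auto
  define q where "q a b = Q $$ (a, b)" for a b
  have qS: "(\<Sum>c<k. q a c * S c b) = (if a = b then 1 else 0)" if "a < k" "b < k" for a b
  proof -
    have "(\<Sum>c<k. q a c * S c b) = (\<Sum>c<k. Q $$ (a, c) * Sm $$ (c, b))"
      using that by (intro sum.cong) (auto simp: q_def Sm_def)
    also have "\<dots> = (Q * Sm) $$ (a, b)"
      by (rule index_mult_mat_sum[OF Q Sm that, symmetric])
    finally show ?thesis
      using that by (simp add: QS)
  qed
  have adj_cancel: "sqnorm k (adjv k S (adjv k q v)) = sqnorm k v" for v
  proof (rule sqnorm_cong)
    fix a assume a: "a < k"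
    have "adjv k S (adjv k q v) a = adjv k (\<lambda>a b. \<Sum>c<k. q a c * S c b) v a"
      by (simp only: adjv_comp)
    also have "\<dots> = (\<Sum>b<k. if b = a then v b else 0)"
      unfolding adjv_def using a by (intro sum.cong refl) (auto simp: qS)
    finally show "adjv k S (adjv k q v) a = v a"
      using a by simp
  qed
  define kap where "kap = 1 + (\<Sum>c<k. \<Sum>a<k. (norm (S a c))\<^sup>2)"
  have kap: "kap \<ge> 1"
    unfolding kap_def by (auto intro!: sum_nonneg)
  \<comment> \<open>With \<open>w = adjv k q v\<close>, the squared length of \<open>v\<close> is at
    most \<open>kap\<close> times that of \<open>w\<close>. The deficit
    \<open>sqnorm k w / 2\<close> is thus at least \<open>sqnorm k v / (2 * kap)\<close>, a fixed
    proportion.\<close>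
  define th where "th = 1 - 1 / (2 * kap)"
  have th: "0 \<le> th" "th < 1"
    using kap by (auto simp: th_def divide_simps)
  have qPS: "Re (qform k P v) = sqnorm k (adjv k S v)" for v
  proof -
    have "qform k P v = of_real (sqnorm k (adjv k S v))"
      by (rule qform_gram) (rule S(1))
    then show ?thesis
      by simp
  qed
  have contr: "(\<Sum>j<g. sqnorm k (adjv k S (adjv k (x j) (adjv k q v)))) \<le> th * sqnorm k v" for v
  proof -
    define w where "w = adjv k q v"
    have Sw: "sqnorm k (adjv k S w) = sqnorm k v"
      unfolding w_def by (rule adj_cancel)
    have "(\<Sum>j<g. sqnorm k (adjv k S (adjv k (x j) w))) = Re (qform k (Phi P) w)"
      by (simp add: qPhi qPS)
    also have "\<dots> \<le> sqnorm k v - sqnorm k w / 2"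
      using PhiP[of w] by (simp only: qPS Sw)
    also have "\<dots> \<le> th * sqnorm k v"
    proof -
      have "sqnorm k v \<le> kap * sqnorm k w"
        using sqnorm_adjv_le[of k S w] by (simp only: Sw kap_def)
      then have "sqnorm k v / (2 * kap) \<le> sqnorm k w / 2"
        using kap by (simp add: field_simps)
      then show ?thesis
        by (simp add: th_def left_diff_distrib)
    qed
    finally show ?thesis
      by (simp only: w_def)
  qed
  have "row_norm g k (\<lambda>j. of_real t \<cdot>\<^sub>m (Q * X j * Sm)) \<le> t * sqrt th" if t: "0 \<le> t" for t
  proof (rule row_norm_le)
    show "mat_tuple g k (\<lambda>j. of_real t \<cdot>\<^sub>m (Q * X j * Sm))"
      unfolding mat_tuple_def
      by (intro allI impI smult_carrier_mat mult_carrier_mat[OF mult_carrier_mat[OF Q XC] Sm])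
    show "0 \<le> t * sqrt th"
      using t th by simp
    fix v
    have "sqnorm k (adjv k (\<lambda>a b. (of_real t \<cdot>\<^sub>m (Q * X j * Sm)) $$ (a, b)) v)
        = t\<^sup>2 * sqnorm k (adjv k S (adjv k (x j) (adjv k q v)))" if j: "j < g" for j
    proof -
      have QX: "Q * X j \<in> carrier_mat k k"
        using Q XC[OF j] by simp
      have ent: "(of_real t \<cdot>\<^sub>m (Q * X j * Sm)) $$ (a, b) = of_real t * (\<Sum>c<k. (\<Sum>e<k. q a e * x j e c) * S c b)"
        if ab: "a < k" "b < k" for a b
      proof -
        have "(Q * X j * Sm) $$ (a, b) = (\<Sum>c<k. (Q * X j) $$ (a, c) * Sm $$ (c, b))"
          by (rule index_mult_mat_sum[OF QX Sm ab])
        also have "\<dots> = (\<Sum>c<k. (\<Sum>e<k. q a e * x j e c) * S c b)"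
        proof (rule sum.cong[OF refl])
          fix c assume "c \<in> {..<k}"
          then have c: "c < k" by simp
          show "(Q * X j) $$ (a, c) * Sm $$ (c, b) = (\<Sum>e<k. q a e * x j e c) * S c b"
            unfolding index_mult_mat_sum[OF Q XC[OF j] ab(1) c] using c ab by (simp add: Sm_def q_def x_def)
        qed
        finally show ?thesis
          using carrier_matD[OF mult_carrier_mat[OF QX Sm]] ab by simp
      qed
      have "adjv k (\<lambda>a b. (of_real t \<cdot>\<^sub>m (Q * X j * Sm)) $$ (a, b)) v b
          = of_real t * adjv k S (adjv k (x j) (adjv k q v)) b" if "b < k" for b
      proof -
        have "adjv k (\<lambda>a b. (of_real t \<cdot>\<^sub>m (Q * X j * Sm)) $$ (a, b)) v b
            = of_real t * adjv k (\<lambda>a b. \<Sum>c<k. (\<Sum>e<k. q a e * x j e c) * S c b) v b"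
          unfolding adjv_def sum_distrib_left using that by (intro sum.cong refl) (simp add: ent mult_ac)
        then show ?thesis
          by (simp only: adjv_comp)
      qed
      then have "sqnorm k (adjv k (\<lambda>a b. (of_real t \<cdot>\<^sub>m (Q * X j * Sm)) $$ (a, b)) v)
          = sqnorm k (\<lambda>b. of_real t * adjv k S (adjv k (x j) (adjv k q v)) b)"
        by (rule sqnorm_cong)
      then show ?thesis
        by (simp add: sqnorm_def norm_mult power_mult_distrib sum_distrib_left)
    qed
    then have "(\<Sum>j<g. sqnorm k (adjv k (\<lambda>a b. (of_real t \<cdot>\<^sub>m (Q * X j * Sm)) $$ (a, b)) v))
        = t\<^sup>2 * (\<Sum>j<g. sqnorm k (adjv k S (adjv k (x j) (adjv k q v))))"
      by (simp add: sum_distrib_left)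
    also have "\<dots> \<le> t\<^sup>2 * (th * sqnorm k v)"
      by (intro mult_left_mono contr) auto
    also have "\<dots> = (t * sqrt th)\<^sup>2 * sqnorm k v"
      using th by (simp add: power_mult_distrib)
    finally show "(\<Sum>j<g. sqnorm k (adjv k (\<lambda>a b. (of_real t \<cdot>\<^sub>m (Q * X j * Sm)) $$ (a, b)) v)) \<le> (t * sqrt th)\<^sup>2 * sqnorm k v" .
  qed
  moreover have "0 \<le> sqrt th" "sqrt th < 1"
    using th by auto
  ultimately show ?thesis
    using that[OF Sm Q QS] by blast
qed

subsection \<open>Homogeneous parts of the determinant\<close>

lemma bij_betw_div_mod: "bij_betw (\<lambda>(a, i). a * d + i) ({..<k} \<times> {..<d}) {..<k * d :: nat}"
proof (rule bij_betwI[where g = "\<lambda>l. (l div d, l mod d)"])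
  show "(\<lambda>(a, i). a * d + i) \<in> {..<k} \<times> {..<d} \<rightarrow> {..<k * d}"
    using div_mod_bound by auto
  show "(\<lambda>l. (l div d, l mod d)) \<in> {..<k * d} \<rightarrow> {..<k} \<times> {..<d}"
  proof
    fix l assume "l \<in> {..<k * d}"
    then have "l < k * d" "0 < d"
      by (auto intro: gr0I)
    then show "(l div d, l mod d) \<in> {..<k} \<times> {..<d}"
      by (simp add: less_mult_imp_div_less)
  qed
qed auto

text \<open>Expanding the sum at every position amounts to choosing a colour tuple \<open>c\<close>.
  For fixed \<open>c\<close> the trace of the Kronecker products splits into one word trace for each
  factor.\<close>

lemma ptr_kron_sum:
  assumes s: "s permutes {..<n}"
    and X: "\<And>j. j < g \<Longrightarrow> X j \<in> carrier_mat k k" and Y: "\<And>j. j < g \<Longrightarrow> Y j \<in> carrier_mat d d"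
  shows "ptr n s {..<k * d} (\<lambda>_ x y. mat_sum (k * d) g (\<lambda>j. X j \<otimes>\<^sub>K Y j) $$ (x, y))
    = (\<Sum>c\<in>tuples n {..<g}. word_trace k n s c X * word_trace d n s c Y)"
proof -
  let ?h = "\<lambda>(a, i). a * d + i"
  have "ptr n s {..<k * d} (\<lambda>_ x y. mat_sum (k * d) g (\<lambda>j. X j \<otimes>\<^sub>K Y j) $$ (x, y))
      = ptr n s ({..<k} \<times> {..<d}) (\<lambda>_ p q. mat_sum (k * d) g (\<lambda>j. X j \<otimes>\<^sub>K Y j) $$ (?h p, ?h q))"
    by (rule ptr_reindex[OF s bij_betw_div_mod, symmetric])
  also have "\<dots> = ptr n s ({..<k} \<times> {..<d}) (\<lambda>_ p q. \<Sum>j<g. X j $$ (fst p, fst q) * Y j $$ (snd p, snd q))"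
  proof (rule ptr_cong[OF s])
    fix p q assume "p \<in> {..<k} \<times> {..<d}" "q \<in> {..<k} \<times> {..<d}"
    then obtain a i b l where pq: "p = (a, i)" "q = (b, l)" "a < k" "i < d" "b < k" "l < d"
      by auto
    have "mat_sum (k * d) g (\<lambda>j. X j \<otimes>\<^sub>K Y j) $$ (a * d + i, b * d + l) = (\<Sum>j<g. X j $$ (a, b) * Y j $$ (i, l))"
      unfolding mat_sum_index[OF div_mod_bound[OF pq(3,4)] div_mod_bound[OF pq(5,6)]]
      by (intro sum.cong refl kron_index[OF X Y]) (use pq in auto)
    then show "mat_sum (k * d) g (\<lambda>j. X j \<otimes>\<^sub>K Y j) $$ (?h p, ?h q) = (\<Sum>j<g. X j $$ (fst p, fst q) * Y j $$ (snd p, snd q))"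
      by (simp add: pq)
  qed
  also have "\<dots> = (\<Sum>c\<in>tuples n {..<g}. ptr n s ({..<k} \<times> {..<d}) (\<lambda>a p q. X (c a) $$ (fst p, fst q) * Y (c a) $$ (snd p, snd q)))"
    by (rule ptr_sum) simp
  also have "\<dots> = (\<Sum>c\<in>tuples n {..<g}. word_trace k n s c X * word_trace d n s c Y)"
    unfolding word_trace_def
    by (rule sum.cong[OF refl], rule ptr_times[OF s, where A = "\<lambda>a x y. X (_ a) $$ (x, y)" and B = "\<lambda>a x y. Y (_ a) $$ (x, y)"])
  finally show ?thesis .
qed

text \<open>The part of \<open>det (L\<^sub>X U)\<close> that is homogeneous of degree \<open>n\<close>, the trace of \<open>\<Sum> X\<^sub>j \<otimes> U\<^sub>j\<close> on the
  \<open>n\<close>-th exterior power.\<close>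

definition hom_part :: "nat \<Rightarrow> nat \<Rightarrow> nat \<Rightarrow> nat \<Rightarrow> (nat \<Rightarrow> complex mat) \<Rightarrow> (nat \<Rightarrow> complex mat) \<Rightarrow> complex" where
  "hom_part g k d n X U =
    (\<Sum>s\<in>perms n. of_int (sign s) * (\<Sum>c\<in>tuples n {..<g}. word_trace k n s c X * word_trace d n s c U)) / fact n"

lemma hom_part_eq_ext_trace:
  assumes "\<And>j. j < g \<Longrightarrow> X j \<in> carrier_mat k k" and "\<And>j. j < g \<Longrightarrow> U j \<in> carrier_mat d d"
  shows "hom_part g k d n X U = ext_trace n {..<k * d} (\<lambda>x y. mat_sum (k * d) g (\<lambda>j. X j \<otimes>\<^sub>K U j) $$ (x, y))"
proof -
  have "ptr n s {..<k * d} (\<lambda>_ x y. mat_sum (k * d) g (\<lambda>j. X j \<otimes>\<^sub>K U j) $$ (x, y))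
    = (\<Sum>c\<in>tuples n {..<g}. word_trace k n s c X * word_trace d n s c U)" if "s \<in> perms n" for s
    by (rule ptr_kron_sum) (use that assms in auto)
  then show ?thesis
    by (simp add: hom_part_def power_trace_def)
qed

lemma kron_one: "1\<^sub>m k \<otimes>\<^sub>K 1\<^sub>m d = (1\<^sub>m (k * d) :: complex mat)"
proof (rule eq_matI)
  fix x y assume "x < dim_row (1\<^sub>m (k * d) :: complex mat)" "y < dim_col (1\<^sub>m (k * d) :: complex mat)"
  then have xy: "x < k * d" "y < k * d" "0 < d"
    by (auto intro: gr0I)
  then have "x div d < k" "y div d < k" "x mod d < d" "y mod d < d"
    by (auto simp: less_mult_imp_div_less)
  moreover have "x div d = y div d \<and> x mod d = y mod d \<longleftrightarrow> x = y"
    by (metis div_mult_mod_eq)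
  ultimately show "(1\<^sub>m k \<otimes>\<^sub>K 1\<^sub>m d) $$ (x, y) = 1\<^sub>m (k * d) $$ (x, y)"
    using xy by (auto simp: kron_def)
qed (auto simp: kron_def)

lemma det_lin_pencil:
  assumes "\<And>j. j < g \<Longrightarrow> X j \<in> carrier_mat k k" and "\<And>j. j < g \<Longrightarrow> U j \<in> carrier_mat d d"
  shows "Determinant.det (lin_pencil g k d X U) = (\<Sum>n\<le>k * d. hom_part g k d n X U)"
    and "k * d < n \<Longrightarrow> hom_part g k d n X U = 0"
proof -
  have hp: "hom_part g k d n X U = ext_trace n {..<k * d} (\<lambda>x y. mat_sum (k * d) g (\<lambda>j. X j \<otimes>\<^sub>K U j) $$ (x, y))" for n
    by (rule hom_part_eq_ext_trace) (use assms in auto)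
  show "Determinant.det (lin_pencil g k d X U) = (\<Sum>n\<le>k * d. hom_part g k d n X U)"
    unfolding lin_pencil_def kron_one hp by (rule det_one_plus(1)[OF mat_sum_carrier])
  show "k * d < n \<Longrightarrow> hom_part g k d n X U = 0"
    unfolding hp by (rule det_one_plus(2)[OF mat_sum_carrier])
qed

lemma word_trace_smult:
  assumes s: "s permutes {..<n}" and c: "c \<in> tuples n {..<g}" and X: "\<And>j. j < g \<Longrightarrow> X j \<in> carrier_mat k k"
    and Y: "\<And>j x y. j < g \<Longrightarrow> x < k \<Longrightarrow> y < k \<Longrightarrow> Y j $$ (x, y) = z * X j $$ (x, y)"
  shows "word_trace k n s c Y = z ^ n * word_trace k n s c X"
proof -
  have "word_trace k n s c Y = ptr n s {..<k} (\<lambda>a x y. z * X (c a) $$ (x, y))"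
    unfolding word_trace_def by (rule ptr_cong[OF s]) (use c in \<open>auto intro!: Y\<close>)
  then show ?thesis
    by (simp only: ptr_scale word_trace_def)
qed

lemma word_trace_similar:
  assumes s: "s permutes {..<n}" and c: "c \<in> tuples n {..<g}" and X: "\<And>j. j < g \<Longrightarrow> X j \<in> carrier_mat k k"
    and P: "P \<in> carrier_mat k k" and Q: "Q \<in> carrier_mat k k" and QP: "Q * P = 1\<^sub>m k"
  shows "word_trace k n s c (\<lambda>j. Q * X j * P) = word_trace k n s c X"
proof -
  have PQ: "P * Q = 1\<^sub>m k"
    by (rule mat_mult_left_right_inverse[OF Q P QP])
  have "word_trace k n s c (\<lambda>j. Q * X j * P)
      = ptr n s {..<k} (\<lambda>a x y. \<Sum>z<k. Q $$ (x, z) * (\<Sum>w<k. X (c a) $$ (z, w) * P $$ (w, y)))"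
    unfolding word_trace_def
  proof (rule ptr_cong[OF s])
    fix a x y assume a: "a < n" and "x \<in> {..<k}" "y \<in> {..<k}"
    then have xy: "x < k" "y < k"
      by auto
    have XC: "X (c a) \<in> carrier_mat k k"
      using c a by (intro X) auto
    have "Q * X (c a) * P = Q * (X (c a) * P)"
      by (rule assoc_mult_mat[OF Q XC P])
    then have "(Q * X (c a) * P) $$ (x, y) = (\<Sum>z<k. Q $$ (x, z) * (X (c a) * P) $$ (z, y))"
      using index_mult_mat_sum[OF Q mult_carrier_mat[OF XC P] xy] by (simp only:)
    also have "\<dots> = (\<Sum>z<k. Q $$ (x, z) * (\<Sum>w<k. X (c a) $$ (z, w) * P $$ (w, y)))"
      by (intro sum.cong refl arg_cong2[of _ _ _ _ "(*)"] index_mult_mat_sum[OF XC P]) (use xy in auto)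
    finally show "(Q * X (c a) * P) $$ (x, y) = (\<Sum>z<k. Q $$ (x, z) * (\<Sum>w<k. X (c a) $$ (z, w) * P $$ (w, y)))" .
  qed
  also have "\<dots> = word_trace k n s c X"
    unfolding word_trace_def
  proof (rule ptr_similar[OF s])
    fix x y assume xy: "x \<in> {..<k}" "y \<in> {..<k}"
    have "(\<Sum>z<k. P $$ (x, z) * Q $$ (z, y)) = (P * Q) $$ (x, y)"
      by (rule index_mult_mat_sum[OF P Q, symmetric]) (use xy in auto)
    then show "(\<Sum>z<k. P $$ (x, z) * Q $$ (z, y)) = (if x = y then 1 else 0)"
      using xy by (simp add: PQ)
  qed simp
  finally show ?thesis .
qed

text \<open>\<open>X\<close> enters only through its word traces, which simultaneous similarity
  leaves unchanged. A bound for a similar and dilated tuple thus carries over to \<open>X\<close>,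
  up to the power of the dilation.\<close>

lemma hom_part_smult_similar:
  assumes X: "\<And>j. j < g \<Longrightarrow> X j \<in> carrier_mat k k"
    and P: "P \<in> carrier_mat k k" and Q: "Q \<in> carrier_mat k k" and QP: "Q * P = 1\<^sub>m k"
  shows "hom_part g k d n (\<lambda>j. z \<cdot>\<^sub>m (Q * X j * P)) U = z ^ n * hom_part g k d n X U"
proof -
  have C: "Q * X j * P \<in> carrier_mat k k" if "j < g" for j
    by (intro mult_carrier_mat[OF mult_carrier_mat[OF Q X[OF that]] P])
  have WT: "word_trace k n s c (\<lambda>j. z \<cdot>\<^sub>m (Q * X j * P)) = z ^ n * word_trace k n s c X"
    if s: "s permutes {..<n}" and c: "c \<in> tuples n {..<g}" for s c
  proof -
    have "word_trace k n s c (\<lambda>j. z \<cdot>\<^sub>m (Q * X j * P)) = z ^ n * word_trace k n s c (\<lambda>j. Q * X j * P)"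
    proof (rule word_trace_smult[OF s c C])
      fix j x y assume "j < g" "x < k" "y < k"
      then show "(z \<cdot>\<^sub>m (Q * X j * P)) $$ (x, y) = z * (Q * X j * P) $$ (x, y)"
        using carrier_matD[OF C] by (intro index_smult_mat) auto
    qed
    then show ?thesis
      by (simp only: word_trace_similar[OF s c X P Q QP])
  qed
  then have "hom_part g k d n (\<lambda>j. z \<cdot>\<^sub>m (Q * X j * P)) U
      = (\<Sum>s\<in>perms n. of_int (sign s) * (\<Sum>c\<in>tuples n {..<g}. z ^ n * (word_trace k n s c X * word_trace d n s c U))) / fact n"
    unfolding hom_part_def by (intro arg_cong[where f = "\<lambda>x. x / fact n"] arg_cong[where f = "(*) _"] sum.cong refl) (simp only: WT mem_Collect_eq mult.assoc)
  also have "\<dots> = z ^ n * hom_part g k d n X U"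
    unfolding hom_part_def sum_distrib_left[symmetric] mult.left_commute[of _ "z ^ n"] by simp
  finally show ?thesis .
qed

section \<open>Orthogonality and moments of the homogeneous parts\<close>

context haar_unitary
begin

lemma hom_part_bounded_measurable: "bounded_measurable H (hom_part g k d n X)"
  unfolding hom_part_def[abs_def] divide_inverse
  by (intro bounded_measurable_intros word_trace_bounded_measurable) auto

lemma hom_part_orthogonal:
  assumes nm: "n \<noteq> m"
  shows "(LINT U|H. hom_part g k d n X U * cnj (hom_part g k' d m Y U)) = 0"
proof -
  \<comment> \<open>Chosen so that the total phase \<open>z ^ n * cnj (z ^ m)\<close> is
    \<open>-1\<close>. Invariance under the scalar \<open>z\<close> then makes the integral equal to
    its negative.\<close>
  define z where "z = cis (pi / (real n - real m))"
  have zz: "z ^ n * cnj (z ^ m) = -1"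
  proof -
    have "z ^ n * cnj (z ^ m) = cis (real n * (pi / (real n - real m)) - real m * (pi / (real n - real m)))"
      by (simp only: z_def Complex.DeMoivre cis_cnj cis_mult diff_conv_add_uminus)
    also have "real n * (pi / (real n - real m)) - real m * (pi / (real n - real m)) = (real n - real m) * (pi / (real n - real m))"
      by (simp only: left_diff_distrib)
    also have "\<dots> = pi"
      using nm by simp
    finally show ?thesis
      by simp
  qed
  define V where "V = (\<lambda>_ :: nat. z \<cdot>\<^sub>m (1\<^sub>m d :: complex mat))"
  have V: "V j \<in> unitary_group d" for j
    unfolding V_def by (rule scalar_unitary) (simp add: z_def)
  have tr: "hom_part g k d n X (translate V U) = z ^ n * hom_part g k d n X U"
    if U: "U \<in> space H" for U k n X
  proof -
    have UC: "U j \<in> carrier_mat d d" if "j < g" for j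
      using space_H[OF U that] by (simp add: unitary_group_def)
    have WT: "word_trace d n s c (translate V U) = z ^ n * word_trace d n s c U"
      if s: "s permutes {..<n}" and c: "c \<in> tuples n {..<g}" for s c
    proof (rule word_trace_smult[OF s c UC])
      fix j x y assume jxy: "j < g" "x < d" "y < d"
      have "translate V U j = z \<cdot>\<^sub>m U j"
        using jxy UC[OF jxy(1)] mult_smult_assoc_mat[OF one_carrier_mat UC[OF jxy(1)], of z]
        by (simp add: translate_def V_def)
      then show "translate V U j $$ (x, y) = z * U j $$ (x, y)"
        using jxy UC[OF jxy(1)] by simp
    qed
    then have "hom_part g k d n X (translate V U)
        = (\<Sum>s\<in>perms n. of_int (sign s) * (\<Sum>c\<in>tuples n {..<g}. z ^ n * (word_trace k n s c X * word_trace d n s c U))) / fact n"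
      unfolding hom_part_def by (intro arg_cong[where f = "\<lambda>x. x / fact n"] arg_cong[where f = "(*) _"] sum.cong refl) (simp only: WT mem_Collect_eq mult.left_commute)
    also have "\<dots> = z ^ n * hom_part g k d n X U"
      unfolding hom_part_def sum_distrib_left[symmetric] mult.left_commute[of _ "z ^ n"] by simp
    finally show ?thesis .
  qed
  let ?F = "\<lambda>U. hom_part g k d n X U * cnj (hom_part g k' d m Y U)"
  have F: "bounded_measurable H ?F"
    by (intro bounded_measurable_mult bounded_measurable_cnj hom_part_bounded_measurable)
  have "(LINT U|H. ?F U) = (LINT U|H. ?F (translate V U))"
    by (rule integral_translate[OF V, symmetric]) (use F in \<open>simp add: bounded_measurable_def\<close>)
  also have "\<dots> = (LINT U|H. (z ^ n * cnj (z ^ m)) * ?F U)"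
    by (rule Bochner_Integration.integral_cong[OF refl]) (simp add: tr)
  also have "\<dots> = - (LINT U|H. ?F U)"
    unfolding zz by simp
  finally show ?thesis
    by simp
qed

lemma integral_det_mult:
  assumes X: "\<And>j. j < g \<Longrightarrow> X j \<in> carrier_mat k k" and Y: "\<And>j. j < g \<Longrightarrow> Y j \<in> carrier_mat k' k'"
    and N: "k * d \<le> N" "k' * d \<le> N"
  shows "(LINT U|H. Determinant.det (lin_pencil g k d X U) * cnj (Determinant.det (lin_pencil g k' d Y U)))
    = (\<Sum>n\<le>N. LINT U|H. hom_part g k d n X U * cnj (hom_part g k' d n Y U))"
proof -
  have det: "Determinant.det (lin_pencil g k d X U) = (\<Sum>n\<le>N. hom_part g k d n X U)"
    if U: "U \<in> space H" and X: "\<And>j. j < g \<Longrightarrow> X j \<in> carrier_mat k k" and N: "k * d \<le> N" for U X k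
  proof -
    have UC: "U j \<in> carrier_mat d d" if "j < g" for j
      using space_H[OF U that] by (simp add: unitary_group_def)
    have "(\<Sum>n\<le>k * d. hom_part g k d n X U) = (\<Sum>n\<le>N. hom_part g k d n X U)"
      by (rule sum.mono_neutral_left) (use N in \<open>auto intro!: det_lin_pencil(2)[OF X UC]\<close>)
    then show ?thesis
      by (simp only: det_lin_pencil(1)[of g X k U d, OF X UC])
  qed
  have bm: "bounded_measurable H (\<lambda>U. hom_part g k d n X U * cnj (hom_part g k' d m Y U))" for n m
    by (intro bounded_measurable_mult bounded_measurable_cnj hom_part_bounded_measurable)
  have "(LINT U|H. Determinant.det (lin_pencil g k d X U) * cnj (Determinant.det (lin_pencil g k' d Y U)))
      = (LINT U|H. (\<Sum>n\<le>N. \<Sum>m\<le>N. hom_part g k d n X U * cnj (hom_part g k' d m Y U)))"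
    by (rule Bochner_Integration.integral_cong[OF refl])
      (simp only: det[OF _ X N(1)] det[OF _ Y N(2)] cnj_sum sum_product)
  also have "\<dots> = (\<Sum>n\<le>N. LINT U|H. (\<Sum>m\<le>N. hom_part g k d n X U * cnj (hom_part g k' d m Y U)))"
    by (rule Bochner_Integration.integral_sum, rule integrable_H, rule bounded_measurable_sum, rule bm)
  also have "\<dots> = (\<Sum>n\<le>N. \<Sum>m\<le>N. LINT U|H. hom_part g k d n X U * cnj (hom_part g k' d m Y U))"
    by (rule sum.cong[OF refl], rule Bochner_Integration.integral_sum, rule integrable_H, rule bm)
  also have "\<dots> = (\<Sum>n\<le>N. \<Sum>m\<le>N. if m = n then LINT U|H. hom_part g k d n X U * cnj (hom_part g k' d n Y U) else 0)"
    by (intro sum.cong refl) (auto simp: hom_part_orthogonal)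
  also have "\<dots> = (\<Sum>n\<le>N. LINT U|H. hom_part g k d n X U * cnj (hom_part g k' d n Y U))"
    by (intro sum.cong refl) (simp add: sum.delta)
  finally show ?thesis .
qed

lemma norm_square_integrable: "integrable H (\<lambda>U. (norm (hom_part g k d n X U))\<^sup>2)"
proof -
  have "integrable H (\<lambda>U. norm (hom_part g k d n X U * cnj (hom_part g k d n X U)))"
    by (intro integrable_norm integrable_H bounded_measurable_mult bounded_measurable_cnj hom_part_bounded_measurable)
  then show ?thesis
    by (simp add: norm_mult power2_eq_square)
qed

text \<open>By orthogonality the squared norm of the determinant is the sum of those of its
  homogeneous parts, so each part is bounded by the whole. \<open>N\<close> is at least
  \<open>n\<close> so that the part in question occurs in the sum.\<close>

lemma hom_part_norm_square_le:
  assumes X: "\<And>j. j < g \<Longrightarrow> X j \<in> carrier_mat k k"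
  shows "(LINT U|H. (norm (hom_part g k d n X U))\<^sup>2) \<le> (LINT U|H. (norm (Determinant.det (lin_pencil g k d X U)))\<^sup>2)"
proof -
  define N where "N = max n (k * d)"
  have re: "complex_of_real (LINT U|H. (norm (f U))\<^sup>2) = (LINT U|H. f U * cnj (f U))" for f
    unfolding complex_norm_square[symmetric] by (rule integral_complex_of_real[symmetric])
  have "complex_of_real (LINT U|H. (norm (Determinant.det (lin_pencil g k d X U)))\<^sup>2)
      = (\<Sum>n\<le>N. complex_of_real (LINT U|H. (norm (hom_part g k d n X U))\<^sup>2))"
    unfolding re by (rule integral_det_mult[OF X X]) (auto simp: N_def)
  then have "(LINT U|H. (norm (Determinant.det (lin_pencil g k d X U)))\<^sup>2) = (\<Sum>n\<le>N. LINT U|H. (norm (hom_part g k d n X U))\<^sup>2)"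
    by (simp only: of_real_sum[symmetric] of_real_eq_iff)
  moreover have "(LINT U|H. (norm (hom_part g k d n X U))\<^sup>2) \<le> (\<Sum>n\<le>N. LINT U|H. (norm (hom_part g k d n X U))\<^sup>2)"
    by (rule member_le_sum) (auto simp: N_def intro!: integral_nonneg_AE)
  ultimately show ?thesis
    by simp
qed

text \<open>The pointwise estimate \<open>|a b| \<le> |a|^2 + |b|^2\<close> is enough, as only a
  summable majorant is wanted.\<close>

lemma norm_hom_part_mult_le:
  "norm (LINT U|H. hom_part g k d n X U * cnj (hom_part g k' d n Y U))
    \<le> (LINT U|H. (norm (hom_part g k d n X U))\<^sup>2) + (LINT U|H. (norm (hom_part g k' d n Y U))\<^sup>2)"
proof -
  have int: "integrable H (\<lambda>U. hom_part g k d n X U * cnj (hom_part g k' d n Y U))"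
    by (intro integrable_H bounded_measurable_mult bounded_measurable_cnj hom_part_bounded_measurable)
  have "norm (LINT U|H. hom_part g k d n X U * cnj (hom_part g k' d n Y U))
      \<le> (LINT U|H. norm (hom_part g k d n X U * cnj (hom_part g k' d n Y U)))"
    by (rule integral_norm_bound)
  also have "\<dots> \<le> (LINT U|H. (norm (hom_part g k d n X U))\<^sup>2 + (norm (hom_part g k' d n Y U))\<^sup>2)"
  proof (rule integral_mono)
    show "integrable H (\<lambda>U. norm (hom_part g k d n X U * cnj (hom_part g k' d n Y U)))"
      by (rule integrable_norm[OF int])
    show "integrable H (\<lambda>U. (norm (hom_part g k d n X U))\<^sup>2 + (norm (hom_part g k' d n Y U))\<^sup>2)"
      by (intro Bochner_Integration.integrable_add norm_square_integrable)
    fix U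
    let ?a = "norm (hom_part g k d n X U)" and ?b = "norm (hom_part g k' d n Y U)"
    have "2 * ?a * ?b \<le> ?a\<^sup>2 + ?b\<^sup>2"
      by (rule sum_squares_bound)
    moreover have "0 \<le> ?a * ?b"
      by simp
    ultimately have "?a * ?b \<le> ?a\<^sup>2 + ?b\<^sup>2"
      by linarith
    then show "norm (hom_part g k d n X U * cnj (hom_part g k' d n Y U)) \<le> ?a\<^sup>2 + ?b\<^sup>2"
      by (simp only: norm_mult complex_mod_cnj)
  qed
  finally have "norm (LINT U|H. hom_part g k d n X U * cnj (hom_part g k' d n Y U))
      \<le> (LINT U|H. (norm (hom_part g k d n X U))\<^sup>2 + (norm (hom_part g k' d n Y U))\<^sup>2)" .
  then show ?thesis
    by (simp only: Bochner_Integration.integral_add[OF norm_square_integrable norm_square_integrable])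
qed

lemma hom_part_moment:
  "(LINT U|H. hom_part g k d n X U * cnj (hom_part g k' d n Y U))
    = (\<Sum>s\<in>perms n. \<Sum>c\<in>tuples n {..<g}. \<Sum>t\<in>perms n. \<Sum>c'\<in>tuples n {..<g}.
        of_int (sign s) * of_int (sign t) * word_trace k n s c X * cnj (word_trace k' n t c' Y) / (fact n * fact n)
        * (LINT U|H. word_trace d n s c U * cnj (word_trace d n t c' U)))"
proof -
  let ?c = "\<lambda>s c t c'. of_int (sign s) * of_int (sign t) * word_trace k n s c X * cnj (word_trace k' n t c' Y) / (fact n * fact n)"
  let ?w = "\<lambda>s c t c' U. word_trace d n s c U * cnj (word_trace d n t c' U)"
  have bm: "bounded_measurable H (\<lambda>U. ?c s c t c' * ?w s c t c' U)"
    if "s \<in> perms n" "c \<in> tuples n {..<g}" "t \<in> perms n" "c' \<in> tuples n {..<g}" for s c t c'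
    by (intro bounded_measurable_mult bounded_measurable_cnj bounded_measurable_const word_trace_bounded_measurable)
      (use that in auto)
  have pt: "hom_part g k d n X U * cnj (hom_part g k' d n Y U)
      = (\<Sum>s\<in>perms n. \<Sum>c\<in>tuples n {..<g}. \<Sum>t\<in>perms n. \<Sum>c'\<in>tuples n {..<g}. ?c s c t c' * ?w s c t c' U)" for U
  proof -
    have hp: "hom_part g k d n X U = (\<Sum>s\<in>perms n. \<Sum>c\<in>tuples n {..<g}. of_int (sign s) * word_trace k n s c X / fact n * word_trace d n s c U)"
      for k X
      unfolding hom_part_def sum_divide_distrib sum_distrib_left by (intro sum.cong refl) simp
    show ?thesis
      unfolding hp cnj_sum sum_distrib_right unfolding sum_distrib_left
      by (intro sum.cong refl) simp
  qed
  have "(LINT U|H. hom_part g k d n X U * cnj (hom_part g k' d n Y U))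
      = (LINT U|H. (\<Sum>s\<in>perms n. \<Sum>c\<in>tuples n {..<g}. \<Sum>t\<in>perms n. \<Sum>c'\<in>tuples n {..<g}. ?c s c t c' * ?w s c t c' U))"
    unfolding pt ..
  also have "\<dots> = (\<Sum>s\<in>perms n. LINT U|H. (\<Sum>c\<in>tuples n {..<g}. \<Sum>t\<in>perms n. \<Sum>c'\<in>tuples n {..<g}. ?c s c t c' * ?w s c t c' U))"
    by (intro Bochner_Integration.integral_sum integrable_H bounded_measurable_sum bm)
  also have "\<dots> = (\<Sum>s\<in>perms n. \<Sum>c\<in>tuples n {..<g}. LINT U|H. (\<Sum>t\<in>perms n. \<Sum>c'\<in>tuples n {..<g}. ?c s c t c' * ?w s c t c' U))"
    by (intro sum.cong refl Bochner_Integration.integral_sum integrable_H bounded_measurable_sum bm)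
  also have "\<dots> = (\<Sum>s\<in>perms n. \<Sum>c\<in>tuples n {..<g}. \<Sum>t\<in>perms n. LINT U|H. (\<Sum>c'\<in>tuples n {..<g}. ?c s c t c' * ?w s c t c' U))"
    by (intro sum.cong refl Bochner_Integration.integral_sum integrable_H bounded_measurable_sum bm)
  also have "\<dots> = (\<Sum>s\<in>perms n. \<Sum>c\<in>tuples n {..<g}. \<Sum>t\<in>perms n. \<Sum>c'\<in>tuples n {..<g}. LINT U|H. ?c s c t c' * ?w s c t c' U)"
    by (intro sum.cong refl Bochner_Integration.integral_sum integrable_H bm)
  finally show ?thesis
    by simp
qed

end

text \<open>For given \<open>s\<close>, \<open>c\<close> and \<open>al\<close> the matching
  condition determines \<open>t\<close>, a conjugate of \<open>s\<close>, and
  \<open>c' = c \<circ> al\<close>. The matched word traces of \<open>Y\<close> coincide and the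
  product of the signs is 1, so every \<open>al\<close> contributes the same. The \<open>n!\<close>
  choices of \<open>al\<close> cancel one of the two factors \<open>fact n\<close>.\<close>

lemma hom_part_moment_limit:
  assumes haar: "\<And>d. d \<ge> 1 \<Longrightarrow> is_haar_unitary d (haar d)"
    and X: "\<And>j. j < g \<Longrightarrow> X j \<in> carrier_mat k k" and Y: "\<And>j. j < g \<Longrightarrow> Y j \<in> carrier_mat k' k'"
  shows "(\<lambda>d. LINT U|haar_power g (haar d). hom_part g k d n X U * cnj (hom_part g k' d n Y U))
    \<longlonglongrightarrow> sym_trace n {..<k * k'} (\<lambda>x y. mat_sum (k * k') g (\<lambda>j. X j \<otimes>\<^sub>K conj_mat (Y j)) $$ (x, y))"
proof -
  let ?co = "\<lambda>s c t c'. of_int (sign s) * of_int (sign t) * word_trace k n s c X * cnj (word_trace k' n t c' Y) / (fact n * fact n)"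
  let ?ind = "\<lambda>s c t c' al. if c \<circ> al = c' \<and> s \<circ> al = al \<circ> t then 1 else (0 :: complex)"
  let ?xy = "\<lambda>s c. word_trace k n s c X * cnj (word_trace k' n s c Y)"
  have L: "(\<lambda>d. \<Sum>s\<in>perms n. \<Sum>c\<in>tuples n {..<g}. \<Sum>t\<in>perms n. \<Sum>c'\<in>tuples n {..<g}.
        ?co s c t c' * (LINT U|haar_power g (haar d). word_trace d n s c U * cnj (word_trace d n t c' U)))
    \<longlonglongrightarrow> (\<Sum>s\<in>perms n. \<Sum>c\<in>tuples n {..<g}. \<Sum>t\<in>perms n. \<Sum>c'\<in>tuples n {..<g}.
        ?co s c t c' * (\<Sum>al\<in>perms n. ?ind s c t c' al))"
    by (intro tendsto_sum tendsto_mult tendsto_const word_trace_moment_limit haar) auto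
  have "(\<lambda>d. LINT U|haar_power g (haar d). hom_part g k d n X U * cnj (hom_part g k' d n Y U))
    \<longlonglongrightarrow> (\<Sum>s\<in>perms n. \<Sum>c\<in>tuples n {..<g}. \<Sum>t\<in>perms n. \<Sum>c'\<in>tuples n {..<g}.
        ?co s c t c' * (\<Sum>al\<in>perms n. ?ind s c t c' al))"
  proof (rule Lim_transform_eventually[OF L])
    show "eventually (\<lambda>d. (\<Sum>s\<in>perms n. \<Sum>c\<in>tuples n {..<g}. \<Sum>t\<in>perms n. \<Sum>c'\<in>tuples n {..<g}.
        ?co s c t c' * (LINT U|haar_power g (haar d). word_trace d n s c U * cnj (word_trace d n t c' U)))
      = (LINT U|haar_power g (haar d). hom_part g k d n X U * cnj (hom_part g k' d n Y U))) sequentially"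
      using eventually_ge_at_top[of 1]
    proof eventually_elim
      case (elim d)
      interpret haar_unitary d g "haar d"
        by standard (rule haar[OF elim])
      show ?case
        by (rule hom_part_moment[symmetric])
    qed
  qed
  also have "(\<Sum>s\<in>perms n. \<Sum>c\<in>tuples n {..<g}. \<Sum>t\<in>perms n. \<Sum>c'\<in>tuples n {..<g}.
        ?co s c t c' * (\<Sum>al\<in>perms n. ?ind s c t c' al))
      = (\<Sum>s\<in>perms n. \<Sum>c\<in>tuples n {..<g}. ?xy s c / fact n)"
  proof (intro sum.cong refl)
    fix s c assume "s \<in> perms n" and c: "c \<in> tuples n {..<g}"
    then have s: "s permutes {..<n}"
      by blast
    have single: "(\<Sum>t\<in>perms n. \<Sum>c'\<in>tuples n {..<g}. ?co s c t c' * ?ind s c t c' al) = ?xy s c / (fact n * fact n)"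
      if "al \<in> perms n" for al
    proof -
      have al: "al permutes {..<n}"
        using that by blast
      define be where "be = inv_into UNIV al"
      have be: "be permutes {..<n}" "al \<circ> be = id" "be \<circ> al = id"
        using permutes_inv[OF al] permutes_inv_o[OF al] by (auto simp: be_def)
      define t0 where "t0 = be \<circ> (s \<circ> al)"
      have t0: "t0 permutes {..<n}"
        unfolding t0_def by (intro permutes_compose al be s)
      have t0_iff: "s \<circ> al = al \<circ> t \<longleftrightarrow> t = t0" for t
      proof
        assume "s \<circ> al = al \<circ> t"
        then have "be \<circ> (s \<circ> al) = (be \<circ> al) \<circ> t"
          by (simp only: comp_assoc)
        then show "t = t0"
          by (simp only: t0_def be(3) id_comp)
      next
        assume "t = t0"
        then have "al \<circ> t = (al \<circ> be) \<circ> (s \<circ> al)"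
          by (simp only: t0_def comp_assoc)
        then show "s \<circ> al = al \<circ> t"
          by (simp only: be(2) id_comp)
      qed
      have ct: "c \<circ> al \<in> tuples n {..<g}"
        by (rule tuples_comp_permutes[OF al c])
      have "(\<Sum>t\<in>perms n. \<Sum>c'\<in>tuples n {..<g}. ?co s c t c' * ?ind s c t c' al)
          = (\<Sum>t\<in>perms n. if t = t0 then \<Sum>c'\<in>tuples n {..<g}. if c' = c \<circ> al then ?co s c t0 (c \<circ> al) else 0 else 0)"
      proof (rule sum.cong[OF refl])
        fix t
        show "(\<Sum>c'\<in>tuples n {..<g}. ?co s c t c' * ?ind s c t c' al)
          = (if t = t0 then \<Sum>c'\<in>tuples n {..<g}. if c' = c \<circ> al then ?co s c t0 (c \<circ> al) else 0 else 0)"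
        proof (cases "t = t0")
          case True
          have "?co s c t c' * (if c \<circ> al = c' \<and> t = t0 then 1 else 0) = (if c' = c \<circ> al then ?co s c t0 (c \<circ> al) else 0)" for c'
            by (cases "c' = c \<circ> al") (use True in auto)
          then show ?thesis
            unfolding t0_iff if_P[OF True] by (rule sum.cong[OF refl])
        next
          case False
          then show ?thesis
            unfolding t0_iff by simp
        qed
      qed
      also have "\<dots> = (\<Sum>c'\<in>tuples n {..<g}. if c' = c \<circ> al then ?co s c t0 (c \<circ> al) else 0)"
        using t0 by (simp only: sum.delta[OF finite_perms] mem_Collect_eq if_True)
      also have "\<dots> = ?co s c t0 (c \<circ> al)"
      proof -
        have fin: "finite (tuples n {..<g})"
          by (intro finite_PiE) auto
        show ?thesis
          using ct by (simp only: sum.delta[OF fin] if_True)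
      qed
      also have "\<dots> = ?xy s c / (fact n * fact n)"
      proof -
        have "word_trace k' n t0 (c \<circ> al) Y = word_trace k' n s c Y"
          unfolding word_trace_def comp_apply
          by (rule ptr_conjugate[OF s al, where A = "\<lambda>a x y. Y (c a) $$ (x, y)"]) (rule t0_iff[THEN iffD2, OF refl, symmetric])
        moreover have "sign t0 = sign s"
        proof -
          have ps: "permutation al" "permutation be" "permutation s"
            using al be(1) s permutation_permutes by blast+
          then have "sign t0 = sign be * (sign s * sign al)"
            by (simp only: t0_def sign_compose permutation_compose)
          moreover have "sign al * sign be = 1"
            by (simp only: sign_compose[OF ps(1,2), symmetric] be(2) sign_id)
          moreover have "sign be * (sign s * sign al) = sign s * (sign al * sign be)"
            by (simp only: mult_ac)
          ultimately show ?thesis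
            by (simp only: mult_1_right)
        qed
        moreover have "of_int (sign s) * of_int (sign s) = (1 :: complex)"
          by (simp add: of_int_mult[symmetric] del: of_int_mult)
        ultimately show ?thesis
          by (simp add: mult.assoc)
      qed
      finally show ?thesis .
    qed
    have "(\<Sum>t\<in>perms n. \<Sum>c'\<in>tuples n {..<g}. ?co s c t c' * (\<Sum>al\<in>perms n. ?ind s c t c' al))
        = (\<Sum>t\<in>perms n. \<Sum>c'\<in>tuples n {..<g}. \<Sum>al\<in>perms n. ?co s c t c' * ?ind s c t c' al)"
      by (simp only: sum_distrib_left)
    also have "\<dots> = (\<Sum>t\<in>perms n. \<Sum>al\<in>perms n. \<Sum>c'\<in>tuples n {..<g}. ?co s c t c' * ?ind s c t c' al)"
      by (rule sum.cong[OF refl], rule sum.swap)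
    also have "\<dots> = (\<Sum>al\<in>perms n. \<Sum>t\<in>perms n. \<Sum>c'\<in>tuples n {..<g}. ?co s c t c' * ?ind s c t c' al)"
      by (rule sum.swap)
    also have "\<dots> = (\<Sum>al\<in>perms n. ?xy s c / (fact n * fact n))"
      by (rule sum.cong[OF refl single])
    also have "\<dots> = ?xy s c / fact n"
    proof -
      have "card (perms n) = fact n"
        by (rule card_permutations) auto
      then show ?thesis
        by simp
    qed
    finally show "(\<Sum>t\<in>perms n. \<Sum>c'\<in>tuples n {..<g}. ?co s c t c' * (\<Sum>al\<in>perms n. ?ind s c t c' al)) = ?xy s c / fact n" .
  qed
  also have "(\<Sum>s\<in>perms n. \<Sum>c\<in>tuples n {..<g}. ?xy s c / fact n)
      = sym_trace n {..<k * k'} (\<lambda>x y. mat_sum (k * k') g (\<lambda>j. X j \<otimes>\<^sub>K conj_mat (Y j)) $$ (x, y))"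
    unfolding power_trace_def sum_divide_distrib
  proof (rule sum.cong[OF refl])
    fix s assume "s \<in> perms n"
    then have s: "s permutes {..<n}"
      by blast
    have YC: "conj_mat (Y j) \<in> carrier_mat k' k'" if "j < g" for j
      by (rule conj_mat_carrier[OF Y[OF that]])
    have WT: "word_trace k' n s c (\<lambda>j. conj_mat (Y j)) = cnj (word_trace k' n s c Y)" if c: "c \<in> tuples n {..<g}" for c
      unfolding word_trace_def cnj_ptr
    proof (rule ptr_cong[OF s])
      fix a x y assume "a < n" "x \<in> {..<k'}" "y \<in> {..<k'}"
      then show "conj_mat (Y (c a)) $$ (x, y) = cnj (Y (c a) $$ (x, y))"
        using PiE_mem[OF c, of a] by (intro conj_mat_index[OF Y]) auto
    qed
    have "ptr n s {..<k * k'} (\<lambda>_ x y. mat_sum (k * k') g (\<lambda>j. X j \<otimes>\<^sub>K conj_mat (Y j)) $$ (x, y))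
        = (\<Sum>c\<in>tuples n {..<g}. word_trace k n s c X * word_trace k' n s c (\<lambda>j. conj_mat (Y j)))"
      by (rule ptr_kron_sum[OF s X YC])
    also have "\<dots> = (\<Sum>c\<in>tuples n {..<g}. ?xy s c)"
      by (intro sum.cong refl) (simp only: WT)
    finally have "ptr n s {..<k * k'} (\<lambda>_ x y. mat_sum (k * k') g (\<lambda>j. X j \<otimes>\<^sub>K conj_mat (Y j)) $$ (x, y)) = (\<Sum>c\<in>tuples n {..<g}. ?xy s c)" .
    then show "(\<Sum>c\<in>tuples n {..<g}. ?xy s c / fact n)
        = 1 * ptr n s {..<k * k'} (\<lambda>_ x y. mat_sum (k * k') g (\<lambda>j. X j \<otimes>\<^sub>K conj_mat (Y j)) $$ (x, y)) / fact n"
      by (simp add: sum_divide_distrib)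
  qed
  finally show ?thesis .
qed

section \<open>Summation over the degrees\<close>

lemma suminf_sym_trace:
  assumes M: "M \<in> carrier_mat m m" and summ: "summable (\<lambda>n. norm (sym_trace n {..<m} (\<lambda>x y. M $$ (x, y))))"
  shows "(\<Sum>n. sym_trace n {..<m} (\<lambda>x y. M $$ (x, y))) = inverse (Determinant.det (1\<^sub>m m - M))"
proof -
  let ?h = "\<lambda>n. sym_trace n {..<m} (\<lambda>x y. M $$ (x, y))"
  let ?e = "\<lambda>n. (-1) ^ n * ext_trace n {..<m} (\<lambda>x y. M $$ (x, y))"
  have uM: "- M \<in> carrier_mat m m"
    using M by simp
  have e_neg: "ext_trace n {..<m} (\<lambda>x y. (- M) $$ (x, y)) = ?e n" for n
  proof -
    have "ptr n s {..<m} (\<lambda>_ x y. (- M) $$ (x, y)) = (-1) ^ n * ptr n s {..<m} (\<lambda>_ x y. M $$ (x, y))"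
      if "s \<in> perms n" for s
    proof -
      have "ptr n s {..<m} (\<lambda>_ x y. (- M) $$ (x, y)) = ptr n s {..<m} (\<lambda>_ x y. (-1) * M $$ (x, y))"
        by (rule ptr_cong) (use that M in auto)
      then show ?thesis
        by (simp only: ptr_scale)
    qed
    then have "ext_trace n {..<m} (\<lambda>x y. (- M) $$ (x, y))
        = (\<Sum>s\<in>perms n. of_int (sign s) * ((-1) ^ n * ptr n s {..<m} (\<lambda>_ x y. M $$ (x, y)))) / fact n"
      unfolding power_trace_def by (intro arg_cong[where f = "\<lambda>x. x / fact n"] sum.cong refl) (simp only:)
    then show ?thesis
      unfolding power_trace_def mult.left_commute[of _ "(-1) ^ n"] sum_distrib_left[symmetric] by simp
  qed
  have det: "Determinant.det (1\<^sub>m m - M) = (\<Sum>n\<le>m. ?e n)"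
    using det_one_plus(1)[OF uM] M by (simp only: e_neg minus_add_uminus_mat[OF one_carrier_mat M])
  have e0: "?e n = 0" if "n \<notin> {..m}" for n
    using det_one_plus(2)[OF M, of n] that by simp
  have e_sums: "?e sums Determinant.det (1\<^sub>m m - M)"
    unfolding det by (rule sums_finite) (use e0 in auto)
  have e_summ: "summable (\<lambda>n. norm (?e n))"
    by (rule summable_finite[OF finite_atMost[of m]]) (drule e0, simp only: norm_zero)
  \<comment> \<open>The identity between the two formal power series, evaluated at 1. The second
    series is a finite sum, and absolute convergence of the first is assumed, so the Cauchy product
    is legitimate.\<close>
  have "(\<lambda>n. \<Sum>i\<le>n. ?h i * ?e (n - i)) sums (suminf ?h * suminf ?e)"
    by (rule Cauchy_product_sums[OF summ e_summ])
  moreover have "(\<Sum>i\<le>n. ?h i * ?e (n - i)) = (if n = 0 then 1 else 0)" for n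
    using arg_cong[OF det_one_plus(3)[OF M], of "\<lambda>f. fps_nth f n"]
    by (simp add: fps_mult_nth atMost_atLeast0)
  ultimately have "(\<lambda>n. if n = 0 then 1 else 0) sums (suminf ?h * suminf ?e)"
    by simp
  then have "suminf ?h * suminf ?e = 1"
    using sums_single[of 0 "\<lambda>_. 1 :: complex"] sums_unique2 by fastforce
  then have "suminf ?h * Determinant.det (1\<^sub>m m - M) = 1"
    by (simp only: sums_unique[OF e_sums])
  then show ?thesis
    by (metis inverse_unique mult.commute)
qed

theorem proposition3p5:
  fixes g :: nat and haar :: "nat \<Rightarrow> complex mat measure"
  assumes g: "g \<ge> 1"
    and haar: "\<And>d. d \<ge> 1 \<Longrightarrow> is_haar_unitary d (haar d)"
    and bound: "\<And>(r::real) (k::nat). 0 \<le> r \<Longrightarrow> r < 1 \<Longrightarrow> k \<ge> 1 \<Longrightarrow>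
      \<exists>C::real. \<forall>X. mat_tuple g k X \<longrightarrow> row_norm g k X \<le> r \<longrightarrow>
        (\<forall>d\<ge>1. (LINT U|haar_power g (haar d).
                   (norm (Determinant.det (lin_pencil g k d X U)))\<^sup>2) \<le> C)"
  shows "\<forall>k k' X Y. k \<ge> 1 \<longrightarrow> k' \<ge> 1 \<longrightarrow> mat_tuple g k X \<longrightarrow> mat_tuple g k' Y \<longrightarrow>
    tuple_rad g k X < 1 \<longrightarrow> tuple_rad g k' Y < 1 \<longrightarrow>
    (\<lambda>d. LINT U|haar_power g (haar d).
            Determinant.det (lin_pencil g k d X U) * cnj (Determinant.det (lin_pencil g k' d Y U)))
      \<longlonglongrightarrow> inverse (Determinant.det
            (1\<^sub>m k \<otimes>\<^sub>K 1\<^sub>m k' - mat_sum (k * k') g (\<lambda>j. X j \<otimes>\<^sub>K conj_mat (Y j))))"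
proof (intro allI impI)
  fix k k' :: nat and X Y :: "nat \<Rightarrow> complex mat"
  assume k: "k \<ge> 1" "k' \<ge> 1" and XY: "mat_tuple g k X" "mat_tuple g k' Y"
    and rad: "tuple_rad g k X < 1" "tuple_rad g k' Y < 1"
  have decay: "\<exists>C q. 0 \<le> q \<and> q < 1 \<and> (\<forall>d\<ge>1. \<forall>n. (LINT U|haar_power g (haar d). (norm (hom_part g k d n X U))\<^sup>2) \<le> C * q ^ n)"
    if k: "k \<ge> 1" and X: "mat_tuple g k X" and rad: "tuple_rad g k X < 1" for k X
  proof -
    have XC: "X j \<in> carrier_mat k k" if "j < g" for j
      using X that by (simp add: mat_tuple_def)
    obtain P Q r where P: "P \<in> carrier_mat k k" and Q: "Q \<in> carrier_mat k k" and QP: "Q * P = 1\<^sub>m k"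
      and r: "0 \<le> r" "r < 1" and row: "\<And>t. 0 \<le> t \<Longrightarrow> row_norm g k (\<lambda>j. of_real t \<cdot>\<^sub>m (Q * X j * P)) \<le> t * r"
      using similar_row_contraction[OF X k rad] by blast
    \<comment> \<open>A dilation with \<open>t > 1\<close> and \<open>t * r < 1\<close> that makes
      sense also for \<open>r = 0\<close>.\<close>
    define t where "t = 2 / (1 + r)"
    have t: "1 < t" "t * r < 1" "0 \<le> t * r"
      using r by (auto simp: t_def field_simps)
    obtain C where C: "\<And>X d. mat_tuple g k X \<Longrightarrow> row_norm g k X \<le> t * r \<Longrightarrow> d \<ge> 1 \<Longrightarrow>
        (LINT U|haar_power g (haar d). (norm (Determinant.det (lin_pencil g k d X U)))\<^sup>2) \<le> C"
      using bound[OF t(3,2) k] by blast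
    define Z where "Z j = of_real t \<cdot>\<^sub>m (Q * X j * P)" for j
    have ZC: "Z j \<in> carrier_mat k k" if "j < g" for j
      unfolding Z_def by (intro smult_carrier_mat mult_carrier_mat[OF mult_carrier_mat[OF Q XC[OF that]] P])
    \<comment> \<open>The bound \<open>C\<close> for the dilated tuple does not depend on
      \<open>d\<close>, and its part of degree \<open>n\<close> carries the factor
      \<open>t ^ n\<close>. Undoing the dilation turns the constant bound into geometric
      decay.\<close>
    have main: "(LINT U|haar_power g (haar d). (norm (hom_part g k d n X U))\<^sup>2) \<le> C * (inverse (t\<^sup>2)) ^ n" if d: "d \<ge> 1" for d n
    proof -
      interpret haar_unitary d g "haar d"
        by standard (rule haar[OF d])
      have hZ: "hom_part g k d n Z U = of_real t ^ n * hom_part g k d n X U" for U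
        unfolding Z_def[abs_def] by (rule hom_part_smult_similar[OF XC P Q QP])
      have "(LINT U|H. (norm (hom_part g k d n Z U))\<^sup>2) \<le> (LINT U|H. (norm (Determinant.det (lin_pencil g k d Z U)))\<^sup>2)"
        by (rule hom_part_norm_square_le[OF ZC])
      also have "\<dots> \<le> C"
        by (rule C[OF _ _ d]) (use ZC row[of t] t in \<open>auto simp: mat_tuple_def Z_def[abs_def]\<close>)
      finally have "(LINT U|H. (norm (hom_part g k d n Z U))\<^sup>2) \<le> C" .
      moreover have "(norm (hom_part g k d n Z U))\<^sup>2 = (t\<^sup>2) ^ n * (norm (hom_part g k d n X U))\<^sup>2" for U
        using t by (simp add: hZ norm_mult norm_power power_mult_distrib power_mult[symmetric] mult.commute)
      ultimately have "(t\<^sup>2) ^ n * (LINT U|H. (norm (hom_part g k d n X U))\<^sup>2) \<le> C"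
        by simp
      then have "inverse ((t\<^sup>2) ^ n) * ((t\<^sup>2) ^ n * (LINT U|H. (norm (hom_part g k d n X U))\<^sup>2)) \<le> inverse ((t\<^sup>2) ^ n) * C"
        by (intro mult_left_mono) auto
      moreover have "inverse ((t\<^sup>2) ^ n) * ((t\<^sup>2) ^ n * x) = x" for x
        using t by simp
      ultimately show ?thesis
        by (simp only: power_inverse mult.commute)
    qed
    have "1 < t\<^sup>2"
      using t by (simp add: one_less_power)
    then have "0 \<le> inverse (t\<^sup>2)" "inverse (t\<^sup>2) < 1"
      by (simp_all add: inverse_less_1_iff)
    with main show ?thesis
      by blast
  qed
  have XC: "X j \<in> carrier_mat k k" and YC: "Y j \<in> carrier_mat k' k'" if "j < g" for j
    using XY that by (simp_all add: mat_tuple_def)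
  obtain C q where q: "0 \<le> q" "q < 1"
    and C: "\<And>d n. d \<ge> 1 \<Longrightarrow> (LINT U|haar_power g (haar d). (norm (hom_part g k d n X U))\<^sup>2) \<le> C * q ^ n"
    using decay[OF k(1) XY(1) rad(1)] by blast
  obtain C' q' where q': "0 \<le> q'" "q' < 1"
    and C': "\<And>d n. d \<ge> 1 \<Longrightarrow> (LINT U|haar_power g (haar d). (norm (hom_part g k' d n Y U))\<^sup>2) \<le> C' * q' ^ n"
    using decay[OF k(2) XY(2) rad(2)] by blast
  define M where "M = mat_sum (k * k') g (\<lambda>j. X j \<otimes>\<^sub>K conj_mat (Y j))"
  define a where "a n d = (LINT U|haar_power g (haar d). hom_part g k d n X U * cnj (hom_part g k' d n Y U))" for n d
  define b where "b n = sym_trace n {..<k * k'} (\<lambda>x y. M $$ (x, y))" for n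
  have a_bound: "norm (a n d) \<le> C * q ^ n + C' * q' ^ n" if d: "d \<ge> 1" for n d
  proof -
    interpret haar_unitary d g "haar d"
      by standard (rule haar[OF d])
    show ?thesis
      unfolding a_def by (rule order_trans[OF norm_hom_part_mult_le add_mono[OF C[OF d] C'[OF d]]])
  qed
  \<comment> \<open>The geometric majorant is the same for all \<open>d \<ge> 1\<close>. Besides the
    exchange of limit and sum it yields the absolute convergence of the limit series, on which its
    evaluation as an inverse determinant rests.\<close>
  have tannery: "eventually (\<lambda>d. summable (\<lambda>n. norm (a n d))) sequentially \<and> summable (\<lambda>n. norm (b n))
      \<and> (\<lambda>d. \<Sum>n. a n d) \<longlonglongrightarrow> suminf b"
  proof (rule tannerys_theorem)
    show "(\<lambda>d. a n d) \<longlonglongrightarrow> b n" for n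
      unfolding a_def b_def M_def by (rule hom_part_moment_limit[OF haar XC YC])
    show "eventually (\<lambda>(n, d). norm (a n d) \<le> C * q ^ n + C' * q' ^ n) (at_top \<times>\<^sub>F sequentially)"
      unfolding eventually_prod_filter
      by (intro exI[of _ "\<lambda>_. True"] exI[of _ "\<lambda>d. d \<ge> 1"]) (auto simp: a_bound eventually_ge_at_top)
    show "summable (\<lambda>n. C * q ^ n + C' * q' ^ n)"
      using q q' by (intro summable_add summable_mult summable_geometric) auto
  qed simp
  have "(\<lambda>d. \<Sum>n. a n d) \<longlonglongrightarrow> inverse (Determinant.det (1\<^sub>m (k * k') - M))"
    using tannery suminf_sym_trace[of M "k * k'"] by (simp add: b_def[abs_def] M_def mat_sum_carrier)
  moreover have "eventually (\<lambda>d. (\<Sum>n. a n d) = (LINT U|haar_power g (haar d).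
      Determinant.det (lin_pencil g k d X U) * cnj (Determinant.det (lin_pencil g k' d Y U)))) sequentially"
    using eventually_ge_at_top[of 1]
  proof eventually_elim
    case (elim d)
    interpret haar_unitary d g "haar d"
      by standard (rule haar[OF elim])
    define N where "N = max (k * d) (k' * d)"
    have zero: "a n d = 0" if "n \<notin> {..N}" for n
    proof -
      have "hom_part g k d n X U = 0" if "U \<in> space H" for U
      proof (rule det_lin_pencil(2)[OF XC])
        show "U j \<in> carrier_mat d d" if "j < g" for j
          using space_H[OF \<open>U \<in> space H\<close> that] by (simp add: unitary_group_def)
        show "k * d < n"
          using \<open>n \<notin> {..N}\<close> by (simp add: N_def)
      qed
      then have "a n d = (LINT U|H. 0)"
        unfolding a_def by (intro Bochner_Integration.integral_cong refl) simp
      then show ?thesis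
        by simp
    qed
    have "(\<Sum>n. a n d) = (\<Sum>n\<le>N. a n d)"
      by (rule suminf_finite) (use zero in auto)
    also have "\<dots> = (LINT U|H. Determinant.det (lin_pencil g k d X U) * cnj (Determinant.det (lin_pencil g k' d Y U)))"
      unfolding a_def by (rule integral_det_mult[OF XC YC, symmetric]) (auto simp: N_def)
    finally show ?case .
  qed
  ultimately show "(\<lambda>d. LINT U|haar_power g (haar d).
            Determinant.det (lin_pencil g k d X U) * cnj (Determinant.det (lin_pencil g k' d Y U)))
      \<longlonglongrightarrow> inverse (Determinant.det
            (1\<^sub>m k \<otimes>\<^sub>K 1\<^sub>m k' - mat_sum (k * k') g (\<lambda>j. X j \<otimes>\<^sub>K conj_mat (Y j))))"
    unfolding kron_one M_def[symmetric] by (rule Lim_transform_eventually)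
qed

end
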